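(* Let $\{f(x;\theta):\theta\in\Theta\}$, $\Theta\subseteq\mathbb R^p$, be a parametric family of densities (not necessarily an exponential family), and let $X,X_1,X_2,\dots$ be i.i.d. with density $f(x;\theta_0)$, $\theta_0\in\Theta$. Let $q_n>0$ be a sequence such that $q_n\to1$ and $\theta_n^*\to\theta_0$ as $n\to\infty$, where $\theta_n^*$ is the solution of $E_{\theta_0}U^*(X;\theta_n^*,q_n)=0$. Suppose $U^*(x;\theta,q)$ is twice differentiable in $\theta$ for every $x$ and assume the following: (C.1) $\max_{1\le k\le p}E_{\theta_0}|U_k^*(X;\theta_n^*,q_n)|^3$ is upper bounded by a constant (not depending on $n$). (C.2) The smallest eigenvalue of $K_n$ is bounded away from zero. (C.3) $E_{\theta_0}\{I^*(X;\theta_n^*,q_n)\}_{kl}^2$, $k,l=1,\dots,p$, are upper bounded by a constant (not depending on $n$). (C.4) The second-order partial derivatives (in $\theta$) of $U^*(x;\theta,q_n)$ are dominated by an integrable function with respect to the true distribution of $X$ for all $\theta$ in a neighborhood of $\theta_0$ and $q_n$ in a neighborhood of $1$. Let $\widetilde\theta_n$ be the maximum L$q$-likelihood estimator with $q=q_n$. Then $$\sqrt n\,V_n^{-1/2}(\widetilde\theta_n-\theta_n^* )\xrightarrow{\ \mathscr D\ }N_p(0,\mathbf I)\qquad\text{as }n\to\infty,$$ where $V_n=J_n^{-1}K_nJ_n^{-1}$ with $$K_n=E_{\theta_0}\big[U^*(X;\theta_n^*,q_n)\big]^{\mathsf T}\big[U^*(X;\theta_n^*,q_n)\big],\qquad J_n=E_{\theta_0}\big[\nabla_\theta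 U^*(X;\theta_n^*,q_n)\big].$$
   Context: Densities are with respect to a $\sigma$-finite measure $\mu$ on a measurable space $(\Omega,\mathscr F)$; $E_{\theta_0}$ denotes expectation when $X$ has density $f(\cdot;\theta_0)$. For $u>0$, $L_q(u)=\log u$ if $q=1$ and $L_q(u)=(u^{1-q}-1)/(1-q)$ if $q\neq1$ ($q>0$). The maximum L$q$-likelihood estimator (ML$q$E) is $\widetilde\theta_n=\arg\max_{\theta\in\Theta}\sum_{i=1}^nL_{q_n}[f(X_i;\theta)]$, which solves the $L_q$-likelihood equation $\sum_{i=1}^nU^*(X_i;\theta,q_n)=0$. Score $U(x;\theta)=\nabla_\theta\log f(x;\theta)$ (viewed as a $1\times p$ row vector, so that $U^{\mathsf T}U$ is $p\times p$) and modified score $U^*(x;\theta,q)=U(x;\theta)f(x;\theta)^{1-q}$ with components $U^*_k$, $k=1,\dots,p$. $I^*(x;\theta,q)=\nabla_\theta U^*(x;\theta,q)$ is the symmetric $p\times p$ matrix of first partial derivatives of $U^*$ in $\theta$. $V_n^{-1/2}$ is the inverse of the symmetric positive definite square root of $V_n$.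
   Formalization: The formal theorem also assumes that the maximum Lq-likelihood estimator converges in probability to θ_0; without this the claim is false, and the conclusion itself forces it. Densities are taken positive everywhere, and θ_0, θ_n* interior to Θ. *)

theory Defs
  imports "HOL-Probability.Probability"
begin

section \<open>Matrices\<close>

definition eigenvalue :: "real^'n^'n \<Rightarrow> real \<Rightarrow> bool" where
  "eigenvalue A c \<longleftrightarrow> (\<exists>v. v \<noteq> 0 \<and> A *v v = c *\<^sub>R v)"

text \<open>Only meaningful for symmetric matrices, whose spectrum is a finite nonempty set of reals.\<close>

definition smallest_eigenvalue :: "real^'n^'n \<Rightarrow> real" where
  "smallest_eigenvalue A = Min {c. eigenvalue A c}"

definition sym_pos_def :: "real^'n^'n \<Rightarrow> bool" where
  "sym_pos_def A \<longleftrightarrow> transpose A = A \<and> (\<forall>v. v \<noteq> 0 \<longrightarrow> 0 < v \<bullet> (A *v v))"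

definition spd_sqrt :: "real^'n^'n \<Rightarrow> real^'n^'n" where
  "spd_sqrt A = (THE S. sym_pos_def S \<and> S ** S = A)"

definition inv_sqrt :: "real^'n^'n \<Rightarrow> real^'n^'n" where
  "inv_sqrt A = matrix_inv (spd_sqrt A)"


section \<open>Convergence of random vectors\<close>

text \<open>Convergence in distribution in the sense of bounded continuous test functions (the
  library's \<^const>\<open>weak_conv_m\<close> covers the real line only).\<close>

definition weak_conv_vec :: "(nat \<Rightarrow> (real^'n) measure) \<Rightarrow> (real^'n) measure \<Rightarrow> bool" where
  "weak_conv_vec N L \<longleftrightarrow>
     (\<forall>g :: real^'n \<Rightarrow> real. continuous_on UNIV g \<and> bounded (range g) \<longrightarrow>
        (\<lambda>n. LINT y|N n. g y) \<longlonglongrightarrow> (LINT y|L. g y))"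

definition std_normal_vec :: "(real^'n) measure" where
  "std_normal_vec = density lborel (\<lambda>y. ennreal (\<Prod>k\<in>UNIV. std_normal_density (y $ k)))"

definition conv_in_prob :: "'w measure \<Rightarrow> (nat \<Rightarrow> 'w \<Rightarrow> real^'n) \<Rightarrow> real^'n \<Rightarrow> bool" where
  "conv_in_prob P T t \<longleftrightarrow>
     (\<forall>\<epsilon>>0. (\<lambda>n. measure P {\<omega> \<in> space P. dist (T n \<omega>) t > \<epsilon>}) \<longlonglongrightarrow> 0)"


section \<open>Derivatives in the parameter\<close>

definition grad :: "(real^'p \<Rightarrow> real) \<Rightarrow> real^'p \<Rightarrow> real^'p" where
  "grad g \<theta> = (\<chi> k. frechet_derivative g (at \<theta>) (axis k 1))"

definition twice_differentiable_at :: "(real^'p \<Rightarrow> real^'p) \<Rightarrow> real^'p \<Rightarrow> bool" where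
  "twice_differentiable_at g \<theta> \<longleftrightarrow>
     (\<forall>\<^sub>F t in nhds \<theta>. g differentiable (at t)) \<and> (\<lambda>t. jacobian g (at t)) differentiable (at \<theta>)"


section \<open>Parametric families and the L\<open>q\<close>-likelihood\<close>

text \<open>The densities are strictly positive on the whole sample space: \<open>L\<^sub>q\<close> and the score
  are only defined where the density is positive.\<close>

definition density_family ::
    "'a measure \<Rightarrow> (real^'p) set \<Rightarrow> ('a \<Rightarrow> real^'p \<Rightarrow> real) \<Rightarrow> bool" where
  "density_family \<mu> \<Theta> f \<longleftrightarrow>
     (\<forall>\<theta>\<in>\<Theta>. (\<lambda>x. f x \<theta>) \<in> borel_measurable \<mu> \<and> (\<forall>x\<in>space \<mu>. 0 < f x \<theta>) \<and>
            (\<integral>\<^sup>+x. ennreal (f x \<theta>) \<partial>\<mu>) = 1)"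

definition law :: "'a measure \<Rightarrow> ('a \<Rightarrow> real^'p \<Rightarrow> real) \<Rightarrow> real^'p \<Rightarrow> 'a measure" where
  "law \<mu> f \<theta> = density \<mu> (\<lambda>x. ennreal (f x \<theta>))"

definition Lq :: "real \<Rightarrow> real \<Rightarrow> real" where
  "Lq q u = (if q = 1 then ln u else (u powr (1 - q) - 1) / (1 - q))"

definition is_MLqE ::
    "('a \<Rightarrow> real^'p \<Rightarrow> real) \<Rightarrow> (real^'p) set \<Rightarrow> real \<Rightarrow> nat \<Rightarrow> (nat \<Rightarrow> 'a) \<Rightarrow> real^'p \<Rightarrow> bool" where
  "is_MLqE f \<Theta> q n x t \<longleftrightarrow> is_arg_max (\<lambda>\<theta>. \<Sum>i=1..n. Lq q (f (x i) \<theta>)) (\<lambda>\<theta>. \<theta> \<in> \<Theta>) t"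

definition score :: "('a \<Rightarrow> real^'p \<Rightarrow> real) \<Rightarrow> 'a \<Rightarrow> real^'p \<Rightarrow> real^'p" where
  "score f x \<theta> = grad (\<lambda>t. ln (f x t)) \<theta>"

definition mod_score :: "('a \<Rightarrow> real^'p \<Rightarrow> real) \<Rightarrow> 'a \<Rightarrow> real^'p \<Rightarrow> real \<Rightarrow> real^'p" where
  "mod_score f x \<theta> q = (f x \<theta> powr (1 - q)) *\<^sub>R score f x \<theta>"

text \<open>The matrix \<open>I\<^sup>*\<close>: entry \<open>(k, l)\<close> is \<open>\<partial>\<^sub>l U\<^sup>*\<^sub>k\<close>.\<close>

definition mod_info :: "('a \<Rightarrow> real^'p \<Rightarrow> real) \<Rightarrow> 'a \<Rightarrow> real^'p \<Rightarrow> real \<Rightarrow> real^'p^'p" where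
  "mod_info f x \<theta> q = jacobian (\<lambda>t. mod_score f x t q) (at \<theta>)"

text \<open>The second-order partial derivative \<open>\<partial>\<^sub>m \<partial>\<^sub>l U\<^sup>*\<^sub>k\<close>.\<close>

definition mod_score_d2 ::
    "('a \<Rightarrow> real^'p \<Rightarrow> real) \<Rightarrow> 'a \<Rightarrow> real^'p \<Rightarrow> real \<Rightarrow> 'p \<Rightarrow> 'p \<Rightarrow> 'p \<Rightarrow> real" where
  "mod_score_d2 f x \<theta> q k l m = grad (\<lambda>t. mod_info f x t q $ k $ l) \<theta> $ m"

text \<open>In the next three definitions \<open>P\<close> is the true distribution of \<open>X\<close>. Scores are row vectors,
  so \<open>U\<^sup>T U\<close> has the entries \<open>U\<^sub>k U\<^sub>l\<close>.\<close>

definition K_mat :: "'a measure \<Rightarrow> ('a \<Rightarrow> real^'p \<Rightarrow> real) \<Rightarrow> real^'p \<Rightarrow> real \<Rightarrow> real^'p^'p" where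
  "K_mat P f \<theta> q = (LINT x|P. (\<chi> k l. mod_score f x \<theta> q $ k * mod_score f x \<theta> q $ l))"

definition J_mat :: "'a measure \<Rightarrow> ('a \<Rightarrow> real^'p \<Rightarrow> real) \<Rightarrow> real^'p \<Rightarrow> real \<Rightarrow> real^'p^'p" where
  "J_mat P f \<theta> q = (LINT x|P. mod_info f x \<theta> q)"

definition V_mat :: "'a measure \<Rightarrow> ('a \<Rightarrow> real^'p \<Rightarrow> real) \<Rightarrow> real^'p \<Rightarrow> real \<Rightarrow> real^'p^'p" where
  "V_mat P f \<theta> q = matrix_inv (J_mat P f \<theta> q) ** K_mat P f \<theta> q ** matrix_inv (J_mat P f \<theta> q)"

end

theory Submission
  imports Defs
begin

text \<open>Write \<open>U\<^sub>n\<close>, \<open>I\<^sub>n\<close> for the modified score and its Jacobian at \<open>(\<theta>s n, q n)\<close>, and put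
  \<open>D\<^sub>n = \<surd>n (T\<^sub>n - \<theta>s n)\<close>. With probability tending to one the estimator lies in a ball around
  \<open>\<theta>0\<close> inside the parameter set, where it solves the estimating equation. Expanding that
  equation at \<open>\<theta>s n\<close> gives \<open>S\<^sub>n + A\<^sub>n D\<^sub>n + r\<^sub>n = 0\<close>, where \<open>S\<^sub>n\<close> is \<open>n\<^sup>-\<^sup>1\<^sup>/\<^sup>2\<close> times the sum of the
  \<open>U\<^sub>n (X\<^sub>i)\<close>, \<open>A\<^sub>n\<close> is the average of the \<open>I\<^sub>n (X\<^sub>i)\<close> and \<open>r\<^sub>n\<close> is bounded by
  \<open>\<bar>T\<^sub>n - \<theta>s n\<bar> \<bar>D\<^sub>n\<bar>\<close> times an average of the dominating function. By Chebyshev's inequality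
  \<open>A\<^sub>n - J\<^sub>n\<close> tends to zero in probability, so \<open>Z\<^sub>n = V\<^sub>n\<^sup>-\<^sup>1\<^sup>/\<^sup>2 D\<^sub>n\<close> differs negligibly from \<open>- G\<^sub>n S\<^sub>n\<close> with
  \<open>G\<^sub>n = V\<^sub>n\<^sup>-\<^sup>1\<^sup>/\<^sup>2 J\<^sub>n\<^sup>-\<^sup>1\<close> (\<open>remainder_negligible\<close>).

  The matrix \<open>G\<^sub>n\<close> whitens \<open>U\<^sub>n\<close> exactly: \<open>G\<^sub>n K\<^sub>n G\<^sub>n\<^sup>T\<close> is the identity for each \<open>n\<close>. Hence every
  linear form in \<open>- G\<^sub>n S\<^sub>n\<close> is a normalised sum of a triangular array of fixed variance and bounded
  third absolute moment, its characteristic function converges to the Gaussian one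
  (\<open>whitened_score_char_limit\<close>), and the continuity theorem in several dimensions
  (\<open>levy_continuity_vec\<close>) concludes. No limit of \<open>V\<^sub>n\<^sup>-\<^sup>1\<^sup>/\<^sup>2\<close> has to be identified.

  The invertibility of \<open>J\<^sub>n\<close> is a consequence of the other conditions. The moment bounds make
  \<open>K\<^sub>n\<close> and \<open>J\<^sub>n\<close> converge to the second moment \<open>K\<close> of the ordinary score and to the mean \<open>J\<close> of
  its Jacobian at \<open>\<theta>0\<close>. Because the densities integrate to one, \<open>- J\<close> dominates \<open>K\<close> as a
  quadratic form (\<open>information_inequality\<close>), and \<open>K\<close> inherits the lower bound on the eigenvalues
  of the \<open>K\<^sub>n\<close>. So \<open>J\<^sub>n\<close> is invertible for all large \<open>n\<close>, with bounded inverse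
  (\<open>J_eventually_coercive\<close>).\<close>

section \<open>Symmetric matrices and square roots\<close>

lemma symmetric_iff_self_adjoint:
  fixes A :: "real^'n^'n"
  shows "transpose A = A \<longleftrightarrow> (\<forall>v w. v \<bullet> (A *v w) = (A *v v) \<bullet> w)"
proof
  assume "transpose A = A"
  then show "\<forall>v w. v \<bullet> (A *v w) = (A *v v) \<bullet> w"
    by (metis dot_lmul_matrix transpose_matrix_vector)
next
  assume *: "\<forall>v w. v \<bullet> (A *v w) = (A *v v) \<bullet> w"
  have "transpose A *v v = A *v v" for v
  proof -
    have "(transpose A *v v) \<bullet> w = (A *v v) \<bullet> w" for w
      using * by (simp add: dot_lmul_matrix)
    then show ?thesis
      by (metis vector_eq_ldot inner_commute)
  qed
  then show "transpose A = A"
    by (simp add: matrix_eq del: transpose_matrix_vector)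
qed

lemma affine_quadratic_nonneg_imp_zero:
  fixes a b :: real
  assumes "\<And>s. 0 \<le> 2 * s * a + s\<^sup>2 * b"
  shows "a = 0"
proof (rule ccontr)
  assume "a \<noteq> 0"
  define B where "B = \<bar>b\<bar> + 1"
  have B: "B > 0" "b < B" by (auto simp: B_def)
  have "0 \<le> 2 * (- a / B) * a + (- a / B)\<^sup>2 * b"
    by (rule assms)
  also have "\<dots> = a\<^sup>2 / B * (b / B - 2)"
    using B by (simp add: power2_eq_square field_simps)
  finally have "0 \<le> a\<^sup>2 / B * (b / B - 2)" .
  moreover have "a\<^sup>2 / B > 0" using \<open>a \<noteq> 0\<close> B by simp
  moreover have "b / B - 2 < 0" using B by (simp add: field_simps)
  ultimately show False by (smt (verit) mult_pos_neg)
qed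

text \<open>The minimum of the quadratic form over the unit sphere exists by compactness, and the
  first-order condition at a minimiser is the eigenvalue equation.\<close>

lemma rayleigh_minimum_eigenvalue:
  fixes A :: "real^'n^'n"
  assumes sym: "transpose A = A"
  obtains c where "eigenvalue A c" "\<And>w. c * (norm w)\<^sup>2 \<le> w \<bullet> (A *v w)"
proof -
  have adj: "v \<bullet> (A *v w) = (A *v v) \<bullet> w" for v w
    using sym symmetric_iff_self_adjoint by blast
  have "axis undefined 1 \<in> sphere (0::real^'n) 1"
    by (simp add: norm_axis_1)
  then have ne: "sphere (0::real^'n) 1 \<noteq> {}" by blast
  have cont: "continuous_on (sphere 0 1) (\<lambda>w::real^'n. w \<bullet> (A *v w))"
    by (intro continuous_intros linear_continuous_on matrix_vector_mul_bounded_linear)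
  obtain v where v: "norm v = 1"
    and min: "\<And>w. norm w = 1 \<Longrightarrow> v \<bullet> (A *v v) \<le> w \<bullet> (A *v w)"
    using continuous_attains_inf[OF compact_sphere ne cont] by auto
  define c where "c = v \<bullet> (A *v v)"
  have quad: "c * (norm w)\<^sup>2 \<le> w \<bullet> (A *v w)" for w
  proof (cases "w = 0")
    case False
    have "c \<le> (w /\<^sub>R norm w) \<bullet> (A *v (w /\<^sub>R norm w))"
      unfolding c_def by (rule min) (simp add: False)
    also have "\<dots> = (w \<bullet> (A *v w)) / (norm w)\<^sup>2"
      by (simp add: matrix_vector_mult_scaleR power2_eq_square field_simps)
    finally show ?thesis using False by (simp add: field_simps)
  qed simp
  define u where "u = A *v v - c *\<^sub>R v"
  have "0 \<le> 2 * s * (norm u)\<^sup>2 + s\<^sup>2 * (u \<bullet> (A *v u) - c * (norm u)\<^sup>2)" for s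
  proof -
    have "0 \<le> (v + s *\<^sub>R u) \<bullet> (A *v (v + s *\<^sub>R u)) - c * (norm (v + s *\<^sub>R u))\<^sup>2"
      using quad by simp
    also have "\<dots> = (v \<bullet> (A *v v) - c * (v \<bullet> v)) + 2 * s * (u \<bullet> (A *v v) - c * (u \<bullet> v))
        + s\<^sup>2 * (u \<bullet> (A *v u) - c * (norm u)\<^sup>2)"
      using adj[of v u] unfolding power2_norm_eq_inner
      by (simp add: matrix_vector_right_distrib matrix_vector_mult_scaleR
          inner_add_left inner_add_right inner_commute algebra_simps power2_eq_square)
    also have "v \<bullet> (A *v v) - c * (v \<bullet> v) = 0"
      using v by (simp add: c_def norm_eq_1)
    also have "u \<bullet> (A *v v) - c * (u \<bullet> v) = (norm u)\<^sup>2"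
      by (simp add: power2_norm_eq_inner, simp add: u_def inner_diff_right)
    finally show ?thesis by simp
  qed
  then have "(norm u)\<^sup>2 = 0"
    by (rule affine_quadratic_nonneg_imp_zero)
  then have "A *v v = c *\<^sub>R v" by (simp add: u_def)
  moreover have "v \<noteq> 0" using v by auto
  ultimately have "eigenvalue A c" unfolding eigenvalue_def by blast
  with quad show ?thesis using that by blast
qed

text \<open>Eigenvectors of distinct eigenvalues are orthogonal, hence independent. Finiteness is what
  makes the minimum in \<^const>\<open>smallest_eigenvalue\<close> a lower bound.\<close>

lemma finite_eigenvalues_symmetric:
  fixes A :: "real^'n^'n"
  assumes sym: "transpose A = A"
  shows "finite {c. eigenvalue A c}"
proof -
  have adj: "v \<bullet> (A *v w) = (A *v v) \<bullet> w" for v w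
    using sym symmetric_iff_self_adjoint by blast
  define e where "e c = (SOME v. v \<noteq> 0 \<and> A *v v = c *\<^sub>R v)" for c
  have e: "e c \<noteq> 0 \<and> A *v e c = c *\<^sub>R e c" if "eigenvalue A c" for c
    using that unfolding e_def eigenvalue_def by (rule someI_ex)
  have orth: "e c \<bullet> e d = 0" if "eigenvalue A c" "eigenvalue A d" "c \<noteq> d" for c d
    using adj[of "e c" "e d"] e[OF that(1)] e[OF that(2)] that(3) by auto
  have inj: "inj_on e {c. eigenvalue A c}"
    by (rule inj_onI) (metis e inner_eq_zero_iff mem_Collect_eq orth)
  have "independent (e ` {c. eigenvalue A c})"
  proof (rule pairwise_orthogonal_independent)
    show "pairwise orthogonal (e ` {c. eigenvalue A c})"
      by (auto simp: pairwise_def orthogonal_def intro!: orth)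
    show "0 \<notin> e ` {c. eigenvalue A c}" using e by force
  qed
  then have "finite (e ` {c. eigenvalue A c})"
    by (rule independent_imp_finite)
  then show ?thesis using inj finite_imageD by blast
qed

lemma smallest_eigenvalue_le_quadratic_form:
  fixes A :: "real^'n^'n"
  assumes sym: "transpose A = A"
  shows "smallest_eigenvalue A * (norm w)\<^sup>2 \<le> w \<bullet> (A *v w)"
proof -
  obtain c where c: "eigenvalue A c" and q: "\<And>w. c * (norm w)\<^sup>2 \<le> w \<bullet> (A *v w)"
    using rayleigh_minimum_eigenvalue[OF sym] by blast
  have "smallest_eigenvalue A \<le> c"
    unfolding smallest_eigenvalue_def using finite_eigenvalues_symmetric[OF sym] c by simp
  then show ?thesis using q[of w] by (meson mult_right_mono order_trans zero_le_power2)
qed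

lemma sym_pos_def_coercive:
  fixes A :: "real^'n^'n"
  assumes "sym_pos_def A"
  obtains m where "m > 0" "\<And>w. m * (norm w)\<^sup>2 \<le> w \<bullet> (A *v w)"
proof -
  have sym: "transpose A = A" and pos: "\<And>v. v \<noteq> 0 \<Longrightarrow> 0 < v \<bullet> (A *v v)"
    using assms by (auto simp: sym_pos_def_def)
  obtain c where c: "eigenvalue A c" and q: "\<And>w. c * (norm w)\<^sup>2 \<le> w \<bullet> (A *v w)"
    using rayleigh_minimum_eigenvalue[OF sym] by blast
  obtain v where "v \<noteq> 0" "A *v v = c *\<^sub>R v" using c by (auto simp: eigenvalue_def)
  then have "c > 0" using pos[of v] inner_ge_zero[of v] by (auto simp: zero_less_mult_iff)
  with q that show ?thesis by blast
qed

text \<open>Rescaled, \<open>A = c (I - B)\<close> with \<open>B\<close> symmetric of operator norm below \<open>1\<close>. A root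
  \<open>I - Y\<close> of \<open>I - B\<close> amounts to a fixed point of \<open>Y \<mapsto> (B + Y\<^sup>2) / 2\<close>, which is a
  contraction of a small ball of self-adjoint operators.\<close>

lemma sym_pos_def_sqrt_exists:
  fixes A :: "real^'n^'n"
  assumes A: "sym_pos_def A"
  obtains S where "sym_pos_def S" "S ** S = A"
proof -
  have sym: "transpose A = A" using A by (simp add: sym_pos_def_def)
  have adj: "v \<bullet> (A *v w) = (A *v v) \<bullet> w" for v w
    using sym symmetric_iff_self_adjoint by blast
  obtain m where m: "m > 0" and low: "\<And>w. m * (norm w)\<^sup>2 \<le> w \<bullet> (A *v w)"
    using sym_pos_def_coercive[OF A] by blast
  obtain L0 where L0: "\<And>w. norm (A *v w) \<le> norm w * L0"
    using bounded_linear.bounded[OF matrix_vector_mul_bounded_linear[of A]] by blast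
  define L where "L = max L0 1"
  have L: "norm (A *v w) \<le> L * norm w" "L > 0" for w
    using order_trans[OF L0[of w] mult_left_mono[of L0 L "norm w"]]
    by (auto simp: L_def mult.commute)
  define c where "c = max (L\<^sup>2 / m) m"
  have c: "c > 0" "L\<^sup>2 \<le> c * m" "m \<le> c" using m L(2) by (auto simp: c_def field_simps max_def)
  define B where "B = Blinfun (\<lambda>v. v - (1 / c) *\<^sub>R (A *v v))"
  have blB: "bounded_linear (\<lambda>v. v - (1 / c) *\<^sub>R (A *v v))"
    by (intro bounded_linear_intros matrix_vector_mul_bounded_linear)
  have B: "blinfun_apply B v = v - (1 / c) *\<^sub>R (A *v v)" for v
    unfolding B_def using blB by (simp add: bounded_linear_Blinfun_apply)
  have Badj: "v \<bullet> blinfun_apply B w = blinfun_apply B v \<bullet> w" for v w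
    by (simp add: B inner_diff_right inner_diff_left adj)
  have mc: "m / c \<le> 1" "m / c > 0" using c m by auto
  define \<beta> where "\<beta> = sqrt (1 - m / c)"
  have \<beta>: "0 \<le> \<beta>" "\<beta> < 1" using mc by (auto simp: \<beta>_def)
  have nB: "norm B \<le> \<beta>"
  proof (rule norm_blinfun_bound[OF \<beta>(1)])
    fix v
    have "(norm (blinfun_apply B v))\<^sup>2 = (norm v)\<^sup>2 - 2 / c * (v \<bullet> (A *v v)) + (norm (A *v v))\<^sup>2 / c\<^sup>2"
      unfolding B power2_norm_eq_inner
      by (simp add: inner_diff_left inner_diff_right inner_commute power2_eq_square algebra_simps)
    also have "\<dots> \<le> (norm v)\<^sup>2 - 2 / c * (m * (norm v)\<^sup>2) + (c * m * (norm v)\<^sup>2) / c\<^sup>2"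
    proof -
      have "(norm (A *v v))\<^sup>2 \<le> L\<^sup>2 * (norm v)\<^sup>2"
        using power_mono[OF L(1)[of v] norm_ge_zero, of 2] by (simp add: power_mult_distrib)
      also have "\<dots> \<le> c * m * (norm v)\<^sup>2" by (intro mult_right_mono c) simp
      finally have 1: "(norm (A *v v))\<^sup>2 / c\<^sup>2 \<le> (c * m * (norm v)\<^sup>2) / c\<^sup>2"
        by (intro divide_right_mono) auto
      have 2: "2 / c * (m * (norm v)\<^sup>2) \<le> 2 / c * (v \<bullet> (A *v v))"
        using low c(1) by (intro mult_left_mono) auto
      show ?thesis using 1 2 by linarith
    qed
    also have "\<dots> = (\<beta> * norm v)\<^sup>2"
      using c(1) mc by (simp add: \<beta>_def power_mult_distrib field_simps power2_eq_square)
    finally show "norm (blinfun_apply B v) \<le> \<beta> * norm v"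
      by (rule power2_le_imp_le) (use \<beta> in simp)
  qed
  \<comment> \<open>the radius solves \<open>(\<beta> + \<rho>\<^sup>2) / 2 = \<rho>\<close>\<close>
  define \<rho> where "\<rho> = 1 - sqrt (1 - \<beta>)"
  have \<rho>: "0 \<le> \<rho>" "\<rho> < 1" using \<beta> by (auto simp: \<rho>_def)
  have \<rho>_eq: "(\<beta> + \<rho> * \<rho>) / 2 = \<rho>"
  proof -
    have "(1 - \<rho>)\<^sup>2 = 1 - \<beta>" using \<beta> by (simp add: \<rho>_def)
    then show ?thesis by (simp add: power2_eq_square algebra_simps)
  qed
  define D :: "((real^'n) \<Rightarrow>\<^sub>L (real^'n)) set" where
    "D = {Y. norm Y \<le> \<rho> \<and> (\<forall>v w. v \<bullet> blinfun_apply Y w = blinfun_apply Y v \<bullet> w)}"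
  define F :: "((real^'n) \<Rightarrow>\<^sub>L (real^'n)) \<Rightarrow> _" where
    "F Y = (1 / 2) *\<^sub>R (B + (Y o\<^sub>L Y))" for Y
  have clD: "closed D"
    unfolding D_def
    by (intro closed_Collect_conj closed_Collect_le closed_Collect_all closed_Collect_eq continuous_intros)
  have "0 \<in> D" using \<rho> by (simp add: D_def)
  then have neD: "D \<noteq> {}" by blast
  have FD: "F ` D \<subseteq> D"
  proof safe
    fix Y assume Y: "Y \<in> D"
    have "norm (F Y) \<le> (norm B + norm (Y o\<^sub>L Y)) / 2"
      unfolding F_def by (simp add: norm_triangle_ineq)
    also have "\<dots> \<le> (\<beta> + \<rho> * \<rho>) / 2"
    proof -
      have "norm (Y o\<^sub>L Y) \<le> norm Y * norm Y" by (rule norm_blinfun_compose)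
      also have "\<dots> \<le> \<rho> * \<rho>" using Y \<rho> by (intro mult_mono) (auto simp: D_def)
      finally show ?thesis using nB by simp
    qed
    finally have "norm (F Y) \<le> \<rho>" using \<rho>_eq by simp
    moreover have "v \<bullet> blinfun_apply (F Y) w = blinfun_apply (F Y) v \<bullet> w" for v w
      using Y Badj[of v w]
      by (simp add: F_def D_def blinfun.bilinear_simps inner_add_left inner_add_right)
    ultimately show "F Y \<in> D" by (simp add: D_def)
  qed
  have lip: "dist (F Y) (F Z) \<le> \<rho> * dist Y Z" if "Y \<in> D" "Z \<in> D" for Y Z
  proof -
    have "F Y - F Z = (1 / 2) *\<^sub>R ((Y o\<^sub>L (Y - Z)) + ((Y - Z) o\<^sub>L Z))"
      by (rule blinfun_eqI) (simp add: F_def blinfun.bilinear_simps algebra_simps)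
    then have "norm (F Y - F Z) \<le> (norm (Y o\<^sub>L (Y - Z)) + norm ((Y - Z) o\<^sub>L Z)) / 2"
      by (simp add: norm_triangle_ineq)
    also have "\<dots> \<le> (norm Y * norm (Y - Z) + norm (Y - Z) * norm Z) / 2"
      by (intro divide_right_mono add_mono norm_blinfun_compose) auto
    also have "\<dots> \<le> (\<rho> * norm (Y - Z) + norm (Y - Z) * \<rho>) / 2"
      using that by (intro divide_right_mono add_mono mult_mono) (auto simp: D_def \<rho>)
    finally show ?thesis by (simp add: dist_norm mult.commute)
  qed
  obtain Y where Y: "Y \<in> D" "F Y = Y"
    using Banach_fix[OF complete_eq_closed[THEN iffD2, OF clD] neD \<rho> FD lip] by blast
  have Yadj: "v \<bullet> blinfun_apply Y w = blinfun_apply Y v \<bullet> w" for v w using Y(1) by (simp add: D_def)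
  define S where "S = matrix (\<lambda>v. sqrt c *\<^sub>R (v - blinfun_apply Y v))"
  have "linear (\<lambda>v. sqrt c *\<^sub>R (v - blinfun_apply Y v))"
    by (intro bounded_linear.linear bounded_linear_intros)
  then have S: "S *v v = sqrt c *\<^sub>R (v - blinfun_apply Y v)" for v
    unfolding S_def by (metis matrix_vector_mul)
  have "S ** S = A"
  proof (subst matrix_eq, rule allI)
    fix v
    have "2 *\<^sub>R blinfun_apply Y v = blinfun_apply B v + blinfun_apply Y (blinfun_apply Y v)"
      by (subst Y(2)[symmetric]) (simp add: F_def blinfun.bilinear_simps)
    then have YY: "blinfun_apply Y (blinfun_apply Y v) = 2 *\<^sub>R blinfun_apply Y v - blinfun_apply B v"
      by (simp add: algebra_simps)
    have "(S ** S) *v v = (sqrt c * sqrt c) *\<^sub>R (v - 2 *\<^sub>R blinfun_apply Y v + blinfun_apply Y (blinfun_apply Y v))"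
      unfolding matrix_vector_mul_assoc[symmetric] S
      by (simp add: blinfun.bilinear_simps algebra_simps scaleR_2)
    also have "\<dots> = c *\<^sub>R (v - blinfun_apply B v)"
      using c(1) unfolding YY by simp
    also have "\<dots> = A *v v" using c(1) by (simp add: B)
    finally show "(S ** S) *v v = A *v v" .
  qed
  moreover have "sym_pos_def S"
    unfolding sym_pos_def_def symmetric_iff_self_adjoint
  proof (intro conjI allI impI)
    fix v w :: "real^'n"
    show "v \<bullet> (S *v w) = (S *v v) \<bullet> w"
      by (simp add: S inner_diff_left inner_diff_right Yadj)
  next
    fix v :: "real^'n" assume "v \<noteq> 0"
    have "v \<bullet> blinfun_apply Y v \<le> norm v * norm (blinfun_apply Y v)" by (rule norm_cauchy_schwarz)
    also have "\<dots> \<le> norm v * (\<rho> * norm v)"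
      using norm_blinfun[of Y v] Y(1)
      by (intro mult_left_mono order_trans[OF norm_blinfun] mult_right_mono) (auto simp: D_def)
    also have "\<dots> < v \<bullet> v"
      using \<rho>(2) \<open>v \<noteq> 0\<close> by (simp add: power2_norm_eq_inner[symmetric] power2_eq_square)
    finally show "0 < v \<bullet> (S *v v)"
      using c(1) by (simp add: S inner_diff_right zero_less_mult_iff)
  qed
  ultimately show ?thesis using that by blast
qed

text \<open>With \<open>D = S - T\<close> one has \<open>S D + D T = 0\<close>; pairing with \<open>D\<close> column by column gives a
  sum of nonnegative terms \<open>D e \<bullet> S (D e)\<close> and \<open>D e \<bullet> T (D e)\<close> that vanishes.\<close>

lemma sym_pos_def_sqrt_unique:
  fixes S T :: "real^'n^'n"
  assumes S: "sym_pos_def S" and T: "sym_pos_def T" and eq: "S ** S = T ** T"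
  shows "S = T"
proof -
  have Sadj: "v \<bullet> (S *v w) = (S *v v) \<bullet> w" and Tadj: "v \<bullet> (T *v w) = (T *v v) \<bullet> w" for v w
    using S T by (auto simp: sym_pos_def_def symmetric_iff_self_adjoint)
  have pos: "0 \<le> v \<bullet> (S *v v)" "0 \<le> v \<bullet> (T *v v)" for v
    using S T by (cases "v = 0"; force simp: sym_pos_def_def less_imp_le)+
  define D where "D v = S *v v - T *v v" for v
  have Dadj: "v \<bullet> D w = D v \<bullet> w" for v w
    by (simp add: D_def inner_diff_left inner_diff_right Sadj Tadj)
  have lin: "linear D" unfolding D_def
    by (intro bounded_linear.linear bounded_linear_intros matrix_vector_mul_bounded_linear)
  have SS: "S *v (S *v v) = T *v (T *v v)" for v
    using eq by (simp add: matrix_vector_mul_assoc)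
  have comm: "S *v (D v) + D (T *v v) = 0" for v
    by (simp add: D_def SS matrix_vector_mult_diff_distrib)
  have "(\<Sum>e\<in>Basis. D e \<bullet> (S *v D e)) + (\<Sum>e\<in>Basis. D e \<bullet> (T *v D e)) = 0"
  proof -
    have "(\<Sum>e\<in>Basis. D e \<bullet> (T *v D e)) = (\<Sum>e\<in>Basis. D e \<bullet> D (T *v e))"
    proof -
      have expand: "\<And>x y::real^'n. x \<bullet> y = (\<Sum>e'\<in>Basis. (x \<bullet> e') * (y \<bullet> e'))"
        by (rule euclidean_inner)
      have "(\<Sum>e\<in>Basis. D e \<bullet> (T *v D e)) = (\<Sum>e\<in>Basis. \<Sum>e'\<in>Basis. (D e \<bullet> e') * ((T *v D e) \<bullet> e'))"
        by (subst expand) rule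
      also have "\<dots> = (\<Sum>e'\<in>Basis. \<Sum>e\<in>Basis. (D e \<bullet> e') * ((T *v D e) \<bullet> e'))"
        by (rule sum.swap)
      also have "\<dots> = (\<Sum>e'\<in>Basis. \<Sum>e\<in>Basis. (D e' \<bullet> e) * (D (T *v e') \<bullet> e))"
      proof (intro sum.cong refl)
        fix e' e :: "real^'n"
        have "D e \<bullet> e' = D e' \<bullet> e" by (metis Dadj inner_commute)
        moreover have "(T *v D e) \<bullet> e' = D (T *v e') \<bullet> e"
          by (metis Dadj Tadj inner_commute)
        ultimately show "(D e \<bullet> e') * ((T *v D e) \<bullet> e') = (D e' \<bullet> e) * (D (T *v e') \<bullet> e)" by simp
      qed
      also have "\<dots> = (\<Sum>e\<in>Basis. D e \<bullet> D (T *v e))"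
        by (subst expand[of "D _"]) rule
      finally show ?thesis .
    qed
    then show ?thesis
      by (simp add: sum.distrib[symmetric] inner_add_right[symmetric] comm)
  qed
  moreover have "0 \<le> (\<Sum>e\<in>Basis. D e \<bullet> (T *v D e))" by (intro sum_nonneg pos)
  ultimately have "(\<Sum>e\<in>Basis. D e \<bullet> (S *v D e)) = 0"
    using sum_nonneg[of Basis "\<lambda>e. D e \<bullet> (S *v D e)"] pos by force
  then have z: "D e \<bullet> (S *v D e) = 0" if "e \<in> Basis" for e
    using that pos by (simp add: sum_nonneg_eq_0_iff)
  have "D e = 0" if "e \<in> Basis" for e
    using z[OF that] S unfolding sym_pos_def_def by force
  then have "D v = 0" for v
    using linear_eq_0_on_span[OF lin, of Basis v] by (simp add: span_Basis)
  then show ?thesis by (simp add: matrix_eq D_def)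
qed

lemma spd_sqrt_properties:
  fixes A :: "real^'n^'n"
  assumes "sym_pos_def A"
  shows "sym_pos_def (spd_sqrt A)" "spd_sqrt A ** spd_sqrt A = A"
proof -
  have "\<exists>!S. sym_pos_def S \<and> S ** S = A"
    using sym_pos_def_sqrt_exists[OF assms] sym_pos_def_sqrt_unique by metis
  from theI'[OF this] show "sym_pos_def (spd_sqrt A)" "spd_sqrt A ** spd_sqrt A = A"
    unfolding spd_sqrt_def by auto
qed

lemma invertible_of_trivial_kernel:
  fixes A :: "real^'n^'n"
  assumes "\<And>v. A *v v = 0 \<Longrightarrow> v = 0"
  shows "invertible A"
  using assms by (simp add: invertible_left_inverse matrix_left_invertible_ker)

lemma matrix_inv_cancel:
  fixes A :: "real^'n^'n"
  assumes "invertible A"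
  shows "A ** matrix_inv A = mat 1" "matrix_inv A ** A = mat 1"
  using assms unfolding invertible_def matrix_inv_def by (metis (mono_tags, lifting) someI_ex)+

lemma transpose_matrix_inv_symmetric:
  fixes A :: "real^'n^'n"
  assumes "invertible A" "transpose A = A"
  shows "transpose (matrix_inv A) = matrix_inv A"
proof -
  have "transpose (matrix_inv A) ** A = mat 1"
    by (metis assms matrix_inv_cancel(1) matrix_transpose_mul transpose_mat)
  then have "transpose (matrix_inv A) ** A ** matrix_inv A = matrix_inv A"
    by simp
  then show ?thesis
    by (simp add: matrix_mul_assoc[symmetric] matrix_inv_cancel(1)[OF assms(1)])
qed

lemma inv_sqrt_properties:
  fixes V :: "real^'n^'n"
  assumes "sym_pos_def V"
  shows "transpose (inv_sqrt V) = inv_sqrt V" "inv_sqrt V ** V ** inv_sqrt V = mat 1"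
proof -
  let ?S = "spd_sqrt V"
  have S: "sym_pos_def ?S" "?S ** ?S = V" by (rule spd_sqrt_properties[OF assms])+
  have inv: "invertible ?S"
    by (rule invertible_of_trivial_kernel) (use S(1) in \<open>force simp: sym_pos_def_def\<close>)
  show "transpose (inv_sqrt V) = inv_sqrt V"
    unfolding inv_sqrt_def
    by (rule transpose_matrix_inv_symmetric[OF inv]) (use S(1) in \<open>simp add: sym_pos_def_def\<close>)
  have "matrix_inv ?S ** (?S ** ?S) ** matrix_inv ?S = (matrix_inv ?S ** ?S) ** (?S ** matrix_inv ?S)"
    by (simp only: matrix_mul_assoc)
  also have "\<dots> = mat 1" by (simp add: matrix_inv_cancel[OF inv])
  finally show "inv_sqrt V ** V ** inv_sqrt V = mat 1" by (simp add: inv_sqrt_def S(2))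
qed

lemma transpose_vector_inner:
  fixes G :: "real^'n^'m"
  shows "t \<bullet> (G *v u) = (transpose G *v t) \<bullet> u"
  by (simp add: dot_lmul_matrix)

text \<open>For \<open>V = J\<^sup>-\<^sup>1 K J\<^sup>-\<^sup>1\<close> the matrix \<open>G = V\<^sup>-\<^sup>1\<^sup>/\<^sup>2 J\<^sup>-\<^sup>1\<close> satisfies \<open>G K G\<^sup>T = I\<close>, so it whitens a
  vector of covariance \<open>K\<close>. The norm bounds follow from this identity and the lower bound on
  \<open>K\<close>.\<close>

lemma sandwich_whitening:
  fixes J K :: "real^'n^'n"
  assumes J: "invertible J" "transpose J = J"
    and K: "transpose K = K" and c: "c > 0" "\<And>w. c * (norm w)\<^sup>2 \<le> w \<bullet> (K *v w)"
  defines "G \<equiv> inv_sqrt (matrix_inv J ** K ** matrix_inv J) ** matrix_inv J"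
  shows "G ** J = inv_sqrt (matrix_inv J ** K ** matrix_inv J)"
    and "(transpose G *v t) \<bullet> (K *v (transpose G *v t)) = t \<bullet> t"
    and "norm (transpose G *v t) \<le> norm t / sqrt c"
    and "norm (G *v u) \<le> norm u / sqrt c"
proof -
  let ?V = "matrix_inv J ** K ** matrix_inv J"
  let ?W = "inv_sqrt ?V"
  have tJ: "transpose (matrix_inv J) = matrix_inv J"
    by (rule transpose_matrix_inv_symmetric[OF J])
  have "sym_pos_def ?V"
    unfolding sym_pos_def_def
  proof (intro conjI allI impI)
    show "transpose ?V = ?V"
      by (simp add: matrix_transpose_mul tJ K matrix_mul_assoc)
    fix v :: "real^'n" assume "v \<noteq> 0"
    have "J *v (matrix_inv J *v v) = v"
      by (simp add: matrix_vector_mul_assoc matrix_inv_cancel(1)[OF J(1)])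
    then have nz: "matrix_inv J *v v \<noteq> 0" using \<open>v \<noteq> 0\<close> by force
    have "0 < c * (norm (matrix_inv J *v v))\<^sup>2" using nz c(1) by simp
    also have "\<dots> \<le> (matrix_inv J *v v) \<bullet> (K *v (matrix_inv J *v v))" by (rule c(2))
    also have "\<dots> = v \<bullet> (?V *v v)"
      by (metis matrix_vector_mul_assoc tJ transpose_vector_inner)
    finally show "0 < v \<bullet> (?V *v v)" .
  qed
  note W = inv_sqrt_properties[OF this]
  show GJ: "G ** J = ?W"
    unfolding G_def by (simp add: matrix_mul_assoc[symmetric] matrix_inv_cancel(2)[OF J(1)])
  have tG: "transpose G = matrix_inv J ** ?W"
    unfolding G_def by (simp add: matrix_transpose_mul tJ W(1))
  have GKG: "G ** K ** transpose G = mat 1"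
    using W(2) unfolding tG unfolding G_def by (simp only: matrix_mul_assoc)
  show eq: "(transpose G *v t) \<bullet> (K *v (transpose G *v t)) = t \<bullet> t" for t
  proof -
    have "(transpose G *v t) \<bullet> (K *v (transpose G *v t)) = t \<bullet> ((G ** K ** transpose G) *v t)"
      by (simp only: transpose_vector_inner[symmetric] matrix_vector_mul_assoc[symmetric])
    then show ?thesis by (simp only: GKG matrix_vector_mul_lid)
  qed
  show bd: "norm (transpose G *v t) \<le> norm t / sqrt c" for t
  proof -
    have "c * (norm (transpose G *v t))\<^sup>2 \<le> (norm t)\<^sup>2"
      using c(2)[of "transpose G *v t"] eq[of t] by (simp only: power2_norm_eq_inner)
    then have "(norm (transpose G *v t))\<^sup>2 \<le> (norm t / sqrt c)\<^sup>2"
      using c(1) by (simp add: power_divide field_simps)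
    then show ?thesis by (rule power2_le_imp_le) (use c(1) in simp)
  qed
  show "norm (G *v u) \<le> norm u / sqrt c"
  proof -
    have "(norm (G *v u))\<^sup>2 = (transpose G *v (G *v u)) \<bullet> u"
      by (simp only: power2_norm_eq_inner transpose_vector_inner)
    also have "\<dots> \<le> norm (transpose G *v (G *v u)) * norm u" by (rule norm_cauchy_schwarz)
    also have "\<dots> \<le> norm (G *v u) / sqrt c * norm u" by (intro mult_right_mono bd) simp
    finally have "norm (G *v u) * norm (G *v u) \<le> norm (G *v u) * (norm u / sqrt c)"
      by (simp add: power2_eq_square)
    then show ?thesis
      by (cases "G *v u = 0") (use c(1) in \<open>auto simp del: times_divide_eq_right simp: mult_le_cancel_left_pos\<close>)
  qed
qed

section \<open>Differential calculus on Euclidean space\<close>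

lemma has_derivative_grad:
  fixes g :: "real^'p \<Rightarrow> real"
  assumes "g differentiable (at \<theta>)"
  shows "(g has_derivative (\<lambda>v. grad g \<theta> \<bullet> v)) (at \<theta>)"
proof -
  let ?D = "frechet_derivative g (at \<theta>)"
  have D: "(g has_derivative ?D) (at \<theta>)" using assms frechet_derivative_works by blast
  have lin: "linear ?D" using D by (rule has_derivative_linear)
  have "?D v = grad g \<theta> \<bullet> v" for v
  proof -
    have "?D v = ?D (\<Sum>k\<in>UNIV. v $ k *\<^sub>R axis k 1)"
      using basis_expansion[of v] by (simp add: scalar_mult_eq_scaleR)
    also have "\<dots> = (\<Sum>k\<in>UNIV. v $ k *\<^sub>R ?D (axis k 1))"
      by (simp only: linear_sum[OF lin] linear_cmul[OF lin])
    finally show ?thesis by (simp add: grad_def inner_vec_def mult.commute)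
  qed
  then show ?thesis using D by (metis (no_types, lifting) ext)
qed

lemma mean_value_on_segment:
  fixes g :: "real^'p \<Rightarrow> real"
  assumes "convex S" "a \<in> S" "b \<in> S" and d: "\<And>y. y \<in> S \<Longrightarrow> (g has_derivative g' y) (at y)"
  obtains s where "0 < s" "s < 1" "a + s *\<^sub>R (b - a) \<in> S" "g b - g a = g' (a + s *\<^sub>R (b - a)) (b - a)"
proof -
  have mem: "a + s *\<^sub>R (b - a) \<in> S" if "0 \<le> s" "s \<le> 1" for s
    using convexD_alt[OF assms(1-3) that] by (simp add: algebra_simps)
  have "((\<lambda>s. g (a + s *\<^sub>R (b - a))) has_derivative (\<lambda>t. g' (a + s *\<^sub>R (b - a)) (t *\<^sub>R (b - a)))) (at s within {0..1})"
    if "0 \<le> s" "s \<le> 1" for s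
  proof -
    have "((\<lambda>s. a + s *\<^sub>R (b - a)) has_derivative (\<lambda>t. t *\<^sub>R (b - a))) (at s within {0..1})"
      by (auto intro!: derivative_eq_intros)
    from has_derivative_compose[OF this d[OF mem[OF that]]] show ?thesis .
  qed
  from mvt_simple[OF zero_less_one this] obtain s where
    "0 < s" "s < 1" "g b - g a = g' (a + s *\<^sub>R (b - a)) (b - a)" by auto
  then show ?thesis using that mem by force
qed

lemma abs_inner_le_of_components:
  fixes x y :: "real^'p" and h :: real
  assumes "\<And>m. \<bar>x $ m\<bar> \<le> h"
  shows "\<bar>x \<bullet> y\<bar> \<le> CARD('p) * h * norm y"
proof -
  have h: "0 \<le> h" using assms order_trans abs_ge_zero by blast
  have "\<bar>x \<bullet> y\<bar> \<le> (\<Sum>m\<in>UNIV. \<bar>x $ m * y $ m\<bar>)"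
    unfolding inner_vec_def by (simp add: sum_abs)
  also have "\<dots> \<le> (\<Sum>m\<in>(UNIV::'p set). h * norm y)"
    using assms component_le_norm_cart[of y] h
    by (intro sum_mono) (simp add: abs_mult mult_mono)
  finally show ?thesis by simp
qed

lemma norm_le_of_components:
  fixes x :: "real^'p" and h :: real
  assumes "\<And>m. \<bar>x $ m\<bar> \<le> h"
  shows "norm x \<le> CARD('p) * h"
  using norm_le_l1_cart[of x] sum_mono[of UNIV "\<lambda>m. \<bar>x $ m\<bar>" "\<lambda>_. h"] assms by simp

lemma norm_matrix_vector_le_of_entries:
  fixes A :: "real^'p^'p" and h :: real
  assumes "\<And>k l. \<bar>A $ k $ l\<bar> \<le> h"
  shows "norm (A *v v) \<le> (CARD('p))\<^sup>2 * h * norm v"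
proof -
  have "\<bar>(A *v v) $ k\<bar> \<le> CARD('p) * h * norm v" for k
    unfolding matrix_vector_mul_component using assms by (intro abs_inner_le_of_components)
  from norm_le_of_components[of "A *v v", OF this] show ?thesis
    by (simp add: power2_eq_square mult.assoc)
qed

text \<open>Two applications of the mean value theorem, to a component of \<open>g\<close> and then to an entry of
  its Jacobian, give the quadratic remainder without continuity of the second derivatives.\<close>

lemma second_order_remainder:
  fixes g :: "real^'p \<Rightarrow> real^'p" and h :: real
  assumes S: "convex S" "a \<in> S" "b \<in> S"
    and d1: "\<And>y. y \<in> S \<Longrightarrow> g differentiable (at y)"
    and d2: "\<And>y k l. y \<in> S \<Longrightarrow> (\<lambda>t. jacobian g (at t) $ k $ l) differentiable (at y)"
    and bd: "\<And>y k l m. y \<in> S \<Longrightarrow> \<bar>grad (\<lambda>t. jacobian g (at t) $ k $ l) y $ m\<bar> \<le> h"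
  shows "norm (g b - g a - jacobian g (at a) *v (b - a)) \<le> (CARD('p)) ^ 3 * h * (norm (b - a))\<^sup>2"
proof -
  let ?J = "\<lambda>y. jacobian g (at y)"
  have h: "0 \<le> h" using bd[OF S(2)] order_trans abs_ge_zero by blast
  have entry: "\<bar>(?J y - ?J a) $ k $ l\<bar> \<le> CARD('p) * h * norm (y - a)" if y: "y \<in> S" for y k l
  proof -
    obtain s where "a + s *\<^sub>R (y - a) \<in> S"
      "?J y $ k $ l - ?J a $ k $ l = grad (\<lambda>t. ?J t $ k $ l) (a + s *\<^sub>R (y - a)) \<bullet> (y - a)"
      by (rule mean_value_on_segment[OF S(1,2) y has_derivative_grad[OF d2]])
    then show ?thesis using abs_inner_le_of_components[OF bd] by simp
  qed
  have "\<bar>(g b - g a - ?J a *v (b - a)) $ k\<bar> \<le> CARD('p) * (CARD('p) * h * norm (b - a)) * norm (b - a)" for k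
  proof -
    have "((\<lambda>y. g y $ k) has_derivative (\<lambda>v. (?J y *v v) $ k)) (at y)" if "y \<in> S" for y
      using d1[OF that] unfolding jacobian_works
      by (rule bounded_linear.has_derivative[OF bounded_linear_vec_nth])
    from mean_value_on_segment[OF S this] obtain s where s: "0 < s" "s < 1" "a + s *\<^sub>R (b - a) \<in> S"
      "g b $ k - g a $ k = (?J (a + s *\<^sub>R (b - a)) *v (b - a)) $ k" by blast
    let ?y = "a + s *\<^sub>R (b - a)"
    have "(g b - g a - ?J a *v (b - a)) $ k = (?J ?y - ?J a) $ k \<bullet> (b - a)"
      using s(4) by (simp add: matrix_vector_mul_component inner_diff_left)
    also have "\<bar>\<dots>\<bar> \<le> CARD('p) * (CARD('p) * h * norm (?y - a)) * norm (b - a)"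
      by (intro abs_inner_le_of_components entry s)
    also have "\<dots> \<le> CARD('p) * (CARD('p) * h * norm (b - a)) * norm (b - a)"
      using s h by (intro mult_right_mono mult_left_mono) (auto simp: mult_left_le_one_le)
    finally show ?thesis .
  qed
  then have "norm (g b - g a - ?J a *v (b - a)) \<le> CARD('p) * (CARD('p) * (CARD('p) * h * norm (b - a)) * norm (b - a))"
    by (rule norm_le_of_components)
  also have "\<dots> = (CARD('p)) ^ 3 * h * (norm (b - a))\<^sup>2"
    unfolding power2_eq_square power3_eq_cube of_nat_mult by (simp only: mult.assoc)
  finally show ?thesis .
qed

text \<open>Both \<open>b \<bullet> A a\<close> and \<open>a \<bullet> A b\<close> are limits of the second difference quotient
  \<open>(G (\<theta> + s a + s b) - G (\<theta> + s a) - G (\<theta> + s b) + G \<theta>) / s\<^sup>2\<close>, which is symmetric in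
  \<open>a\<close> and \<open>b\<close>. Differentiability of the gradient at the single point \<open>\<theta>\<close> suffices.\<close>

lemma hessian_symmetric:
  fixes G :: "real^'p \<Rightarrow> real" and g :: "real^'p \<Rightarrow> real^'p"
  assumes S: "open S" "\<theta> \<in> S" and G: "\<And>y. y \<in> S \<Longrightarrow> (G has_derivative (\<lambda>v. g y \<bullet> v)) (at y)"
    and g: "(g has_derivative (\<lambda>v. A *v v)) (at \<theta>)"
  shows "transpose A = A"
  unfolding symmetric_iff_self_adjoint
proof (intro allI)
  fix a b :: "real^'p"
  obtain r where r: "r > 0" "ball \<theta> r \<subseteq> S" using S openE by blast
  define c where "c = norm a + norm b + 1"
  have c: "c > 0" by (simp add: c_def add_nonneg_pos)
  have close: "\<bar>(G (\<theta> + s *\<^sub>R a + s *\<^sub>R b) - G (\<theta> + s *\<^sub>R a) - G (\<theta> + s *\<^sub>R b) + G \<theta>) / s\<^sup>2 - (A *v a) \<bullet> b\<bar> \<le> 2 * e * c\<^sup>2"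
    if e: "e > 0" and s: "0 < s" "s * c < r"
      and d: "\<And>v. norm v \<le> s * c \<Longrightarrow> norm (g (\<theta> + v) - g \<theta> - A *v v) \<le> e * norm v"
      and ab: "norm a + norm b + 1 = c"
    for e s and a b :: "real^'p"
  proof -
    have inS: "\<theta> + v \<in> S" if "norm v \<le> s * c" for v
      using that s r(2) by (auto simp: dist_norm subset_iff)
    have len: "norm (\<alpha> *\<^sub>R a + \<beta> *\<^sub>R b) \<le> s * c" if "0 \<le> \<alpha>" "\<alpha> \<le> s" "0 \<le> \<beta>" "\<beta> \<le> s" for \<alpha> \<beta>
    proof -
      have "norm (\<alpha> *\<^sub>R a + \<beta> *\<^sub>R b) \<le> \<alpha> * norm a + \<beta> * norm b"
        using norm_triangle_ineq[of "\<alpha> *\<^sub>R a" "\<beta> *\<^sub>R b"] that by simp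
      also have "\<dots> \<le> s * norm a + s * norm b" using that by (intro add_mono mult_right_mono) auto
      also have "\<dots> \<le> s * c" using s ab by (simp add: algebra_simps flip: ab)
      finally show ?thesis .
    qed
    let ?x = "\<lambda>\<tau>. s *\<^sub>R a + (\<tau> * s) *\<^sub>R b" and ?y = "\<lambda>\<tau>. (\<tau> * s) *\<^sub>R b"
    have lx: "norm (?x \<tau>) \<le> s * c" and ly: "norm (?y \<tau>) \<le> s * c" if "0 \<le> \<tau>" "\<tau> \<le> 1" for \<tau>
      using len[of s "\<tau> * s"] len[of 0 "\<tau> * s"] that s by (auto simp: mult_left_le_one_le)
    let ?\<phi> = "\<lambda>\<tau>. G (\<theta> + ?x \<tau>) - G (\<theta> + ?y \<tau>)"
    have "(?\<phi> has_derivative (\<lambda>t. g (\<theta> + ?x \<tau>) \<bullet> ((t * s) *\<^sub>R b) - g (\<theta> + ?y \<tau>) \<bullet> ((t * s) *\<^sub>R b))) (at \<tau> within {0..1})"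
      if "0 \<le> \<tau>" "\<tau> \<le> 1" for \<tau>
    proof (rule has_derivative_diff)
      show "((\<lambda>\<tau>. G (\<theta> + ?x \<tau>)) has_derivative (\<lambda>t. g (\<theta> + ?x \<tau>) \<bullet> ((t * s) *\<^sub>R b))) (at \<tau> within {0..1})"
      proof -
        have "((\<lambda>\<tau>. \<theta> + ?x \<tau>) has_derivative (\<lambda>t. (t * s) *\<^sub>R b)) (at \<tau> within {0..1})"
          by (auto intro!: derivative_eq_intros)
        from has_derivative_compose[OF this G[OF inS[OF lx[OF that]]]] show ?thesis .
      qed
      show "((\<lambda>\<tau>. G (\<theta> + ?y \<tau>)) has_derivative (\<lambda>t. g (\<theta> + ?y \<tau>) \<bullet> ((t * s) *\<^sub>R b))) (at \<tau> within {0..1})"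
      proof -
        have "((\<lambda>\<tau>. \<theta> + ?y \<tau>) has_derivative (\<lambda>t. (t * s) *\<^sub>R b)) (at \<tau> within {0..1})"
          by (auto intro!: derivative_eq_intros)
        from has_derivative_compose[OF this G[OF inS[OF ly[OF that]]]] show ?thesis .
      qed
    qed
    from mvt_simple[OF zero_less_one this] obtain \<tau> where \<tau>: "0 < \<tau>" "\<tau> < 1"
      and eq: "?\<phi> 1 - ?\<phi> 0 = g (\<theta> + ?x \<tau>) \<bullet> (s *\<^sub>R b) - g (\<theta> + ?y \<tau>) \<bullet> (s *\<^sub>R b)" by auto
    let ?R = "\<lambda>v. g (\<theta> + v) - g \<theta> - A *v v"
    have "g (\<theta> + ?x \<tau>) - g (\<theta> + ?y \<tau>) = s *\<^sub>R (A *v a) + (?R (?x \<tau>) - ?R (?y \<tau>))"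
      by (simp add: matrix_vector_right_distrib matrix_vector_mult_scaleR)
    then have "?\<phi> 1 - ?\<phi> 0 = s\<^sup>2 * ((A *v a) \<bullet> b) + s * ((?R (?x \<tau>) - ?R (?y \<tau>)) \<bullet> b)"
      unfolding eq inner_diff_left[symmetric]
      by (simp only: inner_add_left) (simp add: power2_eq_square algebra_simps)
    moreover have "\<bar>(?R (?x \<tau>) - ?R (?y \<tau>)) \<bullet> b\<bar> \<le> s * (2 * e * c\<^sup>2)"
    proof -
      have "norm (?R (?x \<tau>) - ?R (?y \<tau>)) \<le> norm (?R (?x \<tau>)) + norm (?R (?y \<tau>))"
        by (rule norm_triangle_ineq4)
      also have "\<dots> \<le> e * norm (?x \<tau>) + e * norm (?y \<tau>)"
        using \<tau> by (intro add_mono d lx ly) auto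
      also have "\<dots> \<le> e * (s * c) + e * (s * c)"
        using \<tau> e by (intro add_mono mult_left_mono lx ly) auto
      finally have 1: "norm (?R (?x \<tau>) - ?R (?y \<tau>)) \<le> 2 * e * s * c" by (simp add: mult_ac)
      have "norm b \<le> c" using ab norm_ge_zero[of a] by linarith
      with 1 have "norm (?R (?x \<tau>) - ?R (?y \<tau>)) * norm b \<le> (2 * e * s * c) * c"
        using e s c by (intro mult_mono) auto
      then show ?thesis
        using Cauchy_Schwarz_ineq2[of "?R (?x \<tau>) - ?R (?y \<tau>)" b]
        by (simp add: power2_eq_square mult_ac)
    qed
    ultimately have "\<bar>(?\<phi> 1 - ?\<phi> 0) - s\<^sup>2 * ((A *v a) \<bullet> b)\<bar> \<le> s * (s * (2 * e * c\<^sup>2))"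
      using s by (simp add: abs_mult)
    moreover have "\<bar>X / s\<^sup>2 - Y\<bar> \<le> E" if "\<bar>X - s\<^sup>2 * Y\<bar> \<le> s * (s * E)" for X Y E :: real
    proof -
      have "X / s\<^sup>2 - Y = (X - s\<^sup>2 * Y) / s\<^sup>2" using s by (simp add: diff_divide_distrib)
      also have "\<bar>\<dots>\<bar> = \<bar>X - s\<^sup>2 * Y\<bar> / s\<^sup>2" by (simp add: abs_divide)
      also have "\<dots> \<le> s * (s * E) / s\<^sup>2" using that by (rule divide_right_mono) simp
      also have "\<dots> = E" using s by (simp add: power2_eq_square)
      finally show ?thesis .
    qed
    ultimately have bound: "\<bar>(?\<phi> 1 - ?\<phi> 0) / s\<^sup>2 - (A *v a) \<bullet> b\<bar> \<le> 2 * e * c\<^sup>2" by blast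
    have "?\<phi> 1 - ?\<phi> 0 = G (\<theta> + s *\<^sub>R a + s *\<^sub>R b) - G (\<theta> + s *\<^sub>R a) - G (\<theta> + s *\<^sub>R b) + G \<theta>"
      by (simp add: add.assoc)
    from bound[unfolded this] show ?thesis .
  qed
  have "\<bar>(A *v a) \<bullet> b - (A *v b) \<bullet> a\<bar> \<le> 4 * e * c\<^sup>2" if e: "e > 0" for e
  proof -
    have "\<exists>d>0. \<forall>v. norm v < d \<longrightarrow> norm (g (\<theta> + v) - g \<theta> - A *v v) \<le> e * norm v"
    proof -
      have "\<forall>e>0. \<exists>d>0. \<forall>y. norm (y - \<theta>) < d \<longrightarrow> norm (g y - g \<theta> - A *v (y - \<theta>)) \<le> e * norm (y - \<theta>)"
        using g unfolding has_derivative_at_alt by (rule conjunct2)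
      then obtain d where d: "d > 0"
        "\<And>y. norm (y - \<theta>) < d \<Longrightarrow> norm (g y - g \<theta> - A *v (y - \<theta>)) \<le> e * norm (y - \<theta>)"
        using e by blast
      have "norm (g (\<theta> + v) - g \<theta> - A *v v) \<le> e * norm v" if "norm v < d" for v
        using d(2)[of "\<theta> + v"] that by simp
      then show ?thesis using d(1) by blast
    qed
    then obtain d where d: "d > 0" "\<And>v. norm v < d \<Longrightarrow> norm (g (\<theta> + v) - g \<theta> - A *v v) \<le> e * norm v" by blast
    define s where "s = min d r / (2 * c)"
    have s: "0 < s" "s * c < r" "s * c < d"
      using d(1) r(1) c by (auto simp: s_def field_simps min_def)
    have d': "norm v \<le> s * c \<Longrightarrow> norm (g (\<theta> + v) - g \<theta> - A *v v) \<le> e * norm v" for v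
      using d(2) s(3) by simp
    have sw: "G (\<theta> + s *\<^sub>R b + s *\<^sub>R a) - G (\<theta> + s *\<^sub>R b) - G (\<theta> + s *\<^sub>R a) + G \<theta>
        = G (\<theta> + s *\<^sub>R a + s *\<^sub>R b) - G (\<theta> + s *\<^sub>R a) - G (\<theta> + s *\<^sub>R b) + G \<theta>"
      using add.commute[of "s *\<^sub>R a" "s *\<^sub>R b"] by (simp only: add.assoc)
    have "norm a + norm b + 1 = c" "norm b + norm a + 1 = c" by (auto simp: c_def)
    from close[OF e s(1,2) d' this(1)] close[OF e s(1,2) d' this(2)] show ?thesis
      unfolding sw by linarith
  qed
  note bound = this
  have "\<bar>(A *v a) \<bullet> b - (A *v b) \<bullet> a\<bar> \<le> 0"
  proof (rule field_le_epsilon)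
    fix e :: real assume "e > 0"
    have "\<bar>(A *v a) \<bullet> b - (A *v b) \<bullet> a\<bar> \<le> 4 * (e / (4 * c\<^sup>2)) * c\<^sup>2"
      using \<open>e > 0\<close> c by (intro bound) auto
    then show "\<bar>(A *v a) \<bullet> b - (A *v b) \<bullet> a\<bar> \<le> 0 + e" using c by simp
  qed
  then show "a \<bullet> (A *v b) = (A *v a) \<bullet> b" by (simp add: inner_commute)
qed

text \<open>A directional derivative is the limit of the difference quotients with increment
  \<open>1 / (i + 1)\<close>. They are replaced by \<open>0\<close> for the finitely many \<open>i\<close> at which the shifted
  argument leaves \<open>S\<close>, where nothing is known about measurability.\<close>

lemma borel_measurable_frechet_derivative:
  fixes g :: "'a \<Rightarrow> real^'p \<Rightarrow> real"
  assumes S: "open S" "\<theta> \<in> S" and meas: "\<And>t. t \<in> S \<Longrightarrow> (\<lambda>x. g x t) \<in> borel_measurable M"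
    and diff: "\<And>x. x \<in> space M \<Longrightarrow> g x differentiable (at \<theta>)"
  shows "(\<lambda>x. frechet_derivative (g x) (at \<theta>) v) \<in> borel_measurable M"
proof -
  define u where "u i x = (if \<theta> + (1 / real (Suc i)) *\<^sub>R v \<in> S
      then (g x (\<theta> + (1 / real (Suc i)) *\<^sub>R v) - g x \<theta>) / (1 / real (Suc i)) else 0)" for i x
  show ?thesis
  proof (rule borel_measurable_LIMSEQ_real)
    show "u i \<in> borel_measurable M" for i
    proof (cases "\<theta> + (1 / real (Suc i)) *\<^sub>R v \<in> S")
      case True
      have [measurable]: "(\<lambda>x. g x (\<theta> + (1 / real (Suc i)) *\<^sub>R v)) \<in> borel_measurable M"
        "(\<lambda>x. g x \<theta>) \<in> borel_measurable M" using meas True S by auto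
      have "u i = (\<lambda>x. (g x (\<theta> + (1 / real (Suc i)) *\<^sub>R v) - g x \<theta>) / (1 / real (Suc i)))"
        using True by (auto simp only: u_def if_True fun_eq_iff)
      then show ?thesis by (simp only:) measurable
    next
      case False
      then show ?thesis unfolding u_def[abs_def] by simp
    qed
    fix x assume x: "x \<in> space M"
    let ?D = "frechet_derivative (g x) (at \<theta>)"
    have D: "(g x has_derivative ?D) (at \<theta>)" using diff[OF x] frechet_derivative_works by blast
    have "((\<lambda>s. g x (\<theta> + s *\<^sub>R v)) has_derivative (\<lambda>s. ?D (s *\<^sub>R v))) (at 0)"
    proof -
      have "((\<lambda>s. \<theta> + s *\<^sub>R v) has_derivative (\<lambda>s. s *\<^sub>R v)) (at 0)"
        by (auto intro!: derivative_eq_intros)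
      from has_derivative_compose[OF this, of "g x"] D show ?thesis by simp
    qed
    moreover have "(\<lambda>s. ?D (s *\<^sub>R v)) = (\<lambda>s. ?D v * s)"
      using linear_cmul[OF has_derivative_linear[OF D]] by (auto simp: mult.commute)
    ultimately have "((\<lambda>s. g x (\<theta> + s *\<^sub>R v)) has_real_derivative ?D v) (at 0)"
      by (simp add: has_field_derivative_def)
    then have lim: "((\<lambda>s. (g x (\<theta> + s *\<^sub>R v) - g x \<theta>) / s) \<longlongrightarrow> ?D v) (at 0)"
      by (simp add: DERIV_def)
    have null: "(\<lambda>i. 1 / real (Suc i)) \<longlonglongrightarrow> 0"
      by (rule LIMSEQ_Suc[OF lim_const_over_n])
    then have "filterlim (\<lambda>i. 1 / real (Suc i)) (at 0) sequentially"
      unfolding filterlim_at by (intro conjI always_eventually allI) simp_all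
    from filterlim_compose[OF lim this]
    have "(\<lambda>i. (g x (\<theta> + (1 / real (Suc i)) *\<^sub>R v) - g x \<theta>) / (1 / real (Suc i))) \<longlonglongrightarrow> ?D v" .
    moreover have "\<forall>\<^sub>F i in sequentially. (g x (\<theta> + (1 / real (Suc i)) *\<^sub>R v) - g x \<theta>) / (1 / real (Suc i)) = u i x"
    proof -
      have "(\<lambda>i. \<theta> + (1 / real (Suc i)) *\<^sub>R v) \<longlonglongrightarrow> \<theta> + 0 *\<^sub>R v"
        by (intro tendsto_intros null)
      then have "\<forall>\<^sub>F i in sequentially. \<theta> + (1 / real (Suc i)) *\<^sub>R v \<in> S"
        using S by (intro topological_tendstoD) auto
      then show ?thesis by eventually_elim (simp add: u_def)
    qed
    ultimately show "(\<lambda>i. u i x) \<longlonglongrightarrow> ?D v"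
      by (rule Lim_transform_eventually)
  qed
qed

lemma borel_measurable_vec_component [measurable (raw)]:
  fixes g :: "'a \<Rightarrow> ('b :: topological_space)^'n"
  assumes "g \<in> borel_measurable N"
  shows "(\<lambda>x. g x $ k) \<in> borel_measurable N"
proof -
  have "continuous_on UNIV (\<lambda>u :: 'b^'n. u $ k)" by (intro continuous_intros)
  from borel_measurable_continuous_on[OF this assms] show ?thesis .
qed

section \<open>Gaussian kernels\<close>

lemma abs_integral_le:
  fixes f g :: "'a \<Rightarrow> real"
  assumes "integrable M f" "integrable M g" "\<And>x. x \<in> space M \<Longrightarrow> \<bar>f x\<bar> \<le> g x"
  shows "\<bar>LINT x|M. f x\<bar> \<le> (LINT x|M. g x)"
  using assms by (intro order_trans[OF integral_abs_bound] integral_mono) auto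

lemma prod_components_eq_prod_Basis:
  fixes f :: "'n::finite \<Rightarrow> real \<Rightarrow> 'b::comm_monoid_mult"
  shows "(\<Prod>k\<in>UNIV. f k (x $ k)) = (\<Prod>b\<in>(Basis::(real^'n) set). f (inv (\<lambda>k. axis k 1) b) (x \<bullet> b))"
proof -
  have inj: "inj (\<lambda>k::'n. axis k (1::real))"
    by (rule injI) (simp add: axis_eq_axis)
  have "(\<Prod>b\<in>(Basis::(real^'n) set). f (inv (\<lambda>k. axis k 1) b) (x \<bullet> b))
      = (\<Prod>b\<in>range (\<lambda>k::'n. axis k (1::real)). f (inv (\<lambda>k. axis k 1) b) (x \<bullet> b))"
    by (rule prod.cong) (auto simp: Basis_vec_def)
  also have "\<dots> = (\<Prod>k\<in>UNIV. f k (x $ k))"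
    by (subst prod.reindex[OF inj]) (simp add: inv_f_f[OF inj] inner_axis)
  finally show ?thesis by simp
qed

lemma lborel_vec_product_integral:
  fixes f :: "'n::finite \<Rightarrow> real \<Rightarrow> 'b::{real_normed_field,banach,second_countable_topology}"
  assumes f: "\<And>k. integrable lborel (f k)"
  shows "integrable lborel (\<lambda>x::real^'n. \<Prod>k\<in>UNIV. f k (x $ k))" (is ?I)
    and "(LINT x|(lborel :: (real^'n) measure). (\<Prod>k\<in>UNIV. f k (x $ k))) = (\<Prod>k\<in>UNIV. LINT x|lborel. f k x)" (is ?E)
proof -
  let ?a = "inv (\<lambda>k::'n. axis k (1::real))"
  interpret product_sigma_finite "\<lambda>b::real^'n. lborel :: real measure" ..
  have [measurable]: "f k \<in> borel_measurable borel" for k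
    using borel_measurable_integrable[OF f[of k]] by simp
  have dist: "lborel = distr (\<Pi>\<^sub>M b\<in>(Basis::(real^'n) set). lborel) borel (\<lambda>f. \<Sum>b\<in>Basis. f b *\<^sub>R b)"
    by (rule lborel_eq)
  have comp: "(\<Prod>b\<in>(Basis::(real^'n) set). f (?a b) ((\<Sum>b\<in>Basis. y b *\<^sub>R b) \<bullet> b))
      = (\<Prod>b\<in>(Basis::(real^'n) set). f (?a b) (y b))" for y
    by (rule prod.cong) auto
  show ?I
    unfolding prod_components_eq_prod_Basis
    by (subst dist, subst integrable_distr_eq)
       (auto simp: comp intro!: product_integrable_prod f)
  have inj: "inj (\<lambda>k::'n. axis k (1::real))"
    by (rule injI) (simp add: axis_eq_axis)
  have "(LINT x|(lborel :: (real^'n) measure). (\<Prod>k\<in>UNIV. f k (x $ k))) = (\<Prod>b\<in>(Basis::(real^'n) set). LINT x|lborel. f (?a b) x)"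
    unfolding prod_components_eq_prod_Basis
    by (subst dist, subst integral_distr) (auto simp: comp intro!: product_integral_prod f)
  also have "\<dots> = (\<Prod>b\<in>range (\<lambda>k::'n. axis k (1::real)). LINT x|lborel. f (?a b) x)"
    by (rule prod.cong) (auto simp: Basis_vec_def)
  also have "\<dots> = (\<Prod>k\<in>UNIV. LINT x|lborel. f k x)"
    by (subst prod.reindex[OF inj]) (simp add: inv_f_f[OF inj])
  finally show ?E .
qed

text \<open>The product form lets Fubini's theorem transfer facts about the normal density on the line.\<close>

definition gauss_kernel :: "real \<Rightarrow> real^'n \<Rightarrow> real" where
  "gauss_kernel \<sigma> u = (\<Prod>k\<in>UNIV. normal_density 0 \<sigma> (u $ k))"

lemma gauss_kernel_measurable [measurable]: "gauss_kernel \<sigma> \<in> borel_measurable borel"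
  unfolding gauss_kernel_def[abs_def] by measurable

lemma gauss_kernel_nonneg: "0 \<le> gauss_kernel \<sigma> u"
  unfolding gauss_kernel_def by (intro prod_nonneg) auto

lemma std_normal_vec_eq: "std_normal_vec = density lborel (gauss_kernel 1)"
  unfolding std_normal_vec_def gauss_kernel_def[abs_def] by simp

lemma gauss_kernel_eq_exp:
  fixes u :: "real^'n"
  assumes "\<sigma> > 0"
  shows "gauss_kernel \<sigma> u = gauss_kernel \<sigma> (0::real^'n) * exp (- (norm u)\<^sup>2 / (2 * \<sigma>\<^sup>2))"
proof -
  have "gauss_kernel \<sigma> u = (\<Prod>k\<in>UNIV. normal_density 0 \<sigma> 0 * exp (- (u $ k)\<^sup>2 / (2 * \<sigma>\<^sup>2)))"
    unfolding gauss_kernel_def by (simp add: normal_density_def)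
  also have "\<dots> = gauss_kernel \<sigma> (0::real^'n) * exp (\<Sum>k\<in>UNIV. - (u $ k)\<^sup>2 / (2 * \<sigma>\<^sup>2))"
    by (simp add: prod.distrib gauss_kernel_def exp_sum)
  also have "(\<Sum>k\<in>UNIV. - (u $ k)\<^sup>2 / (2 * \<sigma>\<^sup>2)) = - (norm u)\<^sup>2 / (2 * \<sigma>\<^sup>2)"
    unfolding power2_norm_eq_inner inner_vec_def
    by (simp add: sum_divide_distrib[symmetric] sum_negf power2_eq_square)
  finally show ?thesis .
qed

lemma gauss_kernel_le: 
  fixes u :: "real^'n"
  assumes "\<sigma> > 0"
  shows "gauss_kernel \<sigma> u \<le> gauss_kernel \<sigma> (0::real^'n)"
  unfolding gauss_kernel_eq_exp[OF assms, of u]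
  by (rule mult_left_le) (auto simp: gauss_kernel_nonneg)

lemma gauss_kernel_integral:
  assumes "\<sigma> > 0"
  shows "integrable lborel (gauss_kernel \<sigma> :: real^'n \<Rightarrow> real)"
    and "(LINT u|lborel. gauss_kernel \<sigma> (u::real^'n)) = 1"
  unfolding gauss_kernel_def[abs_def]
  using lborel_vec_product_integral[of "\<lambda>_::'n. normal_density 0 \<sigma>"] assms by auto

lemma prob_space_gauss_kernel:
  assumes "\<sigma> > 0"
  shows "prob_space (density lborel (gauss_kernel \<sigma> :: real^'n \<Rightarrow> real))"
proof
  show "emeasure (density lborel (gauss_kernel \<sigma>)) (space (density lborel (gauss_kernel \<sigma> :: real^'n \<Rightarrow> real))) = 1"
    using gauss_kernel_integral[OF assms, where 'n='n]
    by (simp add: emeasure_density nn_integral_eq_integral gauss_kernel_nonneg)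
qed

lemma gauss_kernel_first_moment:
  assumes \<sigma>: "\<sigma> > 0"
  shows "integrable lborel (\<lambda>u::real^'n. norm u * gauss_kernel \<sigma> u)"
    and "(LINT u|(lborel :: (real^'n) measure). norm u * gauss_kernel \<sigma> u) \<le> CARD('n) * sqrt (2 / pi) * \<sigma>"
proof -
  define h :: "'n \<Rightarrow> 'n \<Rightarrow> real \<Rightarrow> real" where
    "h k j x = (if j = k then \<bar>x\<bar> * normal_density 0 \<sigma> x else normal_density 0 \<sigma> x)" for k j x
  have mom: "has_bochner_integral lborel (\<lambda>x. normal_density 0 \<sigma> x * \<bar>x\<bar>) (\<sigma> * sqrt (2 / pi))"
    using normal_moment_abs_odd[OF \<sigma>, of 0 0] by simp
  have int: "integrable lborel (h k j)" for k j
    unfolding h_def using mom \<sigma> by (cases "j = k") (auto simp: has_bochner_integral_iff mult.commute)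
  have val: "(LINT x|lborel. h k j x) = (if j = k then \<sigma> * sqrt (2 / pi) else 1)" for k j
    unfolding h_def using mom \<sigma> by (cases "j = k") (auto simp: has_bochner_integral_iff mult.commute)
  have prod: "(\<Prod>j\<in>UNIV. h k j (u $ j)) = \<bar>u $ k\<bar> * gauss_kernel \<sigma> u" for k and u :: "real^'n"
    unfolding gauss_kernel_def h_def
    by (subst (1 2) prod.remove[of UNIV k]) (auto intro!: prod.cong)
  have int': "integrable lborel (\<lambda>u::real^'n. \<bar>u $ k\<bar> * gauss_kernel \<sigma> u)" for k
    using lborel_vec_product_integral(1)[of "h k"] int by (simp add: prod)
  have val': "(LINT u|(lborel :: (real^'n) measure). \<bar>u $ k\<bar> * gauss_kernel \<sigma> u) = \<sigma> * sqrt (2 / pi)" for k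
    using lborel_vec_product_integral(2)[of "h k"] int by (simp add: prod val)
  have le: "norm u * gauss_kernel \<sigma> u \<le> (\<Sum>k\<in>UNIV. \<bar>u $ k\<bar> * gauss_kernel \<sigma> u)" for u :: "real^'n"
    using norm_le_l1_cart[of u] gauss_kernel_nonneg[of \<sigma> u]
    by (simp add: sum_distrib_right[symmetric] mult_right_mono)
  show int: "integrable lborel (\<lambda>u::real^'n. norm u * gauss_kernel \<sigma> u)"
    by (rule Bochner_Integration.integrable_bound[where f="\<lambda>u. \<Sum>k\<in>UNIV. \<bar>u $ k\<bar> * gauss_kernel \<sigma> u"])
       (auto intro!: Bochner_Integration.integrable_sum int'
             simp: gauss_kernel_nonneg abs_mult sum_nonneg intro: order_trans[OF le])
  have "(LINT u|(lborel :: (real^'n) measure). norm u * gauss_kernel \<sigma> u)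
      \<le> (LINT u|(lborel :: (real^'n) measure). (\<Sum>k\<in>UNIV. \<bar>u $ k\<bar> * gauss_kernel \<sigma> u))"
    by (intro integral_mono int le Bochner_Integration.integrable_sum int')
  also have "\<dots> = CARD('n) * sqrt (2 / pi) * \<sigma>"
    by (subst Bochner_Integration.integral_sum) (auto simp: int' val')
  finally show "(LINT u|(lborel :: (real^'n) measure). norm u * gauss_kernel \<sigma> u) \<le> CARD('n) * sqrt (2 / pi) * \<sigma>" .
qed

lemma normal_density_fourier:
  assumes \<sigma>: "\<sigma> > 0"
  shows "integrable lborel (\<lambda>x. iexp (t * x) * normal_density 0 \<sigma> x)"
    and "(LINT x|lborel. iexp (t * x) * normal_density 0 \<sigma> x) = exp (- (\<sigma>\<^sup>2 * t\<^sup>2) / 2)"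
proof -
  show "integrable lborel (\<lambda>x. iexp (t * x) * normal_density 0 \<sigma> x)"
    by (rule Bochner_Integration.integrable_bound[where f="normal_density 0 \<sigma>"])
       (use \<sigma> in \<open>auto simp: norm_mult\<close>)
  have scale: "normal_density 0 \<sigma> (\<sigma> * x) = std_normal_density x / \<sigma>" for x
    using \<sigma> by (simp add: normal_density_def power_mult_distrib real_sqrt_mult)
  have "(LINT x|lborel. iexp (t * x) * normal_density 0 \<sigma> x)
      = \<sigma> *\<^sub>R (LINT x|lborel. iexp (t * (\<sigma> * x)) * normal_density 0 \<sigma> (\<sigma> * x))"
    using \<sigma> by (subst lborel_integral_real_affine[where c=\<sigma> and t=0]) auto
  also have "\<dots> = (LINT x|lborel. \<sigma> *\<^sub>R (iexp (t * (\<sigma> * x)) * normal_density 0 \<sigma> (\<sigma> * x)))"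
    by simp
  also have "\<dots> = (LINT x|lborel. std_normal_density x *\<^sub>R iexp ((t * \<sigma>) * x))"
    using \<sigma> by (intro Bochner_Integration.integral_cong) (auto simp: scale scaleR_conv_of_real mult.assoc)
  also have "\<dots> = char std_normal_distribution (t * \<sigma>)"
    unfolding char_def by (subst integral_density) auto
  also have "\<dots> = exp (- (\<sigma>\<^sup>2 * t\<^sup>2) / 2)"
    by (simp add: char_std_normal_distribution power_mult_distrib mult.commute)
  finally show "(LINT x|lborel. iexp (t * x) * normal_density 0 \<sigma> x) = exp (- (\<sigma>\<^sup>2 * t\<^sup>2) / 2)" .
qed

lemma gauss_kernel_fourier:
  fixes t :: "real^'n"
  assumes \<sigma>: "\<sigma> > 0"
  shows "(LINT u|lborel. gauss_kernel \<sigma> u *\<^sub>R iexp (t \<bullet> u)) = exp (- (\<sigma>\<^sup>2 * (norm t)\<^sup>2) / 2)"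
proof -
  have "(LINT u|lborel. gauss_kernel \<sigma> u *\<^sub>R iexp (t \<bullet> u))
      = (LINT u|(lborel :: (real^'n) measure). (\<Prod>k\<in>UNIV. iexp (t $ k * u $ k) * normal_density 0 \<sigma> (u $ k)))"
  proof (intro Bochner_Integration.integral_cong refl)
    fix u :: "real^'n"
    have "iexp (t \<bullet> u) = (\<Prod>k\<in>UNIV. iexp (t $ k * u $ k))"
      unfolding inner_vec_def by (simp add: sum_distrib_left exp_sum)
    then show "gauss_kernel \<sigma> u *\<^sub>R iexp (t \<bullet> u)
        = (\<Prod>k\<in>UNIV. iexp (t $ k * u $ k) * normal_density 0 \<sigma> (u $ k))"
      by (simp only: gauss_kernel_def prod.distrib scaleR_conv_of_real of_real_prod mult.commute)
  qed
  also have "\<dots> = (\<Prod>k\<in>UNIV. LINT x|lborel. iexp (t $ k * x) * normal_density 0 \<sigma> x)"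
    by (rule lborel_vec_product_integral(2)) (rule normal_density_fourier(1)[OF \<sigma>])
  also have "\<dots> = (\<Prod>k\<in>UNIV. of_real (exp (- (\<sigma>\<^sup>2 * (t $ k)\<^sup>2) / 2)))"
    by (simp only: normal_density_fourier(2)[OF \<sigma>])
  also have "\<dots> = of_real (exp (\<Sum>k\<in>UNIV. - (\<sigma>\<^sup>2 * (t $ k)\<^sup>2) / 2))"
    by (simp only: of_real_prod[symmetric] exp_sum[OF finite])
  also have "(\<Sum>k\<in>UNIV. - (\<sigma>\<^sup>2 * (t $ k)\<^sup>2) / 2) = - (\<sigma>\<^sup>2 * (norm t)\<^sup>2) / 2"
    unfolding power2_norm_eq_inner inner_vec_def
    by (simp add: sum_divide_distrib[symmetric] sum_negf sum_distrib_left[symmetric] power2_eq_square)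
  finally show ?thesis .
qed

text \<open>Up to normalisation a Gaussian kernel is the Fourier transform of the Gaussian kernel of
  inverse width; this is what turns smoothed expectations into integrals of characteristic
  functions.\<close>

lemma gauss_kernel_eq_fourier:
  fixes u :: "real^'n"
  assumes \<sigma>: "\<sigma> > 0"
  shows "complex_of_real (gauss_kernel \<sigma> u) = of_real (gauss_kernel \<sigma> (0::real^'n)) *
     (LINT w|density lborel (gauss_kernel (1 / \<sigma>)). iexp (u \<bullet> w))"
proof -
  have "(LINT w|density lborel (gauss_kernel (1 / \<sigma>)). iexp (u \<bullet> w)) = exp (- ((1 / \<sigma>)\<^sup>2 * (norm u)\<^sup>2) / 2)"
    using gauss_kernel_fourier[of "1 / \<sigma>" u] \<sigma>
    by (subst integral_density) (auto simp: gauss_kernel_nonneg)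
  also have "\<dots> = exp (- (norm u)\<^sup>2 / (2 * \<sigma>\<^sup>2))"
    by (simp add: power_divide)
  finally show ?thesis by (simp add: gauss_kernel_eq_exp[OF \<sigma>, of u])
qed

lemma char_std_normal_vec:
  fixes t :: "real^'n"
  shows "(LINT y|std_normal_vec. iexp (t \<bullet> y)) = exp (- (norm t)\<^sup>2 / 2)"
  unfolding std_normal_vec_eq using gauss_kernel_fourier[of 1 t]
  by (subst integral_density) (auto simp: gauss_kernel_nonneg)

lemma prob_space_std_normal_vec: "prob_space (std_normal_vec :: (real^'n) measure)"
  unfolding std_normal_vec_eq by (rule prob_space_gauss_kernel) simp

section \<open>The continuity theorem in several dimensions\<close>

text \<open>The left side is the density at \<open>x\<close> of \<open>N\<close> convolved with a centred normal distribution of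
  standard deviation \<open>\<sigma>\<close> in each coordinate. Inserting the Fourier representation of the kernel and exchanging the
  integrals expresses it through the characteristic function of \<open>N\<close>.\<close>

lemma gauss_smoothing_eq_char:
  fixes N :: "(real^'n) measure"
  assumes N: "prob_space N" "sets N = sets borel" and \<sigma>: "\<sigma> > 0"
  shows "complex_of_real (LINT y|N. gauss_kernel \<sigma> (x - y)) = of_real (gauss_kernel \<sigma> (0::real^'n)) *
     (LINT w|density lborel (gauss_kernel (1 / \<sigma>)). iexp (x \<bullet> w) * (LINT y|N. iexp ((- w) \<bullet> y)))"
proof -
  interpret N: prob_space N by fact
  let ?G = "density lborel (gauss_kernel (1 / \<sigma>)) :: (real^'n) measure"
  interpret G: prob_space ?G by (rule prob_space_gauss_kernel) (use \<sigma> in simp)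
  interpret NG: pair_prob_space N ?G ..
  have [measurable_cong]: "sets N = sets borel" by fact
  have int: "integrable (N \<Otimes>\<^sub>M ?G) (case_prod (\<lambda>y w. iexp ((x - y) \<bullet> w)))"
    by (rule NG.integrable_const_bound[where B=1]) (auto simp: split_beta)
  have "complex_of_real (LINT y|N. gauss_kernel \<sigma> (x - y)) = (LINT y|N. complex_of_real (gauss_kernel \<sigma> (x - y)))"
    by simp
  also have "\<dots> = of_real (gauss_kernel \<sigma> (0::real^'n)) * (LINT y|N. LINT w|?G. iexp ((x - y) \<bullet> w))"
    unfolding gauss_kernel_eq_fourier[OF \<sigma>, of "x - _"] by simp
  also have "(LINT y|N. LINT w|?G. iexp ((x - y) \<bullet> w)) = (LINT w|?G. LINT y|N. iexp ((x - y) \<bullet> w))"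
    by (rule NG.Fubini_integral[OF int, symmetric])
  also have "(LINT w|?G. LINT y|N. iexp ((x - y) \<bullet> w)) = (LINT w|?G. iexp (x \<bullet> w) * (LINT y|N. iexp ((- w) \<bullet> y)))"
  proof (intro Bochner_Integration.integral_cong refl)
    fix w :: "real^'n"
    have "(LINT y|N. iexp ((x - y) \<bullet> w)) = (LINT y|N. iexp (x \<bullet> w) * iexp ((- w) \<bullet> y))"
      by (intro Bochner_Integration.integral_cong refl)
         (simp add: inner_diff_left inner_commute algebra_simps exp_diff exp_minus field_simps)
    then show "(LINT y|N. iexp ((x - y) \<bullet> w)) = iexp (x \<bullet> w) * (LINT y|N. iexp ((- w) \<bullet> y))"
      by simp
  qed
  finally show ?thesis .
qed

lemma gauss_smoothing_pointwise_limit: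
  fixes N :: "nat \<Rightarrow> (real^'n) measure" and L :: "(real^'n) measure"
  assumes N: "\<And>n. prob_space (N n)" "\<And>n. sets (N n) = sets borel"
    and L: "prob_space L" "sets L = sets borel"
    and char: "\<And>t. (\<lambda>n. LINT y|N n. iexp (t \<bullet> y)) \<longlonglongrightarrow> (LINT y|L. iexp (t \<bullet> y))"
    and \<sigma>: "\<sigma> > 0"
  shows "(\<lambda>n. LINT y|N n. gauss_kernel \<sigma> (x - y)) \<longlonglongrightarrow> (LINT y|L. gauss_kernel \<sigma> (x - y))"
proof -
  let ?G = "density lborel (gauss_kernel (1 / \<sigma>)) :: (real^'n) measure"
  interpret G: prob_space ?G by (rule prob_space_gauss_kernel) (use \<sigma> in simp)
  have meas: "(\<lambda>w. LINT y|Q. iexp ((- w) \<bullet> y)) \<in> borel_measurable borel"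
    if "prob_space Q" "sets Q = sets borel" for Q :: "(real^'n) measure"
  proof -
    interpret Q: prob_space Q by fact
    have [measurable_cong]: "sets Q = sets borel" by fact
    show ?thesis by measurable
  qed
  have bound: "cmod (LINT y|Q. iexp ((- w) \<bullet> y)) \<le> 1"
    if "prob_space Q" for Q :: "(real^'n) measure" and w
  proof -
    interpret Q: prob_space Q by fact
    show ?thesis
      by (rule order_trans[OF integral_norm_bound]) (simp add: Q.prob_space)
  qed
  have [measurable]: "(\<lambda>w. LINT y|L. iexp ((- w) \<bullet> y)) \<in> borel_measurable borel"
    "(\<lambda>w. LINT y|N n. iexp ((- w) \<bullet> y)) \<in> borel_measurable borel" for n
    using meas N L by blast+
  have "(\<lambda>n. LINT w|?G. iexp (x \<bullet> w) * (LINT y|N n. iexp ((- w) \<bullet> y)))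
      \<longlonglongrightarrow> (LINT w|?G. iexp (x \<bullet> w) * (LINT y|L. iexp ((- w) \<bullet> y)))"
  proof (rule integral_dominated_convergence[where w="\<lambda>_. 1"])
    show "AE w in ?G. (\<lambda>n. iexp (x \<bullet> w) * (LINT y|N n. iexp ((- w) \<bullet> y)))
        \<longlonglongrightarrow> iexp (x \<bullet> w) * (LINT y|L. iexp ((- w) \<bullet> y))"
      by (intro AE_I2 tendsto_mult_left char)
    show "AE w in ?G. cmod (iexp (x \<bullet> w) * (LINT y|N n. iexp ((- w) \<bullet> y))) \<le> 1" for n
      by (intro AE_I2) (simp add: norm_mult bound[OF N(1)] del: inner_minus_left)
    show "(\<lambda>w. iexp (x \<bullet> w) * (LINT y|L. iexp ((- w) \<bullet> y))) \<in> borel_measurable ?G"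
      "(\<lambda>w. iexp (x \<bullet> w) * (LINT y|N n. iexp ((- w) \<bullet> y))) \<in> borel_measurable ?G" for n
      by measurable
  qed simp
  then have "(\<lambda>n. complex_of_real (LINT y|N n. gauss_kernel \<sigma> (x - y)))
      \<longlonglongrightarrow> complex_of_real (LINT y|L. gauss_kernel \<sigma> (x - y))"
    unfolding gauss_smoothing_eq_char[OF N \<sigma>] gauss_smoothing_eq_char[OF L \<sigma>]
    by (rule tendsto_mult_left)
  then show ?thesis by (simp add: tendsto_of_real_iff)
qed

text \<open>Adding independent normal noise to a variable with law \<open>N\<close> and then taking the expectation of
  \<open>g\<close> is integrating \<open>g\<close> against the smoothed density.\<close>

lemma gauss_smoothing_integral:
  fixes N :: "(real^'n) measure" and g :: "real^'n \<Rightarrow> real"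
  assumes N: "prob_space N" "sets N = sets borel" and \<sigma>: "\<sigma> > 0" and g: "integrable lborel g"
  shows "(LINT y|N. LINT u|lborel. g (y + u) * gauss_kernel \<sigma> u)
     = (LINT x|lborel. g x * (LINT y|N. gauss_kernel \<sigma> (x - y)))"
proof -
  interpret N: prob_space N by fact
  have [measurable_cong]: "sets N = sets borel" by fact
  have [measurable]: "g \<in> borel_measurable borel" using borel_measurable_integrable[OF g] by simp
  interpret P: pair_sigma_finite N "lborel :: (real^'n) measure" ..
  have shift: "(LINT u|lborel. g (y + u) * gauss_kernel \<sigma> u) = (LINT x|lborel. g x * gauss_kernel \<sigma> (x - y))" for y
  proof -
    have "(LINT x|lborel. g x * gauss_kernel \<sigma> (x - y)) = (LINT x|distr lborel borel ((+) y). g x * gauss_kernel \<sigma> (x - y))"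
      by (simp add: lborel_distr_plus)
    also have "\<dots> = (LINT u|lborel. g (y + u) * gauss_kernel \<sigma> u)"
      by (subst integral_distr) auto
    finally show ?thesis by simp
  qed
  have "integrable (N \<Otimes>\<^sub>M lborel) (\<lambda>p. g (snd p))"
  proof (rule integrableI_bounded)
    have "(\<integral>\<^sup>+ p. ennreal (norm (g (snd p))) \<partial>(N \<Otimes>\<^sub>M lborel)) = (\<integral>\<^sup>+ y. \<integral>\<^sup>+ x. ennreal (norm (g x)) \<partial>lborel \<partial>N)"
      by (subst lborel.nn_integral_fst[symmetric]) auto
    also have "\<dots> = (\<integral>\<^sup>+ x. ennreal (norm (g x)) \<partial>lborel)"
      by (simp add: N.emeasure_space_1)
    also have "\<dots> < \<infinity>" using g by (simp add: integrable_iff_bounded)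
    finally show "(\<integral>\<^sup>+ p. ennreal (norm (g (snd p))) \<partial>(N \<Otimes>\<^sub>M lborel)) < \<infinity>" .
  qed measurable
  then have "integrable (N \<Otimes>\<^sub>M lborel) (\<lambda>p. gauss_kernel \<sigma> (0::real^'n) * g (snd p))"
    by simp
  then have "integrable (N \<Otimes>\<^sub>M lborel) (case_prod (\<lambda>y x. g x * gauss_kernel \<sigma> (x - y)))"
    by (rule Bochner_Integration.integrable_bound)
       (auto simp: split_beta abs_mult gauss_kernel_nonneg gauss_kernel_le[OF \<sigma>]
             mult.commute[of "gauss_kernel \<sigma> 0"] intro!: mult_left_mono)
  from P.Fubini_integral[OF this] show ?thesis by (simp add: shift)
qed

lemma gauss_smoothing_error:
  fixes g :: "real^'n \<Rightarrow> real"
  assumes \<sigma>: "\<sigma> > 0" and g: "integrable lborel g" and lip: "\<And>x y. \<bar>g x - g y\<bar> \<le> c * norm (x - y)"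
  shows "\<bar>(LINT u|lborel. g (y + u) * gauss_kernel \<sigma> u) - g y\<bar> \<le> c * (CARD('n) * sqrt (2 / pi) * \<sigma>)"
proof -
  have c: "0 \<le> c"
  proof -
    have "0 \<le> c * norm (axis undefined 1 - 0 :: real^'n)" using lip by (meson abs_ge_zero order_trans)
    then show ?thesis by simp
  qed
  have [measurable]: "g \<in> borel_measurable borel" using borel_measurable_integrable[OF g] by simp
  note k = gauss_kernel_integral[OF \<sigma>, where 'n='n] and m = gauss_kernel_first_moment[OF \<sigma>, where 'n='n]
  have int: "integrable lborel (\<lambda>u. (g (y + u) - g y) * gauss_kernel \<sigma> u)"
    by (rule Bochner_Integration.integrable_bound[OF integrable_mult_right[OF m(1), of c]])
       (use lip[of "y + _" y] c in \<open>auto simp: abs_mult gauss_kernel_nonneg mult.assoc[symmetric] intro!: mult_right_mono\<close>)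
  have "(LINT u|lborel. g (y + u) * gauss_kernel \<sigma> u)
      = (LINT u|lborel. (g (y + u) - g y) * gauss_kernel \<sigma> u + g y * gauss_kernel \<sigma> u)"
    by (intro Bochner_Integration.integral_cong) (auto simp: algebra_simps)
  also have "\<dots> = (LINT u|lborel. (g (y + u) - g y) * gauss_kernel \<sigma> u) + g y"
    using int k by (subst Bochner_Integration.integral_add) auto
  finally have "\<bar>(LINT u|lborel. g (y + u) * gauss_kernel \<sigma> u) - g y\<bar>
      = \<bar>LINT u|lborel. (g (y + u) - g y) * gauss_kernel \<sigma> u\<bar>" by simp
  also have "\<dots> \<le> (LINT u|(lborel :: (real^'n) measure). c * (norm u * gauss_kernel \<sigma> u))"
  proof (rule abs_integral_le[OF int])
    show "integrable lborel (\<lambda>u::real^'n. c * (norm u * gauss_kernel \<sigma> u))" using m(1) by simp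
  qed (use lip[of "y + _" y] in \<open>auto simp: abs_mult gauss_kernel_nonneg mult.assoc[symmetric] intro!: mult_right_mono\<close>)
  also have "\<dots> \<le> c * (CARD('n) * sqrt (2 / pi) * \<sigma>)"
    using mult_left_mono[OF m(2) c] by simp
  finally show ?thesis .
qed

text \<open>Fix the width \<open>\<sigma>\<close> so small that smoothing changes the Lipschitz function \<open>g\<close> by at most
  \<open>e / 4\<close> everywhere. The smoothed densities converge pointwise and are bounded by the peak of the
  kernel, so integrability of \<open>g\<close> over the whole space allows dominated convergence.\<close>

lemma char_limit_imp_lipschitz_limit:
  fixes N :: "nat \<Rightarrow> (real^'n) measure" and L :: "(real^'n) measure" and g :: "real^'n \<Rightarrow> real"
  assumes N: "\<And>n. prob_space (N n)" "\<And>n. sets (N n) = sets borel"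
    and L: "prob_space L" "sets L = sets borel"
    and char: "\<And>t. (\<lambda>n. LINT y|N n. iexp (t \<bullet> y)) \<longlonglongrightarrow> (LINT y|L. iexp (t \<bullet> y))"
    and g: "integrable lborel g" "\<And>y. \<bar>g y\<bar> \<le> B" and lip: "\<And>x y. \<bar>g x - g y\<bar> \<le> c * norm (x - y)"
  shows "(\<lambda>n. LINT y|N n. g y) \<longlonglongrightarrow> (LINT y|L. g y)"
proof (rule LIMSEQ_I)
  fix e :: real assume e: "e > 0"
  define a where "a = CARD('n) * sqrt (2 / pi)"
  have a: "a \<ge> 0" by (simp add: a_def)
  define \<sigma> where "\<sigma> = e / (4 * (\<bar>c\<bar> * a + 1))"
  have \<sigma>: "\<sigma> > 0" unfolding \<sigma>_def using e a by (intro divide_pos_pos) (auto simp: add_nonneg_pos)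
  have small: "c * (a * \<sigma>) \<le> e / 4"
  proof -
    have "c * (a * \<sigma>) \<le> (\<bar>c\<bar> * a) * \<sigma>" using \<sigma> a by (simp add: mult.assoc[symmetric] mult_right_mono)
    also have "\<dots> \<le> (\<bar>c\<bar> * a + 1) * \<sigma>" using \<sigma> by (simp add: algebra_simps)
    also have "\<dots> = e / 4"
    proof -
      have "\<bar>c\<bar> * a + 1 > 0" using a by (simp add: add_nonneg_pos)
      then show ?thesis unfolding \<sigma>_def by (simp add: field_simps)
    qed
    finally show ?thesis .
  qed
  have [measurable]: "g \<in> borel_measurable borel" using borel_measurable_integrable[OF g(1)] by simp
  let ?s = "\<lambda>y. LINT u|lborel. g (y + u) * gauss_kernel \<sigma> u"
  have sm [measurable]: "?s \<in> borel_measurable borel" by measurable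
  have err: "\<bar>?s y - g y\<bar> \<le> e / 4" for y
    using gauss_smoothing_error[OF \<sigma> g(1) lip, of y] small unfolding a_def by simp
  have close: "\<bar>(LINT y|Q. ?s y) - (LINT y|Q. g y)\<bar> \<le> e / 4"
    if Q: "prob_space Q" "sets Q = sets borel" for Q :: "(real^'n) measure"
  proof -
    interpret Q: prob_space Q by fact
    have [measurable_cong]: "sets Q = sets borel" by fact
    have ig: "integrable Q g" by (rule Q.integrable_const_bound[where B=B]) (use g(2) in auto)
    have is': "integrable Q ?s"
    proof (rule Q.integrable_const_bound[where B="B + e / 4"])
      have "\<bar>?s y\<bar> \<le> B + e / 4" for y using err[of y] g(2)[of y] by linarith
      then show "AE y in Q. norm (?s y) \<le> B + e / 4" by auto
    qed simp
    have "\<bar>(LINT y|Q. ?s y) - (LINT y|Q. g y)\<bar> = \<bar>LINT y|Q. ?s y - g y\<bar>"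
      using ig is' by simp
    also have "\<dots> \<le> (LINT y|Q. e / 4)"
      by (rule abs_integral_le) (use ig is' err in auto)
    finally show ?thesis by (simp add: Q.prob_space)
  qed
  have "(\<lambda>n. LINT x|lborel. g x * (LINT y|N n. gauss_kernel \<sigma> (x - y)))
      \<longlonglongrightarrow> (LINT x|lborel. g x * (LINT y|L. gauss_kernel \<sigma> (x - y)))"
  proof (rule integral_dominated_convergence[where w="\<lambda>x. \<bar>g x\<bar> * gauss_kernel \<sigma> (0::real^'n)"])
    have meas: "(\<lambda>x. LINT y|Q. gauss_kernel \<sigma> (x - y)) \<in> borel_measurable lborel"
      if "prob_space Q" "sets Q = sets borel" for Q :: "(real^'n) measure"
    proof -
      interpret Q: prob_space Q by fact
      have [measurable_cong]: "sets Q = sets borel" by fact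
      show ?thesis by measurable
    qed
    show "(\<lambda>x. g x * (LINT y|L. gauss_kernel \<sigma> (x - y))) \<in> borel_measurable lborel"
      by (intro borel_measurable_times meas L) simp
    show "(\<lambda>x. g x * (LINT y|N n. gauss_kernel \<sigma> (x - y))) \<in> borel_measurable lborel" for n
      by (intro borel_measurable_times meas N) simp
    show "integrable lborel (\<lambda>x. \<bar>g x\<bar> * gauss_kernel \<sigma> (0::real^'n))" using g(1) by simp
    show "AE x in lborel. (\<lambda>n. g x * (LINT y|N n. gauss_kernel \<sigma> (x - y))) \<longlonglongrightarrow> g x * (LINT y|L. gauss_kernel \<sigma> (x - y))"
      by (intro AE_I2 tendsto_mult_left gauss_smoothing_pointwise_limit[OF N L char \<sigma>])
    have "0 \<le> (LINT y|N n. gauss_kernel \<sigma> (x - y))" "(LINT y|N n. gauss_kernel \<sigma> (x - y)) \<le> gauss_kernel \<sigma> (0::real^'n)" for n x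
    proof -
      interpret Q: prob_space "N n" by (rule N)
      have [measurable_cong]: "sets (N n) = sets borel" by (rule N)
      show "0 \<le> (LINT y|N n. gauss_kernel \<sigma> (x - y))"
        by (intro Bochner_Integration.integral_nonneg gauss_kernel_nonneg)
      have "(LINT y|N n. gauss_kernel \<sigma> (x - y)) \<le> (LINT y|N n. gauss_kernel \<sigma> (0::real^'n))"
        by (intro integral_mono Q.integrable_const_bound[where B="gauss_kernel \<sigma> (0::real^'n)"])
           (auto simp: gauss_kernel_nonneg gauss_kernel_le[OF \<sigma>])
      then show "(LINT y|N n. gauss_kernel \<sigma> (x - y)) \<le> gauss_kernel \<sigma> (0::real^'n)"
        by (simp add: Q.prob_space)
    qed
    then show "AE x in lborel. norm (g x * (LINT y|N n. gauss_kernel \<sigma> (x - y))) \<le> \<bar>g x\<bar> * gauss_kernel \<sigma> (0::real^'n)" for n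
      by (intro AE_I2) (auto simp: abs_mult intro!: mult_left_mono)
  qed
  then have "(\<lambda>n. LINT y|N n. ?s y) \<longlonglongrightarrow> (LINT y|L. ?s y)"
    unfolding gauss_smoothing_integral[OF N \<sigma> g(1)] gauss_smoothing_integral[OF L \<sigma> g(1)] .
  from LIMSEQ_D[OF this, of "e / 4"] e
  obtain n0 where n0: "\<And>n. n \<ge> n0 \<Longrightarrow> \<bar>(LINT y|N n. ?s y) - (LINT y|L. ?s y)\<bar> < e / 4"
    by auto
  show "\<exists>n0. \<forall>n\<ge>n0. norm ((LINT y|N n. g y) - (LINT y|L. g y)) < e"
  proof (intro exI allI impI)
    fix n assume "n \<ge> n0"
    from n0[OF this] close[OF N, of n] close[OF L] e
    show "norm ((LINT y|N n. g y) - (LINT y|L. g y)) < e"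
      unfolding real_norm_def by linarith
  qed
qed

text \<open>The approximants are the Lipschitz regularisations
  \<open>inf\<^sub>y (g y + k |x - y|)\<close>, cut off by a function supported in the ball of radius \<open>k\<close>.\<close>

lemma lipschitz_approximation_below:
  fixes g :: "real^'n \<Rightarrow> real"
  assumes cont: "continuous_on UNIV g" and g: "\<And>y. 0 \<le> g y" "\<And>y. g y \<le> B"
  obtains h :: "nat \<Rightarrow> real^'n \<Rightarrow> real"
    where "\<And>k x. 0 \<le> h k x" "\<And>k x. h k x \<le> g x" "\<And>k. integrable lborel (h k)"
      "\<And>k x y. \<bar>h k x - h k y\<bar> \<le> (B + k) * norm (x - y)" "\<And>x. (\<lambda>k. h k x) \<longlonglongrightarrow> g x"
proof -
  define r where "r k x = (INF y. g y + real k * norm (x - y))" for k x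
  define \<psi> where "\<psi> k x = max 0 (min 1 (real k - norm x))" for k and x :: "real^'n"
  have B: "0 \<le> B" using g order_trans by blast
  have bdd: "bdd_below (range (\<lambda>y. g y + real k * norm (x - y)))" for k x
    by (rule bdd_belowI[of _ 0]) (auto simp: g)
  have r0: "0 \<le> r k x" for k x
    unfolding r_def by (rule cINF_greatest) (auto simp: g)
  have rg: "r k x \<le> g x" for k x
    unfolding r_def using cINF_lower[OF bdd, of x k x] by simp
  have rlip1: "r k x \<le> r k y + real k * norm (x - y)" for k x y
  proof -
    have "r k x - real k * norm (x - y) \<le> r k y"
      unfolding r_def[of k y]
    proof (rule cINF_greatest)
      fix z
      have "r k x \<le> g z + real k * norm (x - z)" unfolding r_def by (rule cINF_lower[OF bdd]) simp
      moreover have "real k * norm (x - z) \<le> real k * (norm (x - y) + norm (y - z))"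
        using norm_triangle_ineq[of "x - y" "y - z"] by (intro mult_left_mono) auto
      ultimately show "r k x - real k * norm (x - y) \<le> g z + real k * norm (y - z)"
        by (simp add: algebra_simps)
    qed simp
    then show ?thesis by simp
  qed
  have rlip: "\<bar>r k x - r k y\<bar> \<le> real k * norm (x - y)" for k x y
    using rlip1[of k x y] rlip1[of k y x] by (simp add: abs_le_iff norm_minus_commute)
  have \<psi>: "0 \<le> \<psi> k x" "\<psi> k x \<le> 1" for k x by (auto simp: \<psi>_def)
  have \<psi>lip: "\<bar>\<psi> k x - \<psi> k y\<bar> \<le> norm (x - y)" for k x y
    using norm_triangle_ineq3[of x y] unfolding \<psi>_def by linarith
  define h where "h k x = r k x * \<psi> k x" for k x
  have h0: "0 \<le> h k x" for k x using r0 \<psi> by (simp add: h_def)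
  have hr: "h k x \<le> r k x" for k x using r0 \<psi> by (simp add: h_def mult_left_le)
  have hg: "h k x \<le> g x" for k x using hr rg order_trans by blast
  have lip: "\<bar>h k x - h k y\<bar> \<le> (B + k) * norm (x - y)" for k x y
  proof -
    have "h k x - h k y = r k x * (\<psi> k x - \<psi> k y) + (r k x - r k y) * \<psi> k y"
      by (simp add: h_def algebra_simps)
    also have "\<bar>\<dots>\<bar> \<le> \<bar>r k x\<bar> * \<bar>\<psi> k x - \<psi> k y\<bar> + \<bar>r k x - r k y\<bar> * \<bar>\<psi> k y\<bar>"
      using abs_triangle_ineq by (simp add: abs_mult[symmetric])
    also have "\<dots> \<le> B * norm (x - y) + real k * norm (x - y) * 1"
      using r0 order_trans[OF rg g(2)] \<psi> \<psi>lip rlip B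
      by (intro add_mono mult_mono) auto
    finally show ?thesis by (simp add: algebra_simps)
  qed
  have "continuous_on UNIV (h k)" for k
  proof (rule continuous_on_iff[THEN iffD2], intro ballI allI impI)
    fix x and e :: real assume e: "0 < e"
    show "\<exists>d>0. \<forall>y\<in>UNIV. dist y x < d \<longrightarrow> dist (h k y) (h k x) < e"
    proof (intro exI conjI ballI impI)
      show "0 < e / (B + k + 1)" using e B by (simp add: add_nonneg_pos)
      fix y assume d: "dist y x < e / (B + k + 1)"
      have "\<bar>h k y - h k x\<bar> \<le> (B + k) * norm (y - x)" by (rule lip)
      also have "\<dots> \<le> (B + k + 1) * norm (y - x)" by (intro mult_right_mono) auto
      also have "\<dots> < e" using d B by (simp add: dist_norm field_simps add_nonneg_pos)
      finally show "dist (h k y) (h k x) < e" by (simp add: dist_real_def)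
    qed
  qed
  then have meas: "h k \<in> borel_measurable borel" for k
    by (rule borel_measurable_continuous_onI)
  have int: "integrable lborel (h k)" for k
  proof (rule integrableI_bounded_set[where A="cball 0 (real k)" and B=B])
    show "emeasure lborel (cball (0::real^'n) (real k)) < \<infinity>"
      by (rule emeasure_bounded_finite) simp
    show "AE x in lborel. x \<notin> cball 0 (real k) \<longrightarrow> h k x = 0"
      by (auto simp: h_def \<psi>_def)
    show "AE x in lborel. x \<in> cball 0 (real k) \<longrightarrow> norm (h k x) \<le> B"
      using h0 order_trans[OF hg g(2)] by auto
  qed (use meas in auto)
  have lim: "(\<lambda>k. h k x) \<longlonglongrightarrow> g x" for x
  proof (rule LIMSEQ_I)
    fix e :: real assume e: "0 < e"
    have "\<exists>d>0. \<forall>y. dist y x < d \<longrightarrow> dist (g y) (g x) < e / 2"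
      using cont e unfolding continuous_on_iff by (meson UNIV_I half_gt_zero)
    then obtain d where d: "d > 0" "\<And>y. dist y x < d \<Longrightarrow> dist (g y) (g x) < e / 2" by blast
    obtain k0 :: nat where k0: "real k0 \<ge> B / d + norm x + 1"
      using real_arch_simple by blast
    show "\<exists>k0. \<forall>k\<ge>k0. norm (h k x - g x) < e"
    proof (intro exI allI impI)
      fix k assume k: "k \<ge> k0"
      have Bd: "0 \<le> B / d" using B d by simp
      have "\<psi> k x = 1" using k k0 Bd unfolding \<psi>_def by auto
      then have hk: "h k x = r k x" by (simp add: h_def)
      have "g x - e / 2 \<le> r k x"
        unfolding r_def
      proof (rule cINF_greatest)
        fix y
        show "g x - e / 2 \<le> g y + real k * norm (x - y)"
        proof (cases "dist y x < d")
          case True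
          have "0 \<le> real k * norm (x - y)" by simp
          then show ?thesis using d(2)[OF True] unfolding dist_real_def by linarith
        next
          case False
          have "real k \<ge> B / d" using k k0 norm_ge_zero[of x] by linarith
          then have "real k * norm (x - y) \<ge> B / d * d"
            using False d(1) Bd by (intro mult_mono) (auto simp: dist_norm norm_minus_commute)
          then show ?thesis using d(1) g(1)[of y] g(2)[of x] e by auto
        qed
      qed simp
      then show "norm (h k x - g x) < e" using hk rg[of k x] e by auto
    qed
  qed
  show ?thesis using that[of h] h0 hg int lip lim by blast
qed

text \<open>Lipschitz approximation from below gives one half of the limit for nonnegative test functions.
  Since constants pass to the limit, applying that half to \<open>B + g\<close> and to \<open>B - g\<close> gives both
  halves for a test function bounded by \<open>B\<close>.\<close>

theorem levy_continuity_vec: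
  fixes N :: "nat \<Rightarrow> (real^'n) measure" and L :: "(real^'n) measure"
  assumes N: "\<And>n. prob_space (N n)" "\<And>n. sets (N n) = sets borel"
    and L: "prob_space L" "sets L = sets borel"
    and char: "\<And>t. (\<lambda>n. LINT y|N n. iexp (t \<bullet> y)) \<longlonglongrightarrow> (LINT y|L. iexp (t \<bullet> y))"
  shows "weak_conv_vec N L"
proof -
  have int: "integrable Q g"
    if "prob_space Q" "sets Q = sets borel" "g \<in> borel_measurable borel" "\<And>y. \<bar>g y\<bar> \<le> B"
    for Q :: "(real^'n) measure" and g :: "real^'n \<Rightarrow> real" and B
  proof -
    interpret Q: prob_space Q by fact
    have [measurable_cong]: "sets Q = sets borel" by fact
    show ?thesis by (rule Q.integrable_const_bound[where B=B]) (use that in auto)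
  qed
  have lower: "\<forall>\<^sub>F n in sequentially. (LINT y|L. g y) - e < (LINT y|N n. g y)"
    if cont: "continuous_on UNIV g" and g: "\<And>y. 0 \<le> g y" "\<And>y. g y \<le> B" and e: "e > 0"
    for g :: "real^'n \<Rightarrow> real" and B e
  proof -
    obtain h :: "nat \<Rightarrow> real^'n \<Rightarrow> real" where h: "\<And>k x. 0 \<le> h k x" "\<And>k x. h k x \<le> g x"
      "\<And>k. integrable lborel (h k)" "\<And>k x y. \<bar>h k x - h k y\<bar> \<le> (B + k) * norm (x - y)"
      "\<And>x. (\<lambda>k. h k x) \<longlonglongrightarrow> g x"
      using lipschitz_approximation_below[OF cont g] by metis
    have gm [measurable]: "g \<in> borel_measurable borel" by (rule borel_measurable_continuous_onI[OF cont])
    have hm [measurable]: "h k \<in> borel_measurable borel" for k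
      using borel_measurable_integrable[OF h(3)[of k]] by simp
    have hB: "\<bar>h k y\<bar> \<le> B" for k y using h(1,2)[of k y] g(2)[of y] by auto
    have gB: "\<bar>g y\<bar> \<le> B" for y using g[of y] by auto
    have [measurable_cong]: "sets L = sets borel" by fact
    have "(\<lambda>k. LINT y|L. h k y) \<longlonglongrightarrow> (LINT y|L. g y)"
      by (rule integral_dominated_convergence[where w=g])
         (use h g in \<open>auto intro!: int[OF L _ gB]\<close>)
    from LIMSEQ_D[OF this, of "e / 2"] e
    obtain k where k: "\<bar>(LINT y|L. h k y) - (LINT y|L. g y)\<bar> < e / 2" by auto
    have "(\<lambda>n. LINT y|N n. h k y) \<longlonglongrightarrow> (LINT y|L. h k y)"
      by (rule char_limit_imp_lipschitz_limit[OF N L char h(3) hB h(4)])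
    then have "\<forall>\<^sub>F n in sequentially. (LINT y|L. h k y) - e / 2 < (LINT y|N n. h k y)"
      using e by (intro order_tendstoD(1)[of _ "LINT y|L. h k y"]) auto
    then show ?thesis
    proof eventually_elim
      case (elim n)
      have "(LINT y|N n. h k y) \<le> (LINT y|N n. g y)"
        by (intro integral_mono int[OF N _ hB] int[OF N _ gB]) (use h in auto)
      then show ?case using elim k by linarith
    qed
  qed
  show ?thesis
    unfolding weak_conv_vec_def
  proof (intro allI impI, elim conjE)
    fix g :: "real^'n \<Rightarrow> real"
    assume cont: "continuous_on UNIV g" and "bounded (range g)"
    then obtain B where B: "\<And>y. \<bar>g y\<bar> \<le> B" by (auto simp: bounded_iff)
    have gm [measurable]: "g \<in> borel_measurable borel" by (rule borel_measurable_continuous_onI[OF cont])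
    have shift: "(LINT y|Q. B + s * g y) = B + s * (LINT y|Q. g y)"
      if Q: "prob_space Q" "sets Q = sets borel" for Q :: "(real^'n) measure" and s :: real
    proof -
      interpret Q: prob_space Q by fact
      show ?thesis using int[OF Q gm B] by (simp add: Q.prob_space)
    qed
    have ev: "\<forall>\<^sub>F n in sequentially. s * (LINT y|L. g y) - e < s * (LINT y|N n. g y)"
      if "e > 0" "s = 1 \<or> s = - 1" for e s :: real
    proof -
      have bb: "0 \<le> B + s * g y" "B + s * g y \<le> 2 * B" for y
        using that(2) B[of y] by (auto simp: abs_le_iff)
      have "continuous_on UNIV (\<lambda>y. B + s * g y)" using cont by (intro continuous_intros) auto
      from lower[OF this bb that(1)] show ?thesis
        by (simp add: shift[OF L] shift[OF N] add_diff_eq[symmetric])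
    qed
    show "(\<lambda>n. LINT y|N n. g y) \<longlonglongrightarrow> (LINT y|L. g y)"
    proof (rule tendstoI)
      fix e :: real assume "e > 0"
      have "\<forall>\<^sub>F n in sequentially. (LINT y|L. g y) - e < (LINT y|N n. g y)"
        "\<forall>\<^sub>F n in sequentially. - (LINT y|L. g y) - e < - (LINT y|N n. g y)"
        using ev[OF \<open>e > 0\<close>, of 1] ev[OF \<open>e > 0\<close>, of "-1"] by simp_all
      then show "\<forall>\<^sub>F n in sequentially. dist (LINT y|N n. g y) (LINT y|L. g y) < e"
        by eventually_elim (auto simp: dist_real_def)
    qed
  qed
qed

section \<open>Triangular arrays\<close>

text \<open>The law \<open>\<nu> n\<close> may vary with the row, so the limit theorem for a fixed law does not apply; the
  uniform third moment replaces it and makes the error \<open>n \<cdot> O (n\<^sup>-\<^sup>3\<^sup>/\<^sup>2)\<close>. The hypotheses are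
  asked for large \<open>n\<close> only, because the rows to which this is applied need an inverse matrix that
  exists only eventually.\<close>

lemma (in prob_space) char_triangular_array_limit:
  fixes Y :: "nat \<Rightarrow> nat \<Rightarrow> 'a \<Rightarrow> real" and \<nu> :: "nat \<Rightarrow> real measure"
  assumes v: "v \<ge> 0"
    and ev: "\<forall>\<^sub>F n in sequentially. indep_vars (\<lambda>_. borel) (Y n) {1..n} \<and>
      (\<forall>i\<in>{1..n}. distr M borel (Y n i) = \<nu> n) \<and>
      integrable (\<nu> n) (\<lambda>x. \<bar>x\<bar> ^ 3) \<and> (LINT x|\<nu> n. x) = 0 \<and> (LINT x|\<nu> n. x\<^sup>2) = v \<and>
      (LINT x|\<nu> n. \<bar>x\<bar> ^ 3) \<le> C"
  shows "(\<lambda>n. LINT \<omega>|M. iexp ((\<Sum>i=1..n. Y n i \<omega>) / sqrt n)) \<longlonglongrightarrow> exp (- v / 2)"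
proof -
  have "\<forall>\<^sub>F n in sequentially.
      cmod ((LINT \<omega>|M. iexp ((\<Sum>i=1..n. Y n i \<omega>) / sqrt n)) - of_real ((1 + (- v / 2) / n) ^ n)) \<le> (C / 6) * (1 / sqrt n)"
    using ev eventually_gt_at_top[of "nat \<lceil>v\<rceil>"]
  proof eventually_elim
    case (elim n)
    then have indep: "indep_vars (\<lambda>_. borel) (Y n) {1..n}"
      and dist: "\<And>i. i \<in> {1..n} \<Longrightarrow> distr M borel (Y n i) = \<nu> n"
      and i3: "integrable (\<nu> n) (\<lambda>x. \<bar>x\<bar> ^ 3)" and m1: "(LINT x|\<nu> n. x) = 0"
      and m2: "(LINT x|\<nu> n. x\<^sup>2) = v" and m3: "(LINT x|\<nu> n. \<bar>x\<bar> ^ 3) \<le> C"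
      by auto
    have n: "n > 0" "v < n" using elim v by linarith+
    have Y [measurable]: "Y n i \<in> borel_measurable M" if "i \<in> {1..n}" for i
      using indep that unfolding indep_vars_def2 by simp
    have S [measurable]: "(\<lambda>\<omega>. \<Sum>i=1..n. Y n i \<omega>) \<in> borel_measurable M"
      by (rule borel_measurable_sum) (rule Y)
    have "1 \<in> {1..n}" using n by simp
    then have "real_distribution (\<nu> n)"
      using dist[of 1] Y[of 1] real_distribution_distr[of "Y n 1"] by simp
    then interpret \<nu>: real_distribution "\<nu> n" .
    have i1: "integrable (\<nu> n) (\<lambda>x. x)" and i2: "integrable (\<nu> n) (\<lambda>x. x\<^sup>2)"
    proof -
      have int: "integrable (\<nu> n) (\<lambda>x. 1 + \<bar>x\<bar> ^ 3)" using i3 by simp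
      have b: "\<bar>x\<bar> \<le> 1 + \<bar>x\<bar> ^ 3 \<and> x\<^sup>2 \<le> 1 + \<bar>x\<bar> ^ 3" for x :: real
      proof (cases "\<bar>x\<bar> \<le> 1")
        case True
        then have "\<bar>x\<bar> ^ 2 \<le> 1" by (simp add: abs_square_le_1)
        moreover have "0 \<le> \<bar>x\<bar> ^ 3" by simp
        ultimately show ?thesis using True unfolding power2_abs by linarith
      next
        case False
        then have "\<bar>x\<bar> ^ 1 \<le> \<bar>x\<bar> ^ 3" "\<bar>x\<bar> ^ 2 \<le> \<bar>x\<bar> ^ 3" by (intro power_increasing; simp)+
        then show ?thesis unfolding power2_abs by (simp add: add_increasing)
      qed
      show "integrable (\<nu> n) (\<lambda>x. x)"
        by (rule Bochner_Integration.integrable_bound[OF int]) (use b in auto)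
      show "integrable (\<nu> n) (\<lambda>x. x\<^sup>2)"
        by (rule Bochner_Integration.integrable_bound[OF int]) (use b in auto)
    qed
    let ?s = "1 / sqrt n"
    have s2: "?s\<^sup>2 = 1 / n" using n by (simp add: power_divide)
    have "(LINT \<omega>|M. iexp ((\<Sum>i=1..n. Y n i \<omega>) / sqrt n)) = char (distr M borel (\<lambda>\<omega>. \<Sum>i=1..n. Y n i \<omega>)) ?s"
      unfolding char_def by (subst integral_distr) auto
    also have "\<dots> = (\<Prod>i=1..n. char (distr M borel (Y n i)) ?s)"
      by (rule char_distr_sum[OF indep])
    also have "\<dots> = char (\<nu> n) ?s ^ n"
      by (simp add: dist)
    finally have eq: "(LINT \<omega>|M. iexp ((\<Sum>i=1..n. Y n i \<omega>) / sqrt n)) = char (\<nu> n) ?s ^ n" .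
    have var: "\<nu>.variance (\<lambda>x. x) = v" by (simp add: m1 m2)
    have "cmod (char (\<nu> n) ?s - (1 - ?s\<^sup>2 * v / 2)) \<le> (?s\<^sup>2 / 6) * \<nu>.expectation (\<lambda>x. min (6 * x\<^sup>2) (\<bar>?s\<bar> * \<bar>x\<bar> ^ 3))"
      by (rule \<nu>.char_approx3[OF i1 m1 i2 var])
    also have "\<dots> \<le> (?s\<^sup>2 / 6) * \<nu>.expectation (\<lambda>x. \<bar>?s\<bar> * \<bar>x\<bar> ^ 3)"
    proof (intro mult_left_mono integral_mono)
      show "integrable (\<nu> n) (\<lambda>x. min (6 * x\<^sup>2) (\<bar>?s\<bar> * \<bar>x\<bar> ^ 3))"
        using i2 i3 by (intro integrable_min) auto
    qed (use i3 in auto)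
    also have "\<dots> \<le> (?s\<^sup>2 / 6) * (?s * C)"
      using m3 n by (intro mult_left_mono) (auto intro!: divide_right_mono)
    finally have approx: "cmod (char (\<nu> n) ?s - of_real (1 + (- v / 2) / n)) \<le> (1 / n) / 6 * (?s * C)"
      unfolding s2 by (simp add: mult.commute)
    have "\<bar>1 + (- v / 2) / n\<bar> \<le> 1" using n v by (auto simp: abs_le_iff field_simps)
    then have "cmod (char (\<nu> n) ?s ^ n - (of_real (1 + (- v / 2) / n)) ^ n) \<le> n * cmod (char (\<nu> n) ?s - of_real (1 + (- v / 2) / n))"
      by (intro norm_power_diff \<nu>.cmod_char_le_1) (simp only: norm_of_real)
    also have "\<dots> \<le> n * ((1 / n) / 6 * (?s * C))"
      by (intro mult_left_mono approx) simp
    also have "\<dots> = (C / 6) * (1 / sqrt n)" using n by simp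
    finally show ?case unfolding eq of_real_power .
  qed
  moreover have "(\<lambda>n. (C / 6) * (1 / sqrt (real n))) \<longlonglongrightarrow> 0"
    by real_asymp
  ultimately have "(\<lambda>n. (LINT \<omega>|M. iexp ((\<Sum>i=1..n. Y n i \<omega>) / sqrt n)) - of_real ((1 + (- v / 2) / n) ^ n)) \<longlonglongrightarrow> 0"
    by (rule Lim_null_comparison)
  moreover have "(\<lambda>n. complex_of_real ((1 + (- v / 2) / n) ^ n)) \<longlonglongrightarrow> complex_of_real (exp (- v / 2))"
    by (rule isCont_tendsto_compose [OF _ tendsto_exp_limit_sequentially]) auto
  ultimately show ?thesis
    using tendsto_add by fastforce
qed

section \<open>Limits of expectations\<close>

text \<open>Fatou's lemma for bounds \<open>b n\<close> that vary with \<open>n\<close>.\<close>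

lemma fatou_expectation_bound:
  fixes W :: "nat \<Rightarrow> 'a \<Rightarrow> real"
  assumes [measurable]: "W0 \<in> borel_measurable M"
    and int: "\<And>n. integrable M (W n)"
    and nn: "\<And>n x. x \<in> space M \<Longrightarrow> 0 \<le> W n x"
    and lim: "AE x in M. (\<lambda>n. W n x) \<longlonglongrightarrow> W0 x"
    and bd: "\<And>n. (LINT x|M. W n x) \<le> b n" and b: "b \<longlonglongrightarrow> \<beta>"
  shows "integrable M W0" "(LINT x|M. W0 x) \<le> \<beta>" "AE x in M. 0 \<le> W0 x"
proof -
  have [measurable]: "W n \<in> borel_measurable M" for n by (rule borel_measurable_integrable[OF int])
  have nnAE: "AE x in M. \<forall>n. 0 \<le> W n x" by (intro AE_I2 allI nn)
  show W0: "AE x in M. 0 \<le> W0 x"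
    using lim nnAE
  proof eventually_elim
    case (elim x)
    then show ?case by (intro LIMSEQ_le_const[OF elim(1)]) blast
  qed
  have b0: "0 \<le> b n" for n
    by (rule order_trans[OF Bochner_Integration.integral_nonneg[OF nn] bd])
  have "(\<integral>\<^sup>+x. ennreal (W0 x) \<partial>M) = (\<integral>\<^sup>+x. liminf (\<lambda>n. ennreal (W n x)) \<partial>M)"
  proof (rule nn_integral_cong_AE)
    show "AE x in M. ennreal (W0 x) = liminf (\<lambda>n. ennreal (W n x))"
      using lim
    proof eventually_elim
      case (elim x)
      then have "(\<lambda>n. ennreal (W n x)) \<longlonglongrightarrow> ennreal (W0 x)" by (intro tendsto_intros)
      then show ?case by (metis lim_imp_Liminf trivial_limit_sequentially)
    qed
  qed
  also have "\<dots> \<le> liminf (\<lambda>n. \<integral>\<^sup>+x. ennreal (W n x) \<partial>M)"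
    by (rule nn_integral_liminf) simp
  also have "\<dots> \<le> liminf (\<lambda>n. ennreal (b n))"
  proof (rule Liminf_mono, rule always_eventually, rule allI)
    fix n
    have "(\<integral>\<^sup>+x. ennreal (W n x) \<partial>M) = ennreal (LINT x|M. W n x)"
      using int nn by (intro nn_integral_eq_integral) auto
    then show "(\<integral>\<^sup>+x. ennreal (W n x) \<partial>M) \<le> ennreal (b n)" using bd by (simp add: ennreal_leI)
  qed
  also have "liminf (\<lambda>n. ennreal (b n)) = ennreal \<beta>"
    by (intro lim_imp_Liminf tendsto_ennrealI b) simp
  finally have le: "(\<integral>\<^sup>+x. ennreal (W0 x) \<partial>M) \<le> ennreal \<beta>" .
  show "integrable M W0"
    by (rule integrableI_nonneg) (use W0 le in \<open>auto intro: le_less_trans\<close>)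
  then have "(\<integral>\<^sup>+x. ennreal (W0 x) \<partial>M) = ennreal (LINT x|M. W0 x)"
    using W0 by (intro nn_integral_eq_integral)
  moreover have "0 \<le> \<beta>" using b b0 by (intro LIMSEQ_le_const) auto
  ultimately show "(LINT x|M. W0 x) \<le> \<beta>" using le by simp
qed

text \<open>A uniform bound on a superlinear moment, expressed through the majorants
  \<open>\<bar>Y\<^sub>n\<bar> \<le> K + \<epsilon> Z\<^sub>n\<close>, makes the family uniformly integrable. Truncating at level \<open>K\<close> costs
  at most \<open>\<epsilon> E Z\<^sub>n\<close> for every \<open>n\<close> and, by Fatou, in the limit.\<close>

lemma (in prob_space) expectation_tendsto_uniformly_integrable:
  fixes Y Z :: "nat \<Rightarrow> 'a \<Rightarrow> real"
  assumes Ym: "\<And>n. Y n \<in> borel_measurable M" and Y0m: "Y0 \<in> borel_measurable M"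
    and lim: "AE x in M. (\<lambda>n. Y n x) \<longlonglongrightarrow> Y0 x"
    and Z: "\<And>n. integrable M (Z n)" "\<And>n x. 0 \<le> Z n x" "\<And>n. expectation (Z n) \<le> C"
    and dom: "\<And>e. e > 0 \<Longrightarrow> \<exists>K. \<forall>n x. \<bar>Y n x\<bar> \<le> K + e * Z n x"
  shows "integrable M Y0" "(\<lambda>n. expectation (Y n)) \<longlonglongrightarrow> expectation Y0"
proof -
  note [measurable] = Ym Y0m
  have C: "0 \<le> C" by (rule order_trans[OF Bochner_Integration.integral_nonneg[OF Z(2)] Z(3)])
  obtain K1 where K1: "\<And>n x. \<bar>Y n x\<bar> \<le> K1 + 1 * Z n x" using dom[of 1] by auto
  have absint: "integrable M (\<lambda>x. \<bar>Y n x\<bar>)" for n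
    by (rule Bochner_Integration.integrable_bound[where f="\<lambda>x. K1 + 1 * Z n x"])
       (use Z(1) order_trans[OF K1 abs_ge_self] in auto)
  then have Yint: "integrable M (Y n)" for n using Ym integrable_abs_cancel by blast
  have bd: "expectation (\<lambda>x. \<bar>Y n x\<bar>) \<le> K1 + C" for n
  proof -
    have "expectation (\<lambda>x. \<bar>Y n x\<bar>) \<le> expectation (\<lambda>x. K1 + 1 * Z n x)"
      using absint Z K1 by (intro integral_mono) auto
    also have "\<dots> = K1 + expectation (Z n)" using Z(1) by (simp add: prob_space)
    finally show ?thesis using Z(3)[of n] by linarith
  qed
  have "integrable M (\<lambda>x. \<bar>Y0 x\<bar>)"
    by (rule fatou_expectation_bound(1)[where W="\<lambda>n x. \<bar>Y n x\<bar>" and b="\<lambda>_. K1 + C" and \<beta>="K1 + C"])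
       (use absint bd lim in \<open>auto intro: tendsto_intros elim: eventually_mono\<close>)
  then show Y0int: "integrable M Y0" using Y0m integrable_abs_cancel by blast
  show "(\<lambda>n. expectation (Y n)) \<longlonglongrightarrow> expectation Y0"
  proof (rule LIMSEQ_I)
    fix e :: real assume e: "e > 0"
    define \<epsilon> where "\<epsilon> = e / (4 * (C + 1))"
    have \<epsilon>: "\<epsilon> > 0" "\<epsilon> * C < e / 3" using e C by (auto simp: \<epsilon>_def field_simps intro!: add_nonneg_pos)
    obtain K where K: "\<And>n x. \<bar>Y n x\<bar> \<le> K + \<epsilon> * Z n x" using dom[OF \<epsilon>(1)] by auto
    define cl where "cl y = max (- \<bar>K\<bar>) (min \<bar>K\<bar> y)" for y :: real
    have clb: "\<bar>cl y\<bar> \<le> \<bar>K\<bar>" for y by (auto simp: cl_def)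
    have [measurable]: "cl \<in> borel_measurable borel" unfolding cl_def[abs_def] by measurable
    have clint: "integrable M (\<lambda>x. cl (g x))" if [measurable]: "g \<in> borel_measurable M" for g
      by (rule integrable_const_bound[where B="\<bar>K\<bar>"]) (use clb in auto)
    have diff: "\<bar>Y n x - cl (Y n x)\<bar> \<le> \<epsilon> * Z n x" for n x
    proof -
      have "0 \<le> \<epsilon> * Z n x" using Z(2) \<epsilon> by simp
      then show ?thesis using K[of n x] unfolding cl_def by linarith
    qed
    have dint: "integrable M (\<lambda>x. \<bar>Y n x - cl (Y n x)\<bar>)" for n
      by (intro integrable_abs Bochner_Integration.integrable_diff Yint clint) (rule Ym)
    have dexp: "expectation (\<lambda>x. \<bar>Y n x - cl (Y n x)\<bar>) \<le> \<epsilon> * C" for n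
    proof -
      have "expectation (\<lambda>x. \<bar>Y n x - cl (Y n x)\<bar>) \<le> expectation (\<lambda>x. \<epsilon> * Z n x)"
        using dint Z diff by (intro integral_mono) auto
      also have "\<dots> \<le> \<epsilon> * C" using Z(3)[of n] \<epsilon>(1) by simp
      finally show ?thesis .
    qed
    have contcl: "isCont cl y" for y unfolding cl_def by (intro continuous_intros)
    have cllim: "AE x in M. (\<lambda>n. cl (Y n x)) \<longlonglongrightarrow> cl (Y0 x)"
      using lim by eventually_elim (rule isCont_tendsto_compose[OF contcl])
    have dlim: "expectation (\<lambda>x. \<bar>Y0 x - cl (Y0 x)\<bar>) \<le> \<epsilon> * C"
    proof (rule fatou_expectation_bound(2)[where W="\<lambda>n x. \<bar>Y n x - cl (Y n x)\<bar>" and b="\<lambda>_. \<epsilon> * C"])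
      show "AE x in M. (\<lambda>n. \<bar>Y n x - cl (Y n x)\<bar>) \<longlonglongrightarrow> \<bar>Y0 x - cl (Y0 x)\<bar>"
        using lim cllim by eventually_elim (intro tendsto_intros)
    qed (use dint dexp in auto)
    have "(\<lambda>n. expectation (\<lambda>x. cl (Y n x))) \<longlonglongrightarrow> expectation (\<lambda>x. cl (Y0 x))"
      by (rule integral_dominated_convergence[where w="\<lambda>_. \<bar>K\<bar>"]) (use cllim clb in auto)
    from LIMSEQ_D[OF this, of "e / 3"] e obtain n0 where
      n0: "\<And>n. n \<ge> n0 \<Longrightarrow> \<bar>expectation (\<lambda>x. cl (Y n x)) - expectation (\<lambda>x. cl (Y0 x))\<bar> < e / 3" by auto
    have gap: "\<bar>expectation g - expectation (\<lambda>x. cl (g x))\<bar> \<le> \<epsilon> * C"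
      if "integrable M g" "expectation (\<lambda>x. \<bar>g x - cl (g x)\<bar>) \<le> \<epsilon> * C" for g
    proof -
      have "integrable M (\<lambda>x. cl (g x))" using that(1) by (intro clint) auto
      then have "expectation g - expectation (\<lambda>x. cl (g x)) = expectation (\<lambda>x. g x - cl (g x))"
        using that(1) by simp
      also have "\<bar>\<dots>\<bar> \<le> expectation (\<lambda>x. \<bar>g x - cl (g x)\<bar>)" by (rule integral_abs_bound)
      finally show ?thesis using that(2) by linarith
    qed
    show "\<exists>n0. \<forall>n\<ge>n0. norm (expectation (Y n) - expectation Y0) < e"
    proof (intro exI allI impI)
      fix n assume "n \<ge> n0"
      from n0[OF this] gap[OF Yint dexp, of n] gap[OF Y0int dlim] \<epsilon>(2)
      show "norm (expectation (Y n) - expectation Y0) < e" unfolding real_norm_def by linarith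
    qed
  qed
qed

section \<open>Sums of independent random variables and negligible errors\<close>

lemma (in prob_space) second_moment_indep_sum:
  fixes Y :: "'i \<Rightarrow> 'a \<Rightarrow> real"
  assumes "finite I" "indep_vars (\<lambda>_. borel) Y I"
    "\<And>i. i \<in> I \<Longrightarrow> integrable M (\<lambda>\<omega>. (Y i \<omega>)\<^sup>2)" "\<And>i. i \<in> I \<Longrightarrow> expectation (Y i) = 0"
  shows "integrable M (\<lambda>\<omega>. (\<Sum>i\<in>I. Y i \<omega>)\<^sup>2) \<and>
    expectation (\<lambda>\<omega>. (\<Sum>i\<in>I. Y i \<omega>)\<^sup>2) = (\<Sum>i\<in>I. expectation (\<lambda>\<omega>. (Y i \<omega>)\<^sup>2))"
  using assms
proof (induction I rule: finite_induct)
  case (insert j F)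
  let ?S = "\<lambda>\<omega>. \<Sum>i\<in>F. Y i \<omega>"
  have Ym: "Y i \<in> borel_measurable M" if "i \<in> insert j F" for i
    using insert.prems(1) that unfolding indep_vars_def2 by blast
  have indF: "indep_vars (\<lambda>_. borel) Y F" by (rule indep_vars_subset[OF insert.prems(1)]) auto
  have IH: "integrable M (\<lambda>\<omega>. (?S \<omega>)\<^sup>2)" "expectation (\<lambda>\<omega>. (?S \<omega>)\<^sup>2) = (\<Sum>i\<in>F. expectation (\<lambda>\<omega>. (Y i \<omega>)\<^sup>2))"
    using insert.IH[OF indF] insert.prems by auto
  have Yi: "integrable M (Y i)" if "i \<in> insert j F" for i
    by (rule square_integrable_imp_integrable[OF Ym[OF that] insert.prems(2)[OF that]])
  have Si: "integrable M ?S" using Yi by (intro Bochner_Integration.integrable_sum) auto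
  have "indep_var borel (Y j) borel ?S"
    using insert.hyps insert.prems(1) by (intro indep_vars_sum) auto
  note ind = indep_var_lebesgue_integral[OF this Yi[of j] Si] indep_var_integrable[OF this Yi[of j] Si]
  have split: "(\<Sum>i\<in>insert j F. Y i \<omega>)\<^sup>2 = (Y j \<omega>)\<^sup>2 + 2 * (Y j \<omega> * ?S \<omega>) + (?S \<omega>)\<^sup>2" for \<omega>
    using insert.hyps by (simp add: power2_eq_square algebra_simps)
  have "integrable M (\<lambda>\<omega>. (Y j \<omega>)\<^sup>2 + 2 * (Y j \<omega> * ?S \<omega>) + (?S \<omega>)\<^sup>2)"
    using IH ind insert.prems by auto
  moreover have "expectation (\<lambda>\<omega>. (Y j \<omega>)\<^sup>2 + 2 * (Y j \<omega> * ?S \<omega>) + (?S \<omega>)\<^sup>2)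
      = (\<Sum>i\<in>insert j F. expectation (\<lambda>\<omega>. (Y i \<omega>)\<^sup>2))"
    using IH ind insert by simp
  ultimately show ?case unfolding split by simp
qed auto

lemma (in prob_space) char_diff_tendsto_zero:
  fixes Z Y :: "nat \<Rightarrow> 'a \<Rightarrow> real^'n"
  assumes [measurable]: "\<And>n. Z n \<in> borel_measurable M" "\<And>n. Y n \<in> borel_measurable M"
    and neg: "\<And>e. e > 0 \<Longrightarrow> (\<lambda>n. prob {\<omega> \<in> space M. norm (Z n \<omega> - Y n \<omega>) > e}) \<longlonglongrightarrow> 0"
  shows "(\<lambda>n. (LINT \<omega>|M. iexp (t \<bullet> Z n \<omega>)) - (LINT \<omega>|M. iexp (t \<bullet> Y n \<omega>))) \<longlonglongrightarrow> 0"
proof (rule LIMSEQ_I)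
  fix e :: real assume e: "e > 0"
  define d where "d = e / (2 * (norm t + 1))"
  have nt: "norm t + 1 > 0" by (simp add: add_nonneg_pos)
  have d: "d > 0" "norm t * d < e / 2"
    unfolding d_def using e nt by (auto simp: field_simps)
  from LIMSEQ_D[OF neg[OF d(1)], of "e / 4"] e obtain n0 where
    n0: "\<And>n. n \<ge> n0 \<Longrightarrow> prob {\<omega> \<in> space M. norm (Z n \<omega> - Y n \<omega>) > d} < e / 4" by auto
  show "\<exists>n0. \<forall>n\<ge>n0. norm ((LINT \<omega>|M. iexp (t \<bullet> Z n \<omega>)) - (LINT \<omega>|M. iexp (t \<bullet> Y n \<omega>)) - 0) < e"
  proof (intro exI allI impI)
    fix n assume n: "n \<ge> n0"
    let ?A = "{\<omega> \<in> space M. norm (Z n \<omega> - Y n \<omega>) > d}"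
    have A [measurable]: "?A \<in> events" by measurable
    have indA: "integrable M (indicat_real ?A)"
      by (rule integrable_const_bound[where B=1]) auto
    have bnd: "cmod (iexp (t \<bullet> Z n \<omega>) - iexp (t \<bullet> Y n \<omega>)) \<le> norm t * d + 2 * indicator ?A \<omega>"
      if "\<omega> \<in> space M" for \<omega>
    proof (cases "\<omega> \<in> ?A")
      case True
      have "cmod (iexp (t \<bullet> Z n \<omega>) - iexp (t \<bullet> Y n \<omega>)) \<le> 1 + 1"
        by (intro order_trans[OF norm_triangle_ineq4] add_mono) auto
      then show ?thesis using True d by (simp add: add_increasing)
    next
      case False
      have "iexp (t \<bullet> Z n \<omega>) - iexp (t \<bullet> Y n \<omega>) = iexp (t \<bullet> Y n \<omega>) * (iexp (t \<bullet> (Z n \<omega> - Y n \<omega>)) - 1)"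
        by (simp add: algebra_simps inner_diff_right flip: exp_add)
      then have "cmod (iexp (t \<bullet> Z n \<omega>) - iexp (t \<bullet> Y n \<omega>)) = cmod (iexp (t \<bullet> (Z n \<omega> - Y n \<omega>)) - 1)"
        by (simp add: norm_mult)
      also have "\<dots> \<le> \<bar>t \<bullet> (Z n \<omega> - Y n \<omega>)\<bar>"
        using iexp_approx1[of "t \<bullet> (Z n \<omega> - Y n \<omega>)" 0] by simp
      also have "\<dots> \<le> norm t * norm (Z n \<omega> - Y n \<omega>)" by (rule Cauchy_Schwarz_ineq2)
      also have "\<dots> \<le> norm t * d" using False that by (intro mult_left_mono) auto
      finally show ?thesis by (simp add: add_increasing2)
    qed
    have int: "integrable M (\<lambda>\<omega>. iexp (t \<bullet> V \<omega>))" if [measurable]: "V \<in> borel_measurable M" for V :: "'a \<Rightarrow> real^'n"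
      by (rule integrable_const_bound[where B=1]) auto
    have "norm ((LINT \<omega>|M. iexp (t \<bullet> Z n \<omega>)) - (LINT \<omega>|M. iexp (t \<bullet> Y n \<omega>)))
        = norm (LINT \<omega>|M. iexp (t \<bullet> Z n \<omega>) - iexp (t \<bullet> Y n \<omega>))"
      by (subst Bochner_Integration.integral_diff) (auto intro!: int)
    also have "\<dots> \<le> (LINT \<omega>|M. cmod (iexp (t \<bullet> Z n \<omega>) - iexp (t \<bullet> Y n \<omega>)))"
      by (rule integral_norm_bound)
    also have "\<dots> \<le> (LINT \<omega>|M. norm t * d + 2 * indicator ?A \<omega>)"
      by (intro integral_mono bnd integrable_norm Bochner_Integration.integrable_diff int
          Bochner_Integration.integrable_add integrable_mult_right indA) auto
    also have "\<dots> = norm t * d + 2 * prob ?A"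
      by (subst Bochner_Integration.integral_add) (use indA in \<open>auto simp: prob_space\<close>)
    also have "\<dots> < e" using n0[OF n] d(2) by linarith
    finally show "norm ((LINT \<omega>|M. iexp (t \<bullet> Z n \<omega>)) - (LINT \<omega>|M. iexp (t \<bullet> Y n \<omega>)) - 0) < e" by simp
  qed
qed

text \<open>The linearised estimating equation \<open>S + A D + r = 0\<close> with \<open>A\<close> close to \<open>J\<close> and \<open>r\<close>
  small relative to \<open>D\<close> is solved by \<open>D = - J\<^sup>-\<^sup>1 S\<close> up to a relative error.\<close>

lemma linearised_equation_error:
  fixes J G A :: "real^'n^'n" and S D r :: "real^'n"
    and j g \<eta> \<kappa> \<epsilon> :: real
  assumes j: "j > 0" "\<And>v. j * norm v \<le> norm (J *v v)"
    and G: "\<And>u. norm (G *v u) \<le> g * norm u" "0 \<le> g"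
    and eq: "S + A *v D + r = 0"
    and A: "\<And>k l. \<bar>A $ k $ l - J $ k $ l\<bar> \<le> \<eta>"
    and r: "norm r \<le> \<kappa> * norm D"
    and \<epsilon>: "(CARD('n))\<^sup>2 * \<eta> + \<kappa> \<le> \<epsilon>" "\<epsilon> \<le> j / 2"
  shows "norm ((G ** J) *v D + G *v S) \<le> (2 * g * \<epsilon> / j) * norm S"
proof -
  let ?E = "(A - J) *v D + r"
  have "\<And>k l. \<bar>(A - J) $ k $ l\<bar> \<le> \<eta>" using A by simp
  from norm_matrix_vector_le_of_entries[OF this]
  have "norm ?E \<le> (CARD('n))\<^sup>2 * \<eta> * norm D + \<kappa> * norm D"
    using r by (intro order_trans[OF norm_triangle_ineq] add_mono) auto
  also have "\<dots> = ((CARD('n))\<^sup>2 * \<eta> + \<kappa>) * norm D" by (simp add: algebra_simps)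
  also have "\<dots> \<le> \<epsilon> * norm D" using \<epsilon>(1) by (intro mult_right_mono) auto
  finally have E: "norm ?E \<le> \<epsilon> * norm D" .
  have JD: "J *v D = - S - ?E"
    using eq by (simp add: matrix_vector_mult_diff_rdistrib algebra_simps eq_neg_iff_add_eq_0)
  have "j * norm D \<le> norm (J *v D)" by (rule j)
  also have "\<dots> \<le> norm S + norm ?E" unfolding JD using norm_triangle_ineq4[of "- S" ?E] by simp
  also have "\<dots> \<le> norm S + j / 2 * norm D"
    using E mult_right_mono[OF \<epsilon>(2), of "norm D"] by simp
  finally have D: "norm D \<le> 2 / j * norm S" using j(1) by (simp add: field_simps)
  have "(G ** J) *v D + G *v S = G *v (- ?E)"
    by (simp only: matrix_vector_mul_assoc[symmetric] JD matrix_vector_right_distrib[symmetric]) simp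
  then have "norm ((G ** J) *v D + G *v S) \<le> g * norm ?E"
    using G(1)[of "- ?E"] by (simp only: norm_minus_cancel)
  also have "\<dots> \<le> g * (\<epsilon> * norm D)" using E G(2) by (intro mult_left_mono)
  also have "\<dots> \<le> g * (\<epsilon> * (2 / j * norm S))"
  proof (cases "0 \<le> \<epsilon>")
    case True
    then show ?thesis using D G(2) by (intro mult_left_mono)
  next
    case False
    then have "norm D = 0" using E norm_ge_zero[of ?E] by (smt (verit) mult_neg_pos norm_ge_zero)
    then have "norm ?E = 0" "S = - ?E" using E JD by auto
    then show ?thesis using \<open>norm D = 0\<close> by simp
  qed
  finally show ?thesis by (simp add: mult_ac)
qed

section \<open>Modified scores\<close>

locale smooth_density_family =
  fixes \<mu> :: "'a measure" and \<Theta> :: "(real^'p) set" and f :: "'a \<Rightarrow> real^'p \<Rightarrow> real"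
  assumes family: "density_family \<mu> \<Theta> f"
    and diff_f: "\<And>x \<theta>. x \<in> space \<mu> \<Longrightarrow> \<theta> \<in> interior \<Theta> \<Longrightarrow> f x differentiable (at \<theta>)"
    and diff_U: "\<And>x \<theta> r. x \<in> space \<mu> \<Longrightarrow> \<theta> \<in> interior \<Theta> \<Longrightarrow> 0 < r \<Longrightarrow>
                   twice_differentiable_at (\<lambda>t. mod_score f x t r) \<theta>"
begin

lemma density_pos: "x \<in> space \<mu> \<Longrightarrow> \<theta> \<in> interior \<Theta> \<Longrightarrow> 0 < f x \<theta>"
  using family interior_subset unfolding density_family_def by blast

lemma density_measurable: "\<theta> \<in> interior \<Theta> \<Longrightarrow> (\<lambda>x. f x \<theta>) \<in> borel_measurable \<mu>"
  using family interior_subset unfolding density_family_def by blast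

lemma log_density_has_derivative:
  assumes "x \<in> space \<mu>" "\<theta> \<in> interior \<Theta>"
  shows "((\<lambda>t. ln (f x t)) has_derivative (\<lambda>v. score f x \<theta> \<bullet> v)) (at \<theta>)"
  unfolding score_def
proof (rule has_derivative_grad)
  have "(f x has_derivative frechet_derivative (f x) (at \<theta>)) (at \<theta>)"
    using diff_f[OF assms] frechet_derivative_works by blast
  from has_derivative_ln[OF density_pos[OF assms] this]
  show "(\<lambda>t. ln (f x t)) differentiable (at \<theta>)" by (rule differentiableI)
qed

lemma density_has_derivative:
  assumes "x \<in> space \<mu>" "\<theta> \<in> interior \<Theta>"
  shows "(f x has_derivative (\<lambda>v. f x \<theta> * (score f x \<theta> \<bullet> v))) (at \<theta>)"
proof (rule has_derivative_transform_within_open[OF _ open_interior assms(2)])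
  show "((\<lambda>t. exp (ln (f x t))) has_derivative (\<lambda>v. f x \<theta> * (score f x \<theta> \<bullet> v))) (at \<theta>)"
    using has_derivative_exp[OF log_density_has_derivative[OF assms]] density_pos[OF assms]
    by (simp add: mult.commute)
qed (use density_pos[OF assms(1)] in simp)

text \<open>The modified score is the gradient of the \<open>L\<^sub>q\<close>-likelihood. This gives both the estimating
  equation at a maximiser and the symmetry of the modified information.\<close>

lemma Lq_density_has_derivative:
  assumes "x \<in> space \<mu>" "\<theta> \<in> interior \<Theta>"
  shows "((\<lambda>t. Lq r (f x t)) has_derivative (\<lambda>v. mod_score f x \<theta> r \<bullet> v)) (at \<theta>)"
proof (cases "r = 1")
  case True
  then show ?thesis using log_density_has_derivative[OF assms] density_pos[OF assms]
    by (simp add: Lq_def mod_score_def)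
next
  case False
  have pos: "f x \<theta> > 0" by (rule density_pos[OF assms])
  have "((\<lambda>u. (u powr (1 - r) - 1) / (1 - r)) has_real_derivative f x \<theta> powr (- r)) (at (f x \<theta>))"
    using False by (auto intro!: derivative_eq_intros has_real_derivative_powr[OF pos, THEN DERIV_cong])
  then have "((\<lambda>u. (u powr (1 - r) - 1) / (1 - r)) has_derivative (\<lambda>y. f x \<theta> powr (- r) * y)) (at (f x \<theta>))"
    by (simp add: has_field_derivative_def)
  from has_derivative_compose[OF density_has_derivative[OF assms] this]
  have "((\<lambda>t. Lq r (f x t)) has_derivative (\<lambda>v. f x \<theta> powr (- r) * (f x \<theta> * (score f x \<theta> \<bullet> v)))) (at \<theta>)"
    using False by (simp add: Lq_def)
  moreover have "f x \<theta> powr (- r) * (f x \<theta> * (score f x \<theta> \<bullet> v)) = mod_score f x \<theta> r \<bullet> v" for v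
    using pos by (simp add: mod_score_def powr_diff powr_minus field_simps)
  ultimately show ?thesis by simp
qed

lemma mod_score_has_derivative:
  assumes "x \<in> space \<mu>" "\<theta> \<in> interior \<Theta>" "0 < r"
  shows "((\<lambda>t. mod_score f x t r) has_derivative (\<lambda>v. mod_info f x \<theta> r *v v)) (at \<theta>)"
proof -
  have "(\<lambda>t. mod_score f x t r) differentiable (at \<theta>)"
    using diff_U[OF assms] unfolding twice_differentiable_at_def by (blast dest: eventually_nhds_x_imp_x)
  then show ?thesis unfolding mod_info_def jacobian_works .
qed

lemma mod_info_symmetric:
  assumes "x \<in> space \<mu>" "\<theta> \<in> interior \<Theta>" "0 < r"
  shows "transpose (mod_info f x \<theta> r) = mod_info f x \<theta> r"
  by (rule hessian_symmetric[OF open_interior assms(2) Lq_density_has_derivative[OF assms(1)]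
        mod_score_has_derivative[OF assms]])

lemma mod_info_differentiable:
  assumes "x \<in> space \<mu>" "\<theta> \<in> interior \<Theta>" "0 < r"
  shows "(\<lambda>t. mod_info f x t r) differentiable (at \<theta>)"
  using diff_U[OF assms] unfolding twice_differentiable_at_def mod_info_def by blast

lemma mod_info_entry_differentiable:
  assumes "x \<in> space \<mu>" "\<theta> \<in> interior \<Theta>" "0 < r"
  shows "(\<lambda>t. mod_info f x t r $ k $ l) differentiable (at \<theta>)"
proof -
  obtain D where D: "((\<lambda>t. mod_info f x t r) has_derivative D) (at \<theta>)"
    using mod_info_differentiable[OF assms] unfolding differentiable_def by blast
  have "bounded_linear (\<lambda>A :: real^'p^'p. A $ k $ l)"
    by (intro bounded_linear_compose[OF bounded_linear_vec_nth] bounded_linear_vec_nth)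
  from bounded_linear.has_derivative[OF this D] show ?thesis by (rule differentiableI)
qed

lemma mod_score_taylor:
  fixes h :: real
  assumes x: "x \<in> space \<mu>" and r: "0 < r" and S: "convex S" "S \<subseteq> interior \<Theta>" "a \<in> S" "b \<in> S"
    and bd: "\<And>y k l m. y \<in> S \<Longrightarrow> \<bar>mod_score_d2 f x y r k l m\<bar> \<le> h"
  shows "norm (mod_score f x b r - mod_score f x a r - mod_info f x a r *v (b - a))
     \<le> (CARD('p)) ^ 3 * h * (norm (b - a))\<^sup>2"
proof -
  have "(\<lambda>t. mod_score f x t r) differentiable (at y)" if "y \<in> S" for y
    using mod_score_has_derivative[OF x _ r] S(2) that by (blast intro: differentiableI)
  moreover have "(\<lambda>t. mod_info f x t r $ k $ l) differentiable (at y)" if "y \<in> S" for y k l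
    using mod_info_entry_differentiable[OF x _ r] S(2) that by blast
  ultimately show ?thesis
    using second_order_remainder[of S a b "\<lambda>t. mod_score f x t r" h] S bd
    unfolding mod_info_def mod_score_d2_def by blast
qed

text \<open>The product rule reduces the joint limit in the parameter and the distortion index to
  continuity in the parameter at index \<open>1\<close>.\<close>

lemma mod_info_eq:
  assumes x: "x \<in> space \<mu>" and \<theta>: "\<theta> \<in> interior \<Theta>" and r: "0 < r"
  shows "mod_info f x \<theta> r $ k $ l = f x \<theta> powr (1 - r) *
    (mod_info f x \<theta> 1 $ k $ l + (1 - r) * (score f x \<theta> $ k * score f x \<theta> $ l))"
proof -
  have pos: "f x \<theta> > 0" by (rule density_pos[OF x \<theta>])
  have s1: "mod_score f x t 1 = score f x t" if "t \<in> interior \<Theta>" for t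
    using density_pos[OF x that] by (simp add: mod_score_def)
  have "(score f x has_derivative (\<lambda>v. mod_info f x \<theta> 1 *v v)) (at \<theta>)"
    by (rule has_derivative_transform_within_open[OF mod_score_has_derivative[OF x \<theta>] open_interior \<theta>])
       (auto simp: s1)
  then have sd: "((\<lambda>t. score f x t $ k) has_derivative (\<lambda>v. (mod_info f x \<theta> 1 *v v) $ k)) (at \<theta>)"
    by (rule bounded_linear.has_derivative[OF bounded_linear_vec_nth])
  have pd: "((\<lambda>t. f x t powr (1 - r)) has_derivative
      (\<lambda>v. f x \<theta> powr (1 - r) * ((1 - r) * (score f x \<theta> \<bullet> v)))) (at \<theta>)"
    using has_derivative_powr[OF density_has_derivative[OF x \<theta>] has_derivative_const pos UNIV_I, of "1 - r"] pos
    by (simp add: mult_ac)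
  have 1: "((\<lambda>t. mod_score f x t r $ k) has_derivative
      (\<lambda>v. f x \<theta> powr (1 - r) * (mod_info f x \<theta> 1 *v v) $ k +
         f x \<theta> powr (1 - r) * ((1 - r) * (score f x \<theta> \<bullet> v)) * score f x \<theta> $ k)) (at \<theta>)"
    using has_derivative_mult[OF pd sd] by (simp add: mod_score_def)
  have 2: "((\<lambda>t. mod_score f x t r $ k) has_derivative (\<lambda>v. (mod_info f x \<theta> r *v v) $ k)) (at \<theta>)"
    using mod_score_has_derivative[OF x \<theta> r]
    by (rule bounded_linear.has_derivative[OF bounded_linear_vec_nth])
  have col: "(A *v axis l 1) $ k = A $ k $ l" for A :: "real^'p^'p"
    by (simp add: matrix_vector_mul_component inner_axis)
  show ?thesis
    using fun_cong[OF has_derivative_unique[OF 2 1], of "axis l 1"]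
    by (simp add: col inner_axis algebra_simps)
qed

lemma score_measurable:
  assumes "\<theta> \<in> interior \<Theta>"
  shows "(\<lambda>x. score f x \<theta> $ k) \<in> borel_measurable \<mu>"
  unfolding score_def grad_def vec_lambda_beta
proof (rule borel_measurable_frechet_derivative[OF open_interior assms])
  show "(\<lambda>x. ln (f x t)) \<in> borel_measurable \<mu>" if "t \<in> interior \<Theta>" for t
    using density_measurable[OF that] by simp
qed (use log_density_has_derivative assms in \<open>blast intro: differentiableI\<close>)

lemma mod_score_measurable:
  assumes "\<theta> \<in> interior \<Theta>"
  shows "(\<lambda>x. mod_score f x \<theta> r) \<in> borel_measurable \<mu>"
proof -
  have [measurable]: "(\<lambda>x. f x \<theta>) \<in> borel_measurable \<mu>" by (rule density_measurable[OF assms])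
  have [measurable]: "(\<lambda>x. score f x \<theta> $ k) \<in> borel_measurable \<mu>" for k
    by (rule score_measurable[OF assms])
  have "(\<lambda>x. mod_score f x \<theta> r \<bullet> b) \<in> borel_measurable \<mu>" if "b \<in> Basis" for b
    using that by (auto simp: Basis_vec_def mod_score_def inner_axis)
  then show ?thesis by (subst borel_measurable_euclidean_space) blast
qed

lemma mod_info_measurable:
  assumes "\<theta> \<in> interior \<Theta>" "0 < r"
  shows "(\<lambda>x. mod_info f x \<theta> r) \<in> borel_measurable \<mu>"
proof -
  have entry: "(\<lambda>x. mod_info f x \<theta> r $ k $ l) \<in> borel_measurable \<mu>" for k l
  proof (rule measurable_cong[THEN iffD1])
    fix x assume x: "x \<in> space \<mu>"
    have "((\<lambda>t. mod_score f x t r $ k) has_derivative (\<lambda>v. (mod_info f x \<theta> r *v v) $ k)) (at \<theta>)"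
      using mod_score_has_derivative[OF x assms]
      by (rule bounded_linear.has_derivative[OF bounded_linear_vec_nth])
    from frechet_derivative_at[OF this, symmetric]
    show "frechet_derivative (\<lambda>t. mod_score f x t r $ k) (at \<theta>) (axis l 1) = mod_info f x \<theta> r $ k $ l"
      by (simp add: matrix_vector_mul_component inner_axis)
  next
    show "(\<lambda>x. frechet_derivative (\<lambda>t. mod_score f x t r $ k) (at \<theta>) (axis l 1)) \<in> borel_measurable \<mu>"
    proof (rule borel_measurable_frechet_derivative[OF open_interior assms(1)])
      show "(\<lambda>x. mod_score f x t r $ k) \<in> borel_measurable \<mu>" if "t \<in> interior \<Theta>" for t
        by (rule borel_measurable_vec_component[OF mod_score_measurable[OF that]])
      show "(\<lambda>t. mod_score f x t r $ k) differentiable (at \<theta>)" if "x \<in> space \<mu>" for x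
        by (rule differentiableI[OF bounded_linear.has_derivative[OF bounded_linear_vec_nth
                mod_score_has_derivative[OF that assms]]])
    qed
  qed
  have "(\<lambda>x. mod_info f x \<theta> r \<bullet> b) \<in> borel_measurable \<mu>" if "b \<in> Basis" for b
    using that entry by (auto simp: Basis_vec_def inner_axis)
  then show ?thesis by (subst borel_measurable_euclidean_space) blast
qed

lemma mod_score_tendsto:
  assumes x: "x \<in> space \<mu>" and t: "t \<longlonglongrightarrow> \<theta>" and \<theta>: "\<theta> \<in> interior \<Theta>"
    and r: "r \<longlonglongrightarrow> 1" and mem: "\<And>n. t n \<in> interior \<Theta>"
  shows "(\<lambda>n. mod_score f x (t n) (r n)) \<longlonglongrightarrow> score f x \<theta>"
proof -
  have s1: "mod_score f x t 1 = score f x t" if "t \<in> interior \<Theta>" for t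
    using density_pos[OF x that] by (simp add: mod_score_def)
  have "isCont (f x) \<theta>" by (rule has_derivative_continuous[OF density_has_derivative[OF x \<theta>]])
  then have 1: "(\<lambda>n. f x (t n)) \<longlonglongrightarrow> f x \<theta>" using t by (rule isCont_tendsto_compose)
  have "isCont (\<lambda>t. mod_score f x t 1) \<theta>"
    by (rule has_derivative_continuous[OF mod_score_has_derivative[OF x \<theta>]]) simp
  from isCont_tendsto_compose[OF this t] have 2: "(\<lambda>n. score f x (t n)) \<longlonglongrightarrow> score f x \<theta>"
    by (simp add: s1 mem \<theta>)
  have "(\<lambda>n. f x (t n) powr (1 - r n) *\<^sub>R score f x (t n)) \<longlonglongrightarrow> f x \<theta> powr (1 - 1) *\<^sub>R score f x \<theta>"
    by (intro tendsto_intros 1 2 r) (use density_pos[OF x \<theta>] in simp)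
  then show ?thesis using density_pos[OF x \<theta>] by (simp add: mod_score_def)
qed

lemma mod_info_tendsto:
  assumes x: "x \<in> space \<mu>" and t: "t \<longlonglongrightarrow> \<theta>" and \<theta>: "\<theta> \<in> interior \<Theta>"
    and r: "r \<longlonglongrightarrow> 1" "\<And>n. 0 < r n" and mem: "\<And>n. t n \<in> interior \<Theta>"
  shows "(\<lambda>n. mod_info f x (t n) (r n) $ k $ l) \<longlonglongrightarrow> mod_info f x \<theta> 1 $ k $ l"
proof -
  have "isCont (f x) \<theta>" by (rule has_derivative_continuous[OF density_has_derivative[OF x \<theta>]])
  then have 1: "(\<lambda>n. f x (t n)) \<longlonglongrightarrow> f x \<theta>" using t by (rule isCont_tendsto_compose)
  have 2: "(\<lambda>n. score f x (t n)) \<longlonglongrightarrow> score f x \<theta>"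
  proof -
    have "mod_score f x (t n) 1 = score f x (t n)" for n
      using density_pos[OF x mem[of n]] by (simp add: mod_score_def)
    then show ?thesis using mod_score_tendsto[OF x t \<theta> tendsto_const mem] by simp
  qed
  have "isCont (\<lambda>t. mod_info f x t 1 $ k $ l) \<theta>"
    using mod_info_entry_differentiable[OF x \<theta>, of 1 k l] by (auto intro: differentiable_imp_continuous_within)
  from isCont_tendsto_compose[OF this t]
  have 3: "(\<lambda>n. mod_info f x (t n) 1 $ k $ l) \<longlonglongrightarrow> mod_info f x \<theta> 1 $ k $ l" .
  have "(\<lambda>n. f x (t n) powr (1 - r n) * (mod_info f x (t n) 1 $ k $ l + (1 - r n) * (score f x (t n) $ k * score f x (t n) $ l)))
     \<longlonglongrightarrow> f x \<theta> powr (1 - 1) * (mod_info f x \<theta> 1 $ k $ l + (1 - 1) * (score f x \<theta> $ k * score f x \<theta> $ l))"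
    by (intro tendsto_intros 1 2 3 r) (use density_pos[OF x \<theta>] in simp)
  then show ?thesis
    using density_pos[OF x \<theta>] by (simp add: mod_info_eq[OF x mem r(2)])
qed

text \<open>An interior maximiser is a critical point, which is the estimating equation.\<close>

lemma MLqE_estimating_equation:
  assumes x: "\<And>i. i \<in> {1..n} \<Longrightarrow> x i \<in> space \<mu>" and t: "t \<in> interior \<Theta>" and max: "is_MLqE f \<Theta> r n x t"
  shows "(\<Sum>i=1..n. mod_score f (x i) t r) = 0"
proof -
  let ?L = "\<lambda>\<theta>. \<Sum>i=1..n. Lq r (f (x i) \<theta>)"
  have "(?L has_derivative (\<lambda>v. \<Sum>i=1..n. mod_score f (x i) t r \<bullet> v)) (at t)"
    by (intro has_derivative_sum Lq_density_has_derivative x t)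
  moreover have "\<forall>y\<in>interior \<Theta>. ?L y \<le> ?L t"
  proof
    fix y assume "y \<in> interior \<Theta>"
    then have "y \<in> \<Theta>" using interior_subset by blast
    then show "?L y \<le> ?L t" using max unfolding is_MLqE_def is_arg_max_def by (meson not_le)
  qed
  ultimately have "(\<lambda>v. \<Sum>i=1..n. mod_score f (x i) t r \<bullet> v) = (\<lambda>v. 0)"
    using differential_zero_maxmin[OF t open_interior] by blast
  then have "(\<Sum>i=1..n. mod_score f (x i) t r) \<bullet> v = 0" for v
    by (simp add: inner_sum_left fun_eq_iff)
  then show ?thesis using inner_eq_zero_iff by blast
qed

end

section \<open>Moments of the modified score\<close>

text \<open>These are the majorants \<open>\<bar>Y\<bar> \<le> K + \<epsilon> Z\<close> of the uniform integrability criterion, with the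
  constants written out.\<close>

lemma abs_le_const_plus_square:
  fixes y e :: real
  assumes "e > 0"
  shows "\<bar>y\<bar> \<le> 1 / e + e * y\<^sup>2"
proof (cases "\<bar>y\<bar> \<le> 1 / e")
  case True
  then show ?thesis using assms by (simp add: add_increasing2)
next
  case False
  then have "1 \<le> e * \<bar>y\<bar>" using assms by (simp add: field_simps)
  then have "\<bar>y\<bar> * 1 \<le> \<bar>y\<bar> * (e * \<bar>y\<bar>)" by (intro mult_left_mono) auto
  also have "\<dots> = e * y\<^sup>2" by (simp add: power2_eq_square)
  finally show ?thesis using assms by (simp add: add_increasing)
qed

lemma square_le_const_plus_cube:
  fixes y e :: real
  assumes "e > 0"
  shows "y\<^sup>2 \<le> (1 / e)\<^sup>2 + e * \<bar>y\<bar> ^ 3"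
proof (cases "\<bar>y\<bar> \<le> 1 / e")
  case True
  then have "y\<^sup>2 \<le> (1 / e)\<^sup>2" using assms by (simp add: abs_le_square_iff[symmetric])
  then show ?thesis using assms by (simp add: add_increasing2)
next
  case False
  then have "1 \<le> e * \<bar>y\<bar>" using assms by (simp add: field_simps)
  then have "\<bar>y\<bar>\<^sup>2 * 1 \<le> \<bar>y\<bar>\<^sup>2 * (e * \<bar>y\<bar>)" by (intro mult_left_mono) auto
  also have "\<dots> = e * \<bar>y\<bar> ^ 3" by (simp only: power2_eq_square power3_eq_cube mult_ac)
  finally show ?thesis by (simp add: add_increasing)
qed

lemma abs_le_const_plus_cube:
  fixes y e :: real
  assumes "e > 0"
  shows "\<bar>y\<bar> \<le> 1 + (1 / e)\<^sup>2 + e * \<bar>y\<bar> ^ 3"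
  using square_le_const_plus_cube[OF assms, of y] abs_le_const_plus_square[of 1 y]
    abs_le_square_iff[of 1 y] by (cases "\<bar>y\<bar> \<le> 1") (auto simp: power2_eq_square intro: order_trans[of _ "y * y"])

lemma norm_cubed_le_sum:
  fixes u :: "real^'p"
  shows "norm u ^ 3 \<le> (CARD('p)) ^ 3 * (\<Sum>k\<in>UNIV. \<bar>u $ k\<bar> ^ 3)"
proof -
  have "Max (range (\<lambda>k. \<bar>u $ k\<bar>)) \<in> range (\<lambda>k. \<bar>u $ k\<bar>)" by (intro Max_in) auto
  then obtain m where m: "Max (range (\<lambda>k. \<bar>u $ k\<bar>)) = \<bar>u $ m\<bar>" by (rule imageE)
  have "\<bar>u $ k\<bar> \<le> \<bar>u $ m\<bar>" for k unfolding m[symmetric] by (intro Max_ge) auto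
  then have "norm u \<le> CARD('p) * \<bar>u $ m\<bar>" by (rule norm_le_of_components)
  then have "norm u ^ 3 \<le> (CARD('p) * \<bar>u $ m\<bar>) ^ 3" by (intro power_mono) auto
  also have "\<dots> = (CARD('p)) ^ 3 * \<bar>u $ m\<bar> ^ 3" by (simp add: power_mult_distrib)
  also have "\<dots> \<le> (CARD('p)) ^ 3 * (\<Sum>k\<in>UNIV. \<bar>u $ k\<bar> ^ 3)"
    by (intro mult_left_mono member_le_sum) auto
  finally show ?thesis .
qed

lemma integral_le_of_nn_integral_le:
  fixes g :: "'a \<Rightarrow> real"
  assumes [measurable]: "g \<in> borel_measurable M" and nn: "\<And>x. 0 \<le> g x"
    and le: "(\<integral>\<^sup>+x. ennreal (g x) \<partial>M) \<le> ennreal C"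
  shows "integrable M g" "(LINT x|M. g x) \<le> max 0 C"
proof -
  show int: "integrable M g"
    by (rule integrableI_nonneg) (use nn le in \<open>auto intro: le_less_trans\<close>)
  have "(\<integral>\<^sup>+x. ennreal (g x) \<partial>M) = ennreal (LINT x|M. g x)"
    using int nn by (intro nn_integral_eq_integral) auto
  then show "(LINT x|M. g x) \<le> max 0 C"
    using le by (cases "0 \<le> C") (auto simp: ennreal_neg)
qed

lemma integrable_matrix:
  fixes A :: "'a \<Rightarrow> real^'p^'p"
  assumes int: "\<And>k l. integrable M (\<lambda>x. A x $ k $ l)"
  shows "integrable M A"
proof -
  have "A x = (\<Sum>k\<in>UNIV. \<Sum>l\<in>UNIV. (A x $ k $ l) *\<^sub>R axis k (axis l 1))" for x
    by (simp add: vec_eq_iff axis_def if_distrib[of "\<lambda>v. v $ _"] if_distrib[of "\<lambda>v. _ * v"] sum.If_cases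
        sum_component cong: if_cong)
  moreover have "integrable M (\<lambda>x. \<Sum>k\<in>UNIV. \<Sum>l\<in>UNIV. (A x $ k $ l) *\<^sub>R axis k (axis l (1::real)))"
    by (intro Bochner_Integration.integrable_sum integrable_scaleR_left int)
  ultimately show ?thesis by (metis (no_types, lifting) ext)
qed

lemma integral_matrix_entry:
  fixes A :: "'a \<Rightarrow> real^'p^'p"
  assumes "integrable M A"
  shows "(LINT x|M. A x) $ k $ l = (LINT x|M. A x $ k $ l)"
proof -
  have "bounded_linear (\<lambda>A :: real^'p^'p. A $ k $ l)"
    by (intro bounded_linear_compose[OF bounded_linear_vec_nth] bounded_linear_vec_nth)
  from integral_bounded_linear[OF this assms] show ?thesis by simp
qed

lemma integral_quadratic_form:
  fixes A :: "'a \<Rightarrow> real^'p^'p"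
  assumes "integrable M A"
  shows "integrable M (\<lambda>x. v \<bullet> (A x *v w))" "v \<bullet> ((LINT x|M. A x) *v w) = (LINT x|M. v \<bullet> (A x *v w))"
proof -
  have "linear (\<lambda>A :: real^'p^'p. v \<bullet> (A *v w))"
    by (rule linearI)
       (simp_all add: matrix_vector_mult_add_rdistrib inner_add_right scaleR_matrix_vector_assoc[symmetric])
  then have bl: "bounded_linear (\<lambda>A :: real^'p^'p. v \<bullet> (A *v w))" by (simp add: linear_conv_bounded_linear)
  show "integrable M (\<lambda>x. v \<bullet> (A x *v w))" by (rule integrable_bounded_linear[OF bl assms])
  show "v \<bullet> ((LINT x|M. A x) *v w) = (LINT x|M. v \<bullet> (A x *v w))"
    using integral_bounded_linear[OF bl assms] by simp
qed

locale true_parameter = smooth_density_family \<mu> \<Theta> f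
  for \<mu> :: "'a measure" and \<Theta> :: "(real^'p) set" and f :: "'a \<Rightarrow> real^'p \<Rightarrow> real" +
  fixes \<theta>0 :: "real^'p"
  assumes theta0: "\<theta>0 \<in> interior \<Theta>"
begin

abbreviation P where "P \<equiv> law \<mu> f \<theta>0"

lemma sets_P [simp, measurable_cong]: "sets P = sets \<mu>" by (simp add: law_def)

lemma space_P [simp]: "space P = space \<mu>" by (simp add: law_def)

lemma density_theta0_measurable [measurable]: "(\<lambda>x. f x \<theta>0) \<in> borel_measurable \<mu>"
  by (rule density_measurable[OF theta0])

sublocale P: prob_space P
proof
  have "\<theta>0 \<in> \<Theta>" using theta0 interior_subset by blast
  then show "emeasure P (space P) = 1"
    using family by (simp add: law_def emeasure_density density_family_def)
qed

lemma likelihood_ratio_expectation: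
  assumes "\<theta> \<in> interior \<Theta>"
  shows "integrable P (\<lambda>x. f x \<theta> / f x \<theta>0)" "(LINT x|P. f x \<theta> / f x \<theta>0) = 1"
proof -
  have [measurable]: "(\<lambda>x. f x \<theta>) \<in> borel_measurable \<mu>" by (rule density_measurable[OF assms])
  have mem: "\<theta> \<in> \<Theta>" using assms interior_subset by blast
  have "(\<integral>\<^sup>+x. ennreal (f x \<theta> / f x \<theta>0) \<partial>P) = (\<integral>\<^sup>+x. ennreal (f x \<theta>0) * ennreal (f x \<theta> / f x \<theta>0) \<partial>\<mu>)"
    unfolding law_def by (subst nn_integral_density) auto
  also have "\<dots> = (\<integral>\<^sup>+x. ennreal (f x \<theta>) \<partial>\<mu>)"
    using density_pos[OF _ theta0] density_pos[OF _ assms]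
    by (intro nn_integral_cong) (simp add: ennreal_mult[symmetric] less_imp_le order_less_imp_not_eq2)
  also have "\<dots> = 1" using family mem by (simp add: density_family_def)
  finally have 1: "(\<integral>\<^sup>+x. ennreal (f x \<theta> / f x \<theta>0) \<partial>P) = 1" .
  have nn: "AE x in P. 0 \<le> f x \<theta> / f x \<theta>0"
    using density_pos[OF _ theta0] density_pos[OF _ assms] by (intro AE_I2) (simp add: less_imp_le)
  show int: "integrable P (\<lambda>x. f x \<theta> / f x \<theta>0)"
    by (rule integrableI_nonneg) (use nn 1 in auto)
  have "ennreal (LINT x|P. f x \<theta> / f x \<theta>0) = ennreal 1"
    using nn_integral_eq_integral[OF int nn] 1 by simp
  moreover have "0 \<le> (LINT x|P. f x \<theta> / f x \<theta>0)" using nn by (rule integral_nonneg_AE)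
  ultimately show "(LINT x|P. f x \<theta> / f x \<theta>0) = 1" by (simp only: ennreal_inj zero_le_one)
qed

end

locale mlqe_model = true_parameter \<mu> \<Theta> f \<theta>0
  for \<mu> :: "'a measure" and \<Theta> :: "(real^'p) set" and f :: "'a \<Rightarrow> real^'p \<Rightarrow> real" and \<theta>0 +
  fixes q :: "nat \<Rightarrow> real" and \<theta>s :: "nat \<Rightarrow> real^'p"
  assumes q_pos: "\<And>n. 0 < q n"
    and q_lim: "q \<longlonglongrightarrow> 1"
    and thetas_mem: "\<And>n. \<theta>s n \<in> interior \<Theta>"
    and thetas_eq: "\<And>n. (LINT x|P. mod_score f x (\<theta>s n) (q n)) = 0"
    and thetas_lim: "\<theta>s \<longlonglongrightarrow> \<theta>0"
    and C1: "\<exists>C::real. \<forall>n. (MAX k. \<integral>\<^sup>+x. ennreal (\<bar>mod_score f x (\<theta>s n) (q n) $ k\<bar> ^ 3) \<partial>P) \<le> ennreal C"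
    and C2: "\<exists>c>0. \<forall>n. c \<le> smallest_eigenvalue (K_mat P f (\<theta>s n) (q n))"
    and C3: "\<exists>C::real. \<forall>n k l. (\<integral>\<^sup>+x. ennreal ((mod_info f x (\<theta>s n) (q n) $ k $ l)\<^sup>2) \<partial>P) \<le> ennreal C"
    and C4: "\<exists>A B h. open A \<and> \<theta>0 \<in> A \<and> A \<subseteq> \<Theta> \<and> open B \<and> 1 \<in> B \<and> integrable P h \<and>
               (AE x in P. \<forall>n. q n \<in> B \<longrightarrow> (\<forall>\<theta>\<in>A. \<forall>k l m.
                  \<bar>mod_score_d2 f x \<theta> (q n) k l m\<bar> \<le> (h x :: real)))"
begin

abbreviation U where "U n x \<equiv> mod_score f x (\<theta>s n) (q n)"
abbreviation I where "I n x \<equiv> mod_info f x (\<theta>s n) (q n)"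
abbreviation K where "K n \<equiv> K_mat P f (\<theta>s n) (q n)"
abbreviation J where "J n \<equiv> J_mat P f (\<theta>s n) (q n)"

lemma U_measurable [measurable]: "U n \<in> borel_measurable \<mu>"
  by (rule mod_score_measurable[OF thetas_mem])

lemma U_measurable_P [measurable]: "U n \<in> borel_measurable P"
  by measurable

lemma I_measurable [measurable]: "I n \<in> borel_measurable \<mu>"
  by (rule mod_info_measurable[OF thetas_mem q_pos])

lemma I_entry_measurable [measurable]: "(\<lambda>x. I n x $ k $ l) \<in> borel_measurable \<mu>"
  by measurable

lemma U_limit: "x \<in> space \<mu> \<Longrightarrow> (\<lambda>n. U n x) \<longlonglongrightarrow> score f x \<theta>0"
  by (rule mod_score_tendsto[OF _ thetas_lim theta0 q_lim thetas_mem])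

lemma I_limit: "x \<in> space \<mu> \<Longrightarrow> (\<lambda>n. I n x $ k $ l) \<longlonglongrightarrow> mod_info f x \<theta>0 1 $ k $ l"
  by (rule mod_info_tendsto[OF _ thetas_lim theta0 q_lim q_pos thetas_mem])

lemma U_third_moment:
  obtains C where "\<And>n. integrable P (\<lambda>x. norm (U n x) ^ 3)" "\<And>n. (LINT x|P. norm (U n x) ^ 3) \<le> C"
proof -
  obtain C where C: "\<And>n. (MAX k. \<integral>\<^sup>+x. ennreal (\<bar>U n x $ k\<bar> ^ 3) \<partial>P) \<le> ennreal C"
    using C1 by blast
  have k: "(\<integral>\<^sup>+x. ennreal (\<bar>U n x $ k\<bar> ^ 3) \<partial>P) \<le> ennreal C" for n k
    by (rule order_trans[OF Max_ge C]) auto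
  note b = integral_le_of_nn_integral_le[OF _ _ k]
  have int: "integrable P (\<lambda>x. \<bar>U n x $ k\<bar> ^ 3)" for n k by (rule b(1)) simp_all
  have le: "(LINT x|P. \<bar>U n x $ k\<bar> ^ 3) \<le> max 0 C" for n k by (rule b(2)) simp_all
  have int_sum: "integrable P (\<lambda>x. (CARD('p)) ^ 3 * (\<Sum>k\<in>UNIV. \<bar>U n x $ k\<bar> ^ 3))" for n
    by (intro integrable_mult_right Bochner_Integration.integrable_sum int)
  have int3: "integrable P (\<lambda>x. norm (U n x) ^ 3)" for n
    by (rule Bochner_Integration.integrable_bound[OF int_sum])
       (use norm_cubed_le_sum in \<open>auto simp: sum_nonneg abs_mult\<close>)
  have "(LINT x|P. norm (U n x) ^ 3) \<le> (CARD('p)) ^ 3 * (CARD('p) * max 0 C)" for n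
  proof -
    have "(LINT x|P. norm (U n x) ^ 3) \<le> (LINT x|P. (CARD('p)) ^ 3 * (\<Sum>k\<in>UNIV. \<bar>U n x $ k\<bar> ^ 3))"
      by (intro integral_mono int3 int_sum norm_cubed_le_sum)
    also have "\<dots> = (CARD('p)) ^ 3 * (\<Sum>k\<in>UNIV. LINT x|P. \<bar>U n x $ k\<bar> ^ 3)"
      by (simp add: Bochner_Integration.integral_sum int)
    also have "\<dots> \<le> (CARD('p)) ^ 3 * (\<Sum>k\<in>(UNIV::'p set). max 0 C)"
      by (intro mult_left_mono sum_mono le) auto
    finally show ?thesis by simp
  qed
  then show ?thesis using that int3 by blast
qed

lemma U_inner_cubed_le: "\<bar>a \<bullet> U n x\<bar> ^ 3 \<le> norm a ^ 3 * norm (U n x) ^ 3"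
  using power_mono[OF Cauchy_Schwarz_ineq2[of a "U n x"], of 3] by (simp add: power_mult_distrib)

lemma U_inner_integrable:
  shows "integrable P (\<lambda>x. \<bar>a \<bullet> U n x\<bar> ^ 3)" "integrable P (\<lambda>x. (a \<bullet> U n x)\<^sup>2)"
    "integrable P (\<lambda>x. a \<bullet> U n x)"
proof -
  obtain C where C: "\<And>n. integrable P (\<lambda>x. norm (U n x) ^ 3)" using U_third_moment by blast
  show i3: "integrable P (\<lambda>x. \<bar>a \<bullet> U n x\<bar> ^ 3)"
    by (rule Bochner_Integration.integrable_bound[OF integrable_mult_right[OF C, of "norm a ^ 3"]])
       (use U_inner_cubed_le in auto)
  show "integrable P (\<lambda>x. (a \<bullet> U n x)\<^sup>2)"
    by (rule Bochner_Integration.integrable_bound[where f="\<lambda>x. (1 / 1)\<^sup>2 + 1 * \<bar>a \<bullet> U n x\<bar> ^ 3"])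
       (use i3 square_le_const_plus_cube[of 1 "a \<bullet> U n _"] in auto)
  show "integrable P (\<lambda>x. a \<bullet> U n x)"
    by (rule Bochner_Integration.integrable_bound[where f="\<lambda>x. 1 + (1 / 1)\<^sup>2 + 1 * \<bar>a \<bullet> U n x\<bar> ^ 3"])
       (use i3 abs_le_const_plus_cube[of 1 "a \<bullet> U n _"] in auto)
qed

lemma U_integrable: "integrable P (U n)"
proof -
  have "integrable P (\<lambda>x. norm (U n x))"
  proof (rule Bochner_Integration.integrable_bound[where f="\<lambda>x. \<Sum>k\<in>UNIV. \<bar>axis k 1 \<bullet> U n x\<bar>"])
    show "integrable P (\<lambda>x. \<Sum>k\<in>UNIV. \<bar>axis k 1 \<bullet> U n x\<bar>)"
      by (intro Bochner_Integration.integrable_sum integrable_abs U_inner_integrable)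
    show "AE x in P. norm (norm (U n x)) \<le> norm (\<Sum>k\<in>UNIV. \<bar>axis k 1 \<bullet> U n x\<bar>)"
      using norm_le_l1_cart[of "U n _"] by (auto simp: inner_axis' sum_nonneg)
  qed simp
  then show ?thesis by (rule integrable_norm_cancel) simp
qed

lemma U_inner_mean: "(LINT x|P. a \<bullet> U n x) = 0"
  using U_integrable[of n] thetas_eq[of n] by simp

lemma U_outer_integrable: "integrable P (\<lambda>x. U n x $ k * U n x $ l)"
proof (rule Bochner_Integration.integrable_bound[where f="\<lambda>x. (axis k 1 \<bullet> U n x)\<^sup>2 + (axis l 1 \<bullet> U n x)\<^sup>2"])
  show "integrable P (\<lambda>x. (axis k 1 \<bullet> U n x)\<^sup>2 + (axis l 1 \<bullet> U n x)\<^sup>2)"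
    by (intro Bochner_Integration.integrable_add U_inner_integrable)
  have "\<bar>y * z\<bar> \<le> y\<^sup>2 + z\<^sup>2" for y z :: real
    using sum_squares_bound[of "\<bar>y\<bar>" "\<bar>z\<bar>"] abs_mult[of y z] abs_ge_zero[of "y * z"]
    unfolding power2_abs by linarith
  then show "AE x in P. norm (U n x $ k * U n x $ l) \<le> norm ((axis k 1 \<bullet> U n x)\<^sup>2 + (axis l 1 \<bullet> U n x)\<^sup>2)"
    by (auto simp: inner_axis')
qed simp

lemma K_entry: "K n $ k $ l = (LINT x|P. U n x $ k * U n x $ l)"
  unfolding K_mat_def by (subst integral_matrix_entry) (auto intro!: integrable_matrix U_outer_integrable)

lemma K_symmetric: "transpose (K n) = K n"
  by (simp add: vec_eq_iff transpose_def K_entry mult.commute)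

lemma K_quadratic_form: "a \<bullet> (K n *v a) = (LINT x|P. (a \<bullet> U n x)\<^sup>2)"
proof -
  have "integrable P (\<lambda>x. \<chi> k l. U n x $ k * U n x $ l)"
    by (rule integrable_matrix) (simp add: U_outer_integrable)
  from integral_quadratic_form(2)[OF this, of a a]
  have "a \<bullet> (K n *v a) = (LINT x|P. a \<bullet> ((\<chi> k l. U n x $ k * U n x $ l) *v a))"
    unfolding K_mat_def .
  also have "\<dots> = (LINT x|P. (a \<bullet> U n x)\<^sup>2)"
    by (intro Bochner_Integration.integral_cong refl)
       (simp add: inner_vec_def matrix_vector_mult_def power2_eq_square sum_product sum_distrib_left mult_ac)
  finally show ?thesis .
qed

lemma K_coercive:
  obtains c where "c > 0" "\<And>n v. c * (norm v)\<^sup>2 \<le> v \<bullet> (K n *v v)"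
proof -
  obtain c where c: "c > 0" "\<And>n. c \<le> smallest_eigenvalue (K n)" using C2 by blast
  have "c * (norm v)\<^sup>2 \<le> v \<bullet> (K n *v v)" for n v
    by (rule order_trans[OF mult_right_mono[OF c(2)] smallest_eigenvalue_le_quadratic_form[OF K_symmetric]]) simp
  then show ?thesis using that c(1) by blast
qed

lemma I_second_moment:
  obtains C where "\<And>n k l. integrable P (\<lambda>x. (I n x $ k $ l)\<^sup>2)" "\<And>n k l. (LINT x|P. (I n x $ k $ l)\<^sup>2) \<le> C"
proof -
  obtain C where C: "\<And>n k l. (\<integral>\<^sup>+x. ennreal ((I n x $ k $ l)\<^sup>2) \<partial>P) \<le> ennreal C"
    using C3 by blast
  note b = integral_le_of_nn_integral_le[OF _ _ C]
  have "integrable P (\<lambda>x. (I n x $ k $ l)\<^sup>2)" for n k l by (rule b(1)) simp_all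
  moreover have "(LINT x|P. (I n x $ k $ l)\<^sup>2) \<le> max 0 C" for n k l by (rule b(2)) simp_all
  ultimately show ?thesis using that by blast
qed

lemma I_entry_integrable: "integrable P (\<lambda>x. I n x $ k $ l)"
proof -
  have "integrable P (\<lambda>x. (I n x $ k $ l)\<^sup>2)" by (rule I_second_moment)
  then show ?thesis by (rule P.square_integrable_imp_integrable[rotated]) simp
qed

lemma J_entry: "J n $ k $ l = (LINT x|P. I n x $ k $ l)"
  unfolding J_mat_def by (rule integral_matrix_entry[OF integrable_matrix[OF I_entry_integrable]])

lemma J_symmetric: "transpose (J n) = J n"
proof -
  have "J n $ l $ k = J n $ k $ l" for k l
    unfolding J_entry
  proof (intro Bochner_Integration.integral_cong refl)
    fix x assume "x \<in> space P"
    then have "transpose (I n x) = I n x"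
      using mod_info_symmetric[OF _ thetas_mem q_pos] by simp
    then show "I n x $ l $ k = I n x $ k $ l" unfolding transpose_def vec_eq_iff by simp
  qed
  then show ?thesis unfolding vec_eq_iff transpose_def vec_lambda_beta by blast
qed

section \<open>The limiting score and its information inequality\<close>

lemma score_measurable_P [measurable]: "(\<lambda>x. score f x \<theta>0) \<in> borel_measurable \<mu>"
  using U_limit by (rule borel_measurable_LIMSEQ_metric[OF U_measurable])

lemma score_inner_limits:
  shows "(LINT x|P. a \<bullet> score f x \<theta>0) = 0" "integrable P (\<lambda>x. a \<bullet> score f x \<theta>0)"
    "integrable P (\<lambda>x. (a \<bullet> score f x \<theta>0)\<^sup>2)"
    "(\<lambda>n. LINT x|P. (a \<bullet> U n x)\<^sup>2) \<longlonglongrightarrow> (LINT x|P. (a \<bullet> score f x \<theta>0)\<^sup>2)"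
proof -
  obtain C where C: "\<And>n. integrable P (\<lambda>x. norm (U n x) ^ 3)" "\<And>n. (LINT x|P. norm (U n x) ^ 3) \<le> C"
    using U_third_moment by blast
  have bd: "(LINT x|P. \<bar>a \<bullet> U n x\<bar> ^ 3) \<le> norm a ^ 3 * C" for n
  proof -
    have "(LINT x|P. \<bar>a \<bullet> U n x\<bar> ^ 3) \<le> (LINT x|P. norm a ^ 3 * norm (U n x) ^ 3)"
      by (intro integral_mono U_inner_integrable integrable_mult_right C U_inner_cubed_le)
    also have "\<dots> \<le> norm a ^ 3 * C" using C(2)[of n] by (simp add: mult_left_mono)
    finally show ?thesis .
  qed
  have lim: "AE x in P. (\<lambda>n. a \<bullet> U n x) \<longlonglongrightarrow> a \<bullet> score f x \<theta>0"
    by (intro AE_I2 tendsto_intros U_limit) simp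
  have lim2: "AE x in P. (\<lambda>n. (a \<bullet> U n x)\<^sup>2) \<longlonglongrightarrow> (a \<bullet> score f x \<theta>0)\<^sup>2"
    by (intro AE_I2 tendsto_intros U_limit) simp
  note ui = P.expectation_tendsto_uniformly_integrable[where Z="\<lambda>n x. \<bar>a \<bullet> U n x\<bar> ^ 3", OF _ _ _ U_inner_integrable(1) _ bd]
  have d1: "\<exists>K. \<forall>n x. \<bar>a \<bullet> U n x\<bar> \<le> K + e * \<bar>a \<bullet> U n x\<bar> ^ 3" if "e > 0" for e
    using abs_le_const_plus_cube[OF that] by blast
  have d2: "\<exists>K. \<forall>n x. \<bar>(a \<bullet> U n x)\<^sup>2\<bar> \<le> K + e * \<bar>a \<bullet> U n x\<bar> ^ 3" if "e > 0" for e
    using square_le_const_plus_cube[OF that] unfolding abs_power2 by blast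
  have m: "(\<lambda>x. a \<bullet> U n x) \<in> borel_measurable P" "(\<lambda>x. a \<bullet> score f x \<theta>0) \<in> borel_measurable P"
    "(\<lambda>x. (a \<bullet> U n x)\<^sup>2) \<in> borel_measurable P" "(\<lambda>x. (a \<bullet> score f x \<theta>0)\<^sup>2) \<in> borel_measurable P" for n
    by measurable
  have nn: "0 \<le> \<bar>a \<bullet> U n x\<bar> ^ 3" for n x by simp
  show "integrable P (\<lambda>x. a \<bullet> score f x \<theta>0)" by (rule ui(1)[OF m(1,2) lim nn d1])
  have "(\<lambda>n. LINT x|P. a \<bullet> U n x) \<longlonglongrightarrow> (LINT x|P. a \<bullet> score f x \<theta>0)"
    by (rule ui(2)[OF m(1,2) lim nn d1])
  then show "(LINT x|P. a \<bullet> score f x \<theta>0) = 0"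
    unfolding U_inner_mean by (simp add: LIMSEQ_const_iff)
  show "integrable P (\<lambda>x. (a \<bullet> score f x \<theta>0)\<^sup>2)" by (rule ui(1)[OF m(3,4) lim2 nn d2])
  show "(\<lambda>n. LINT x|P. (a \<bullet> U n x)\<^sup>2) \<longlonglongrightarrow> (LINT x|P. (a \<bullet> score f x \<theta>0)\<^sup>2)"
    by (rule ui(2)[OF m(3,4) lim2 nn d2])
qed

lemma J_limit:
  shows "integrable P (\<lambda>x. mod_info f x \<theta>0 1)" "(\<lambda>n. J n $ k $ l) \<longlonglongrightarrow> J_mat P f \<theta>0 1 $ k $ l"
proof -
  obtain C where C: "\<And>n k l. integrable P (\<lambda>x. (I n x $ k $ l)\<^sup>2)" "\<And>n k l. (LINT x|P. (I n x $ k $ l)\<^sup>2) \<le> C"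
    using I_second_moment by blast
  have m: "(\<lambda>x. mod_info f x \<theta>0 1 $ k $ l) \<in> borel_measurable P" for k l
    using mod_info_measurable[OF theta0, of 1]
    by (intro borel_measurable_vec_component) simp
  have lim: "AE x in P. (\<lambda>n. I n x $ k $ l) \<longlonglongrightarrow> mod_info f x \<theta>0 1 $ k $ l" for k l
    by (intro AE_I2 I_limit) simp
  have d: "\<exists>K. \<forall>n x. \<bar>I n x $ k $ l\<bar> \<le> K + e * (I n x $ k $ l)\<^sup>2" if "e > 0" for e k l
    using abs_le_const_plus_square[OF that] by blast
  have Im: "(\<lambda>x. I n x $ k $ l) \<in> borel_measurable P" for n k l by measurable
  note ui = P.expectation_tendsto_uniformly_integrable[OF Im m lim C(1) zero_le_power2 C(2) d]
  note 1 = ui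
  show int: "integrable P (\<lambda>x. mod_info f x \<theta>0 1)" by (rule integrable_matrix[OF 1(1)])
  show "(\<lambda>n. J n $ k $ l) \<longlonglongrightarrow> J_mat P f \<theta>0 1 $ k $ l"
    using 1(2)[of k l] unfolding J_entry unfolding J_mat_def by (simp add: integral_matrix_entry[OF int])
qed

definition taylor_dominated :: "real \<Rightarrow> nat \<Rightarrow> 'a \<Rightarrow> real \<Rightarrow> bool" where
  "taylor_dominated \<rho> N x c \<longleftrightarrow> (\<forall>n\<ge>N. \<forall>a\<in>ball \<theta>0 \<rho>. \<forall>b\<in>ball \<theta>0 \<rho>.
     norm (mod_score f x b (q n) - mod_score f x a (q n) - mod_info f x a (q n) *v (b - a)) \<le> c * (norm (b - a))\<^sup>2)"

text \<open>The base point \<open>a\<close> ranges over a ball as well, because the expansion is used at the moving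
  point \<open>\<theta>s n\<close> for the estimator and at \<open>\<theta>0\<close> for the information inequality.\<close>

lemma taylor_domination:
  obtains \<rho> h N where "\<rho> > 0" "ball \<theta>0 \<rho> \<subseteq> interior \<Theta>" "integrable P h" "h \<in> borel_measurable \<mu>" "\<And>x. 0 \<le> h x"
    "AE x in P. taylor_dominated \<rho> N x (h x)"
proof -
  obtain A B h where A: "open A" "\<theta>0 \<in> A" "A \<subseteq> \<Theta>" and B: "open B" "1 \<in> B" and h: "integrable P h"
    and dom: "AE x in P. \<forall>n. q n \<in> B \<longrightarrow> (\<forall>\<theta>\<in>A. \<forall>k l m. \<bar>mod_score_d2 f x \<theta> (q n) k l m\<bar> \<le> h x)"
    using C4 by blast
  obtain \<rho> where \<rho>: "\<rho> > 0" "ball \<theta>0 \<rho> \<subseteq> A" using A openE by blast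
  have sub: "ball \<theta>0 \<rho> \<subseteq> interior \<Theta>"
    using \<rho>(2) A by (meson interior_maximal order_trans)
  have "\<forall>\<^sub>F n in sequentially. q n \<in> B" using q_lim B by (rule topological_tendstoD)
  then obtain N where N: "\<And>n. n \<ge> N \<Longrightarrow> q n \<in> B" by (auto simp: eventually_sequentially)
  define h' where "h' x = (CARD('p)) ^ 3 * \<bar>h x\<bar>" for x
  have h'i: "integrable P h'" unfolding h'_def[abs_def] using h by (intro integrable_mult_right integrable_abs)
  have "h' \<in> borel_measurable P" using h'i by (rule borel_measurable_integrable)
  then have h'm: "h' \<in> borel_measurable \<mu>" by simp
  have "AE x in P. taylor_dominated \<rho> N x (h' x)"
    using dom AE_space
  proof eventually_elim
    case (elim x)
    have "\<bar>mod_score_d2 f x y (q n) k l m\<bar> \<le> \<bar>h x\<bar>" if "n \<ge> N" "y \<in> ball \<theta>0 \<rho>" for n y k l m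
    proof -
      have "\<bar>mod_score_d2 f x y (q n) k l m\<bar> \<le> h x" using elim(1) N[OF that(1)] that(2) \<rho>(2) by blast
      then show ?thesis by simp
    qed
    then show ?case
      using mod_score_taylor[OF _ q_pos convex_ball sub] elim(2)
      unfolding h'_def taylor_dominated_def by auto
  qed
  then show ?thesis using that[of \<rho> h' N] \<rho>(1) sub h'i h'm by (auto simp: h'_def)
qed

text \<open>The domination is available along the indices \<open>q n\<close>, none of which need equal \<open>1\<close>. Letting
  \<open>n\<close> tend to infinity at fixed \<open>b\<close> transfers it to the ordinary score, and integrating along the
  segment from \<open>\<theta>0\<close> to \<open>\<theta>0 + v\<close> gives the expansion of the log-likelihood.\<close>

lemma log_likelihood_expansion:
  assumes x: "x \<in> space \<mu>" and sub: "ball \<theta>0 \<rho> \<subseteq> interior \<Theta>" and v: "norm v < \<rho>"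
    and dom: "taylor_dominated \<rho> N x h"
  shows "\<bar>ln (f x (\<theta>0 + v)) - ln (f x \<theta>0) - score f x \<theta>0 \<bullet> v - (v \<bullet> (mod_info f x \<theta>0 1 *v v)) / 2\<bar> \<le> h * norm v ^ 3"
proof -
  let ?A = "mod_info f x \<theta>0 1" and ?u = "score f x"
  have "0 < \<rho>" using v norm_ge_zero[of v] by linarith
  then have dom: "norm (mod_score f x b (q n) - mod_score f x \<theta>0 (q n) - mod_info f x \<theta>0 (q n) *v (b - \<theta>0))
      \<le> h * (norm (b - \<theta>0))\<^sup>2" if "n \<ge> N" "b \<in> ball \<theta>0 \<rho>" for n b
    using dom that unfolding taylor_dominated_def by simp
  have h: "0 \<le> h \<or> v = 0"
  proof (cases "v = 0")
    case False
    have "\<theta>0 + v \<in> ball \<theta>0 \<rho>" using v by (simp add: dist_norm)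
    from order_trans[OF norm_ge_zero dom[OF order_refl this]] have "0 \<le> h * (norm v)\<^sup>2" by simp
    then show ?thesis using False by (simp add: zero_le_mult_iff)
  qed simp
  have lim: "norm (?u b - ?u \<theta>0 - ?A *v (b - \<theta>0)) \<le> h * (norm (b - \<theta>0))\<^sup>2" if b: "b \<in> ball \<theta>0 \<rho>" for b
  proof (rule LIMSEQ_le_const2)
    have bi: "b \<in> interior \<Theta>" using b sub by blast
    have "(\<lambda>n. mod_info f x \<theta>0 (q n) *v (b - \<theta>0)) \<longlonglongrightarrow> ?A *v (b - \<theta>0)"
      unfolding matrix_vector_mult_def
      by (rule vec_tendstoI, unfold vec_lambda_beta)
         (intro tendsto_intros mod_info_tendsto[OF x tendsto_const theta0 q_lim q_pos theta0])
    then show "(\<lambda>n. norm (mod_score f x b (q n) - mod_score f x \<theta>0 (q n) - mod_info f x \<theta>0 (q n) *v (b - \<theta>0)))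
        \<longlonglongrightarrow> norm (?u b - ?u \<theta>0 - ?A *v (b - \<theta>0))"
      by (intro tendsto_intros mod_score_tendsto[OF x tendsto_const _ q_lim] theta0 bi)
    show "\<exists>N. \<forall>n\<ge>N. norm (mod_score f x b (q n) - mod_score f x \<theta>0 (q n) - mod_info f x \<theta>0 (q n) *v (b - \<theta>0))
        \<le> h * (norm (b - \<theta>0))\<^sup>2" using dom b by blast
  qed
  let ?g = "\<lambda>s. ln (f x (\<theta>0 + s *\<^sub>R v)) - s * (?u \<theta>0 \<bullet> v) - s\<^sup>2 * (v \<bullet> (?A *v v)) / 2"
  have inb: "\<theta>0 + s *\<^sub>R v \<in> ball \<theta>0 \<rho>" if "0 \<le> s" "s \<le> 1" for s
  proof -
    have "norm (s *\<^sub>R v) \<le> norm v" using that by (simp add: mult_left_le_one_le)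
    then show ?thesis using v by (simp add: dist_norm)
  qed
  have "(?g has_derivative (\<lambda>t. ?u (\<theta>0 + s *\<^sub>R v) \<bullet> (t *\<^sub>R v) - t * (?u \<theta>0 \<bullet> v) - (2 * s * t) * (v \<bullet> (?A *v v)) / 2)) (at s within {0..1})"
    if s: "0 \<le> s" "s \<le> 1" for s
  proof (intro has_derivative_diff)
    have "((\<lambda>s. \<theta>0 + s *\<^sub>R v) has_derivative (\<lambda>t. t *\<^sub>R v)) (at s within {0..1})"
      by (auto intro!: derivative_eq_intros)
    moreover have "\<theta>0 + s *\<^sub>R v \<in> interior \<Theta>" using inb[OF s] sub by blast
    ultimately show "((\<lambda>s. ln (f x (\<theta>0 + s *\<^sub>R v))) has_derivative (\<lambda>t. ?u (\<theta>0 + s *\<^sub>R v) \<bullet> (t *\<^sub>R v))) (at s within {0..1})"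
      by (rule has_derivative_compose[OF _ log_density_has_derivative[OF x]])
    show "((\<lambda>s. s * (?u \<theta>0 \<bullet> v)) has_derivative (\<lambda>t. t * (?u \<theta>0 \<bullet> v))) (at s within {0..1})"
      by (auto intro!: derivative_eq_intros)
    show "((\<lambda>s. s\<^sup>2 * (v \<bullet> (?A *v v)) / 2) has_derivative (\<lambda>t. (2 * s * t) * (v \<bullet> (?A *v v)) / 2)) (at s within {0..1})"
      by (auto intro!: derivative_eq_intros)
  qed
  from mvt_simple[OF zero_less_one this] obtain s where s: "0 < s" "s < 1"
    and eq: "?g 1 - ?g 0 = ?u (\<theta>0 + s *\<^sub>R v) \<bullet> v - ?u \<theta>0 \<bullet> v - s * (v \<bullet> (?A *v v))" by auto
  have "?g 1 - ?g 0 = (?u (\<theta>0 + s *\<^sub>R v) - ?u \<theta>0 - ?A *v (s *\<^sub>R v)) \<bullet> v"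
    unfolding eq by (simp add: inner_diff_left inner_diff_right matrix_vector_mult_scaleR inner_commute)
  also have "\<bar>\<dots>\<bar> \<le> norm (?u (\<theta>0 + s *\<^sub>R v) - ?u \<theta>0 - ?A *v (s *\<^sub>R v)) * norm v"
    by (rule Cauchy_Schwarz_ineq2)
  also have "\<dots> \<le> (h * (norm (s *\<^sub>R v))\<^sup>2) * norm v"
    using lim[OF inb, of s] s by (intro mult_right_mono) auto
  also have "\<dots> \<le> (h * (norm v)\<^sup>2) * norm v"
  proof (cases "v = 0")
    case False
    then have "0 \<le> h" using h by simp
    moreover have "norm (s *\<^sub>R v) \<le> norm v" using s by (simp add: mult_left_le_one_le)
    ultimately show ?thesis by (intro mult_right_mono mult_left_mono power_mono) auto
  qed simp
  also have "\<dots> = h * norm v ^ 3" by (simp add: power2_eq_square power3_eq_cube)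
  finally show ?thesis by (simp add: diff_diff_eq2 algebra_simps)
qed

text \<open>Densities integrate to one, so \<open>E exp L = 1\<close> for the log-likelihood ratio
  \<open>L\<close> between \<open>\<theta>0 + \<delta> v\<close> and \<open>\<theta>0\<close>. Hence \<open>E (exp L - 1 - L) = - E L\<close>, and
  after division by \<open>\<delta>\<^sup>2\<close> the right side tends to \<open>- v \<bullet> J v / 2\<close> by the expansion of
  \<open>L\<close>, while Fatou's lemma bounds the left side below by \<open>E (v \<bullet> U)\<^sup>2 / 2\<close>. No
  differentiation under the integral sign is involved.\<close>

lemma information_inequality:
  "(LINT x|P. (v \<bullet> score f x \<theta>0)\<^sup>2) \<le> - (v \<bullet> (J_mat P f \<theta>0 1 *v v))"
proof -
  obtain \<rho> h N where \<rho>: "\<rho> > 0" "ball \<theta>0 \<rho> \<subseteq> interior \<Theta>" and h: "integrable P h" "h \<in> borel_measurable \<mu>" "\<And>x. 0 \<le> h x"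
    and dom: "AE x in P. taylor_dominated \<rho> N x (h x)"
    using taylor_domination by blast
  \<comment> \<open>the factor keeps \<open>\<theta>0 + \<delta> m v\<close> in the ball for every \<open>m\<close>\<close>
  define \<delta> where "\<delta> m = (\<rho> / (norm v + 1)) * (1 / real (Suc m))" for m
  have nv: "norm v + 1 > 0" by (simp add: add_nonneg_pos)
  have \<delta>0: "\<delta> m > 0" for m using \<rho>(1) nv by (simp add: \<delta>_def)
  have \<delta>v: "norm (\<delta> m *\<^sub>R v) < \<rho>" for m
  proof -
    have "\<delta> m \<le> \<rho> / (norm v + 1)"
      unfolding \<delta>_def using \<rho>(1) nv by (intro mult_left_le) (auto simp: field_simps)
    then have "\<delta> m * norm v \<le> \<rho> / (norm v + 1) * norm v" by (rule mult_right_mono) simp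
    also have "\<dots> < \<rho>" using \<rho>(1) nv by (simp add: field_simps)
    finally show ?thesis using \<delta>0[of m] by simp
  qed
  have \<delta>lim: "\<delta> \<longlonglongrightarrow> 0"
  proof -
    have "(\<lambda>m. (\<rho> / (norm v + 1)) * (1 / real (Suc m))) \<longlonglongrightarrow> (\<rho> / (norm v + 1)) * 0"
      by (intro tendsto_mult_left LIMSEQ_Suc[OF lim_const_over_n])
    then show ?thesis by (simp add: \<delta>_def[abs_def])
  qed
  have mem: "\<theta>0 + \<delta> m *\<^sub>R v \<in> interior \<Theta>" for m
    using \<delta>v[of m] \<rho>(2) by (auto simp: dist_norm subset_iff)
  define L where "L m x = ln (f x (\<theta>0 + \<delta> m *\<^sub>R v)) - ln (f x \<theta>0)" for m x
  have Lm [measurable]: "L m \<in> borel_measurable \<mu>" for m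
    unfolding L_def[abs_def] using density_measurable[OF mem[of m]] by measurable
  have Lexp: "exp (L m x) = f x (\<theta>0 + \<delta> m *\<^sub>R v) / f x \<theta>0" if "x \<in> space \<mu>" for m x
    using density_pos[OF that mem[of m]] density_pos[OF that theta0] by (simp add: L_def exp_diff)
  have eint: "integrable P (\<lambda>x. exp (L m x))" for m
    using likelihood_ratio_expectation(1)[OF mem[of m]]
    by (rule Bochner_Integration.integrable_cong[THEN iffD1, OF refl, rotated]) (simp add: Lexp)
  have e1: "(LINT x|P. exp (L m x)) = 1" for m
    unfolding likelihood_ratio_expectation(2)[OF mem[of m], symmetric]
    by (rule Bochner_Integration.integral_cong) (simp_all add: Lexp)
  let ?A = "\<lambda>x. mod_info f x \<theta>0 1" and ?J = "J_mat P f \<theta>0 1"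
  have exp2: "AE x in P. \<forall>m. \<bar>L m x - \<delta> m * (v \<bullet> score f x \<theta>0) - (\<delta> m)\<^sup>2 * (v \<bullet> (?A x *v v)) / 2\<bar>
      \<le> h x * (\<delta> m ^ 3 * norm v ^ 3)"
    using dom AE_space
  proof eventually_elim
    case (elim x)
    show ?case
    proof
      fix m
      have "x \<in> space \<mu>" using elim(2) by simp
      from log_likelihood_expansion[OF this \<rho>(2) \<delta>v[of m] elim(1)]
      show "\<bar>L m x - \<delta> m * (v \<bullet> score f x \<theta>0) - (\<delta> m)\<^sup>2 * (v \<bullet> (?A x *v v)) / 2\<bar> \<le> h x * (\<delta> m ^ 3 * norm v ^ 3)"
        using \<delta>0[of m]
        by (simp add: L_def inner_commute matrix_vector_mult_scaleR power_mult_distrib power2_eq_square mult.assoc)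
    qed
  qed
  have sint: "integrable P (\<lambda>x. v \<bullet> score f x \<theta>0)" and s0: "(LINT x|P. v \<bullet> score f x \<theta>0) = 0"
    by (rule score_inner_limits)+
  have Aint: "integrable P (\<lambda>x. v \<bullet> (?A x *v v))" and Aval: "(LINT x|P. v \<bullet> (?A x *v v)) = v \<bullet> (?J *v v)"
    using integral_quadratic_form[OF J_limit(1), of v v] by (auto simp: J_mat_def)
  have Qint: "integrable P (\<lambda>x. \<delta> m * (v \<bullet> score f x \<theta>0) + (\<delta> m)\<^sup>2 * (v \<bullet> (?A x *v v)) / 2)" for m
    using sint Aint by auto
  have hint: "integrable P (\<lambda>x. h x * (\<delta> m ^ 3 * norm v ^ 3))" for m using h(1) by auto
  have Rint: "integrable P (\<lambda>x. L m x - (\<delta> m * (v \<bullet> score f x \<theta>0) + (\<delta> m)\<^sup>2 * (v \<bullet> (?A x *v v)) / 2))" for m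
    by (rule Bochner_Integration.integrable_bound[OF hint[of m]])
       (use exp2 Qint[of m] in \<open>auto simp: diff_diff_eq elim!: eventually_mono intro: order_trans[OF _ abs_ge_self]\<close>)
  have Lint: "integrable P (L m)" for m
    using Bochner_Integration.integrable_add[OF Rint[of m] Qint[of m]] by simp
  have Lexpect: "- (LINT x|P. L m x) \<le> - (\<delta> m)\<^sup>2 * (v \<bullet> (?J *v v)) / 2 + (LINT x|P. h x) * (\<delta> m ^ 3 * norm v ^ 3)" for m
  proof -
    have "(LINT x|P. \<delta> m * (v \<bullet> score f x \<theta>0) + (\<delta> m)\<^sup>2 * (v \<bullet> (?A x *v v)) / 2 - L m x) \<le> (LINT x|P. h x * (\<delta> m ^ 3 * norm v ^ 3))"
      by (intro integral_mono_AE Bochner_Integration.integrable_diff Qint Lint hint)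
         (use exp2 in \<open>auto elim!: eventually_mono simp: abs_le_iff algebra_simps\<close>)
    moreover have "(LINT x|P. \<delta> m * (v \<bullet> score f x \<theta>0) + (\<delta> m)\<^sup>2 * (v \<bullet> (?A x *v v)) / 2 - L m x)
        = (\<delta> m)\<^sup>2 * (v \<bullet> (?J *v v)) / 2 - (LINT x|P. L m x)"
      using sint Aint s0 Aval Lint Qint by simp
    ultimately show ?thesis by simp
  qed
  define W where "W m x = (exp (L m x) - 1 - L m x) / (\<delta> m)\<^sup>2" for m x
  have Wint: "integrable P (W m)" for m
    unfolding W_def[abs_def] using eint Lint by auto
  have Wbd: "(LINT x|P. W m x) \<le> - (v \<bullet> (?J *v v)) / 2 + (LINT x|P. h x) * norm v ^ 3 * \<delta> m" for m
  proof -
    have "(LINT x|P. W m x) = - (LINT x|P. L m x) / (\<delta> m)\<^sup>2"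
      unfolding W_def using eint[of m] e1[of m] Lint[of m] P.prob_space by simp
    also have "\<dots> \<le> (- (\<delta> m)\<^sup>2 * (v \<bullet> (?J *v v)) / 2 + (LINT x|P. h x) * (\<delta> m ^ 3 * norm v ^ 3)) / (\<delta> m)\<^sup>2"
      by (intro divide_right_mono Lexpect) simp
    also have "\<dots> = - (v \<bullet> (?J *v v)) / 2 + (LINT x|P. h x) * norm v ^ 3 * \<delta> m"
      using \<delta>0[of m] by (simp add: field_simps power2_eq_square power3_eq_cube)
    finally show ?thesis .
  qed
  have Wnn: "0 \<le> W m x" for m x
  proof -
    have "0 \<le> exp (L m x) - 1 - L m x" using exp_ge_add_one_self[of "L m x"] by linarith
    then show ?thesis unfolding W_def by (rule divide_nonneg_nonneg) simp
  qed
  have Wlim: "(\<lambda>m. W m x) \<longlonglongrightarrow> (1 / 2) * (v \<bullet> score f x \<theta>0)\<^sup>2" if x: "x \<in> space \<mu>" for x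
  proof -
    have "((\<lambda>s. \<theta>0 + s *\<^sub>R v) has_derivative (\<lambda>s. s *\<^sub>R v)) (at 0)" by (auto intro!: derivative_eq_intros)
    from has_derivative_compose[OF this, of "\<lambda>t. ln (f x t)" "\<lambda>v. score f x \<theta>0 \<bullet> v"] log_density_has_derivative[OF x theta0]
    have "((\<lambda>s. ln (f x (\<theta>0 + s *\<^sub>R v))) has_real_derivative score f x \<theta>0 \<bullet> v) (at 0)"
      by (simp add: has_field_derivative_def mult_commute_abs)
    then have "((\<lambda>s. (ln (f x (\<theta>0 + s *\<^sub>R v)) - ln (f x \<theta>0)) / s) \<longlongrightarrow> score f x \<theta>0 \<bullet> v) (at 0)"
      by (simp add: DERIV_def)
    moreover have "filterlim \<delta> (at 0) sequentially"
      unfolding filterlim_at using \<delta>lim \<delta>0 by (auto intro!: always_eventually simp: order_less_imp_not_eq2)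
    ultimately have Ld: "(\<lambda>m. L m x / \<delta> m) \<longlonglongrightarrow> score f x \<theta>0 \<bullet> v"
      unfolding L_def by (rule filterlim_compose)
    have "(\<lambda>m. L m x / \<delta> m * \<delta> m) \<longlonglongrightarrow> (score f x \<theta>0 \<bullet> v) * 0"
      by (intro tendsto_mult Ld \<delta>lim)
    then have L0: "(\<lambda>m. L m x) \<longlonglongrightarrow> 0" using \<delta>0 by (simp add: order_less_imp_not_eq2)
    \<comment> \<open>continuous at \<open>0\<close>, which covers the indices with \<open>L m x = 0\<close>\<close>
    define \<phi> where "\<phi> y = (if y = 0 then 1 / 2 else (exp y - 1 - y) / y\<^sup>2)" for y :: real
    have "((\<lambda>y::real. (exp y - 1 - y) / y\<^sup>2) \<longlongrightarrow> 1 / 2) (at 0)" by real_asymp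
    then have "(\<phi> \<longlongrightarrow> 1 / 2) (at 0)"
      by (rule Lim_transform_eventually) (auto simp: \<phi>_def eventually_at_filter)
    then have "isCont \<phi> 0" by (simp add: isCont_def \<phi>_def)
    from isCont_tendsto_compose[OF this L0] have "(\<lambda>m. \<phi> (L m x)) \<longlonglongrightarrow> 1 / 2" by (simp add: \<phi>_def)
    then have "(\<lambda>m. \<phi> (L m x) * (L m x / \<delta> m)\<^sup>2) \<longlonglongrightarrow> (1 / 2) * (score f x \<theta>0 \<bullet> v)\<^sup>2"
      by (intro tendsto_mult tendsto_power Ld)
    moreover have "\<phi> (L m x) * (L m x / \<delta> m)\<^sup>2 = W m x" for m
      by (simp add: W_def \<phi>_def power_divide)
    ultimately show ?thesis by (simp add: inner_commute)
  qed
  have "(LINT x|P. (1 / 2) * (v \<bullet> score f x \<theta>0)\<^sup>2) \<le> - (v \<bullet> (?J *v v)) / 2"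
  proof (rule fatou_expectation_bound(2)[where W=W])
    show "integrable P (W m)" for m by (rule Wint)
    show "(LINT x|P. W m x) \<le> - (v \<bullet> (?J *v v)) / 2 + (LINT x|P. h x) * norm v ^ 3 * \<delta> m" for m by (rule Wbd)
    have "(\<lambda>m. - (v \<bullet> (?J *v v)) / 2 + (LINT x|P. h x) * norm v ^ 3 * \<delta> m)
        \<longlonglongrightarrow> - (v \<bullet> (?J *v v)) / 2 + (LINT x|P. h x) * norm v ^ 3 * 0"
      by (intro tendsto_add tendsto_const tendsto_mult_left \<delta>lim)
    then show "(\<lambda>m. - (v \<bullet> (?J *v v)) / 2 + (LINT x|P. h x) * norm v ^ 3 * \<delta> m) \<longlonglongrightarrow> - (v \<bullet> (?J *v v)) / 2" by simp
    show "AE x in P. (\<lambda>m. W m x) \<longlonglongrightarrow> (1 / 2) * (v \<bullet> score f x \<theta>0)\<^sup>2"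
      by (intro AE_I2 Wlim) simp
  qed (use Wnn in auto)
  then show ?thesis by simp
qed

text \<open>The lower bound on \<open>K n\<close> survives in the limit, passes to \<open>- J\<close> at \<open>\<theta>0\<close> by the information
  inequality, and half of it is left for \<open>J n\<close> once its entries are close to their limits.\<close>

lemma J_eventually_coercive:
  obtains j where "j > 0" "\<forall>\<^sub>F n in sequentially. \<forall>v. j * norm v \<le> norm (J n *v v)"
proof -
  obtain c where c: "c > 0" "\<And>n v. c * (norm v)\<^sup>2 \<le> v \<bullet> (K n *v v)" using K_coercive by blast
  let ?J = "J_mat P f \<theta>0 1"
  have low: "c * (norm v)\<^sup>2 \<le> - (v \<bullet> (?J *v v))" for v
  proof -
    have "c * (norm v)\<^sup>2 \<le> (LINT x|P. (v \<bullet> score f x \<theta>0)\<^sup>2)"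
      using c(2)[of v] unfolding K_quadratic_form by (intro LIMSEQ_le_const[OF score_inner_limits(4)]) auto
    then show ?thesis using information_inequality[of v] by linarith
  qed
  define \<eta> where "\<eta> = c / (2 * (CARD('p))\<^sup>2)"
  have \<eta>: "\<eta> > 0" "(CARD('p))\<^sup>2 * \<eta> = c / 2" using c(1) by (auto simp: \<eta>_def)
  have "\<forall>\<^sub>F n in sequentially. \<bar>J n $ k $ l - ?J $ k $ l\<bar> \<le> \<eta>" for k l
    using tendstoD[OF J_limit(2)[of k l] \<eta>(1)] by eventually_elim (simp add: dist_real_def)
  then have "\<forall>\<^sub>F n in sequentially. \<forall>k l. \<bar>J n $ k $ l - ?J $ k $ l\<bar> \<le> \<eta>"
    by (intro eventually_all_finite) auto
  then have "\<forall>\<^sub>F n in sequentially. \<forall>v. c / 2 * norm v \<le> norm (J n *v v)"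
  proof eventually_elim
    case (elim n)
    show ?case
    proof
      fix v :: "real^'p"
      have e: "\<And>k l. \<bar>(J n - ?J) $ k $ l\<bar> \<le> \<eta>" using elim by simp
      have "norm ((J n - ?J) *v v) \<le> c / 2 * norm v"
        using norm_matrix_vector_le_of_entries[OF e, of v] by (simp only: \<eta>(2))
      then have "norm v * norm ((J n - ?J) *v v) \<le> norm v * (c / 2 * norm v)" by (rule mult_left_mono) simp
      then have "v \<bullet> ((J n - ?J) *v v) \<le> c / 2 * (norm v)\<^sup>2"
        using norm_cauchy_schwarz[of v "(J n - ?J) *v v"] by (simp add: power2_eq_square mult_ac)
      then have "c / 2 * (norm v)\<^sup>2 \<le> - (v \<bullet> (J n *v v))"
        using low[of v] by (simp add: matrix_vector_mult_diff_rdistrib inner_diff_right)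
      also have "\<dots> \<le> norm v * norm (J n *v v)"
        using Cauchy_Schwarz_ineq2[of v "J n *v v"] by (simp add: abs_le_iff)
      finally have "norm v * (c / 2 * norm v) \<le> norm v * norm (J n *v v)" by (simp add: power2_eq_square mult_ac)
      then show "c / 2 * norm v \<le> norm (J n *v v)" by (cases "v = 0") auto
    qed
  qed
  then show ?thesis using that[of "c / 2"] c(1) by simp
qed

end

section \<open>The estimator\<close>

locale mlqe_sample = mlqe_model \<mu> \<Theta> f \<theta>0 q \<theta>s + M: prob_space M
  for \<mu> :: "'a measure" and \<Theta> :: "(real^'p) set" and f :: "'a \<Rightarrow> real^'p \<Rightarrow> real" and \<theta>0
    and q :: "nat \<Rightarrow> real" and \<theta>s :: "nat \<Rightarrow> real^'p" and M :: "'w measure" +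
  fixes X :: "nat \<Rightarrow> 'w \<Rightarrow> 'a" and T :: "nat \<Rightarrow> 'w \<Rightarrow> real^'p"
  assumes indep: "M.indep_vars (\<lambda>_. \<mu>) X {1..}"
    and distr: "\<And>i. i \<ge> 1 \<Longrightarrow> distributed M \<mu> (X i) (\<lambda>x. ennreal (f x \<theta>0))"
    and T_meas: "\<And>n. T n \<in> borel_measurable M"
    and T_MLqE: "\<And>n. AE \<omega> in M. is_MLqE f \<Theta> (q n) n (\<lambda>i. X i \<omega>) (T n \<omega>)"
    and T_consistent: "conv_in_prob M T \<theta>0"
begin

lemma X_measurable: "i \<ge> 1 \<Longrightarrow> X i \<in> measurable M \<mu>"
  using indep unfolding M.indep_vars_def2 by simp

lemma X_distr: "i \<ge> 1 \<Longrightarrow> distr M \<mu> (X i) = P"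
  using distributed_distr_eq_density[OF distr] by (simp add: law_def)

lemma X_expectation:
  fixes g :: "'a \<Rightarrow> real"
  assumes "g \<in> borel_measurable \<mu>" "i \<ge> 1"
  shows "M.expectation (\<lambda>\<omega>. g (X i \<omega>)) = (LINT x|P. g x)"
    "integrable M (\<lambda>\<omega>. g (X i \<omega>)) \<longleftrightarrow> integrable P g"
  unfolding X_distr[OF assms(2), symmetric]
  using assms X_measurable by (simp_all add: integral_distr integrable_distr_eq)

lemma X_AE:
  assumes "i \<ge> 1" "AE x in P. Q x"
  shows "AE \<omega> in M. Q (X i \<omega>)"
  using AE_distrD[OF X_measurable[OF assms(1)]] assms(2) unfolding X_distr[OF assms(1)] by blast

lemma indep_transformed:
  assumes "g \<in> borel_measurable \<mu>"
  shows "M.indep_vars (\<lambda>_. borel) (\<lambda>i \<omega>. g (X i \<omega>) :: real) {1..n}"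
  using M.indep_vars_compose2[OF M.indep_vars_subset[OF indep, of "{1..n}"], of "\<lambda>_. g"] assms by auto

lemma chebyshev_iid_sum:
  fixes g :: "'a \<Rightarrow> real"
  assumes g [measurable]: "g \<in> borel_measurable \<mu>" and g2: "integrable P (\<lambda>x. (g x)\<^sup>2)"
    and mean: "(LINT x|P. g x) = 0" and a: "a > 0"
  shows "M.prob {\<omega> \<in> space M. a < \<bar>\<Sum>i=1..n. g (X i \<omega>)\<bar>} \<le> n * (LINT x|P. (g x)\<^sup>2) / a\<^sup>2"
proof -
  have g2m: "(\<lambda>x. (g x)\<^sup>2) \<in> borel_measurable \<mu>" by measurable
  have Xm [measurable]: "(\<lambda>\<omega>. g (X i \<omega>)) \<in> borel_measurable M" if "i \<in> {1..n}" for i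
    using measurable_compose[OF X_measurable g] that by simp
  have Sm [measurable]: "(\<lambda>\<omega>. \<Sum>i=1..n. g (X i \<omega>)) \<in> borel_measurable M"
    by (rule borel_measurable_sum) (rule Xm)
  have i2: "integrable M (\<lambda>\<omega>. (g (X i \<omega>))\<^sup>2)" and e0: "M.expectation (\<lambda>\<omega>. g (X i \<omega>)) = 0" if "i \<in> {1..n}" for i
    using X_expectation(2)[OF g2m, of i] X_expectation(1)[OF g, of i] that g2 mean by auto
  have e2: "M.expectation (\<lambda>\<omega>. (g (X i \<omega>))\<^sup>2) = (LINT x|P. (g x)\<^sup>2)" if "i \<in> {1..n}" for i
    using X_expectation(1)[OF g2m, of i] that by simp
  have S: "integrable M (\<lambda>\<omega>. (\<Sum>i=1..n. g (X i \<omega>))\<^sup>2) \<and>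
    M.expectation (\<lambda>\<omega>. (\<Sum>i=1..n. g (X i \<omega>))\<^sup>2) = (\<Sum>i=1..n. M.expectation (\<lambda>\<omega>. (g (X i \<omega>))\<^sup>2))"
    by (rule M.second_moment_indep_sum[OF finite_atLeastAtMost indep_transformed[OF g] i2 e0])
  have "M.prob {\<omega> \<in> space M. a < \<bar>\<Sum>i=1..n. g (X i \<omega>)\<bar>} \<le> M.prob {\<omega> \<in> space M. a \<le> \<bar>\<Sum>i=1..n. g (X i \<omega>)\<bar>}"
    by (intro M.finite_measure_mono) auto
  also have "\<dots> \<le> M.expectation (\<lambda>\<omega>. (\<Sum>i=1..n. g (X i \<omega>))\<^sup>2) / a\<^sup>2"
    by (rule M.second_moment_method[OF Sm _ a]) (use S in simp)
  also have "\<dots> = n * (LINT x|P. (g x)\<^sup>2) / a\<^sup>2"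
    unfolding S[THEN conjunct2] by (simp add: e2)
  finally show ?thesis .
qed

definition S where "S n \<omega> = (1 / sqrt n) *\<^sub>R (\<Sum>i=1..n. U n (X i \<omega>))"
definition A where "A n \<omega> = (1 / n) *\<^sub>R (\<Sum>i=1..n. I n (X i \<omega>))"

lemma S_measurable [measurable]: "S n \<in> borel_measurable M"
proof -
  have "(\<lambda>\<omega>. U n (X i \<omega>)) \<in> borel_measurable M" if "i \<in> {1..n}" for i
    using measurable_compose[OF X_measurable U_measurable] that by simp
  then have [measurable]: "(\<lambda>\<omega>. \<Sum>i=1..n. U n (X i \<omega>)) \<in> borel_measurable M"
    by (rule borel_measurable_sum)
  show ?thesis unfolding S_def[abs_def] by measurable
qed

lemma S_component_tail:
  obtains C where "\<And>n k L. L > 0 \<Longrightarrow> M.prob {\<omega> \<in> space M. L < \<bar>S n \<omega> $ k\<bar>} \<le> C / L\<^sup>2" "C > 0"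
proof -
  obtain C where C: "\<And>n. integrable P (\<lambda>x. norm (U n x) ^ 3)" "\<And>n. (LINT x|P. norm (U n x) ^ 3) \<le> C"
    by (rule U_third_moment) (rule that; assumption)
  have "0 \<le> (LINT x|P. norm (U 0 x) ^ 3)" by simp
  then have C0: "0 \<le> C" using C(2)[of 0] by linarith
  have sq: "(LINT x|P. (axis k 1 \<bullet> U n x)\<^sup>2) \<le> 1 + C" for n k
  proof -
    have "(LINT x|P. (axis k 1 \<bullet> U n x)\<^sup>2) \<le> (LINT x|P. 1 + norm (U n x) ^ 3)"
    proof (intro integral_mono U_inner_integrable)
      show "integrable P (\<lambda>x. 1 + norm (U n x) ^ 3)" using C(1) by simp
      show "(axis k 1 \<bullet> U n x)\<^sup>2 \<le> 1 + norm (U n x) ^ 3" for x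
        using square_le_const_plus_cube[of 1 "axis k 1 \<bullet> U n x"] U_inner_cubed_le[of "axis k 1" x n]
        unfolding norm_axis_1 div_by_1 power_one mult_1_left by linarith
    qed
    also have "\<dots> = 1 + (LINT x|P. norm (U n x) ^ 3)" using C(1)[of n] P.prob_space by simp
    finally show ?thesis using C(2)[of n] by linarith
  qed
  have "M.prob {\<omega> \<in> space M. L < \<bar>S n \<omega> $ k\<bar>} \<le> (1 + C) / L\<^sup>2" if L: "L > 0" for n k L
  proof (cases "n = 0")
    case True
    then have "{\<omega> \<in> space M. L < \<bar>S n \<omega> $ k\<bar>} = {}" using L by (auto simp: S_def)
    then have "M.prob {\<omega> \<in> space M. L < \<bar>S n \<omega> $ k\<bar>} = 0" by (simp only: measure_empty)
    then show ?thesis using C0 by simp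
  next
    case False
    have "S n \<omega> $ k = (\<Sum>i=1..n. axis k 1 \<bullet> U n (X i \<omega>)) / sqrt n" for \<omega>
      by (simp add: S_def inner_axis' sum_component)
    then have "{\<omega> \<in> space M. L < \<bar>S n \<omega> $ k\<bar>} = {\<omega> \<in> space M. L * sqrt n < \<bar>\<Sum>i=1..n. axis k 1 \<bullet> U n (X i \<omega>)\<bar>}"
      using False by (simp add: pos_less_divide_eq)
    also have "M.prob \<dots> \<le> n * (LINT x|P. (axis k 1 \<bullet> U n x)\<^sup>2) / (L * sqrt n)\<^sup>2"
      using L False by (intro chebyshev_iid_sum U_inner_integrable U_inner_mean) auto
    also have "\<dots> = (LINT x|P. (axis k 1 \<bullet> U n x)\<^sup>2) / L\<^sup>2"
      using False by (simp add: power_mult_distrib)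
    also have "\<dots> \<le> (1 + C) / L\<^sup>2" by (intro divide_right_mono sq) simp
    finally show ?thesis .
  qed
  then show ?thesis using that[of "1 + C"] C0 by simp
qed

lemma A_entry_convergence:
  assumes \<eta>: "\<eta> > 0"
  shows "(\<lambda>n. M.prob {\<omega> \<in> space M. \<eta> < \<bar>A n \<omega> $ k $ l - J n $ k $ l\<bar>}) \<longlonglongrightarrow> 0"
proof -
  obtain C where C: "\<And>n k l. integrable P (\<lambda>x. (I n x $ k $ l)\<^sup>2)" "\<And>n k l. (LINT x|P. (I n x $ k $ l)\<^sup>2) \<le> C"
    by (rule I_second_moment) (rule that; assumption)
  have bd: "M.prob {\<omega> \<in> space M. \<eta> < \<bar>A n \<omega> $ k $ l - J n $ k $ l\<bar>} \<le> C / \<eta>\<^sup>2 * (1 / n)" if n: "n \<ge> 1" for n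
  proof -
    let ?g = "\<lambda>x. I n x $ k $ l - J n $ k $ l"
    have gi: "integrable P (\<lambda>x. (?g x)\<^sup>2)"
      using C(1)[of n k l] I_entry_integrable[of n k l] by (simp add: power2_diff)
    have var: "(LINT x|P. (?g x)\<^sup>2) \<le> C"
    proof -
      have "(LINT x|P. (?g x)\<^sup>2) = (LINT x|P. (I n x $ k $ l)\<^sup>2) - (LINT x|P. I n x $ k $ l)\<^sup>2"
        unfolding J_entry using P.variance_eq[OF I_entry_integrable C(1)] .
      then show ?thesis using C(2)[of n k l] zero_le_power2[of "LINT x|P. I n x $ k $ l"] by linarith
    qed
    have "A n \<omega> $ k $ l - J n $ k $ l = (\<Sum>i=1..n. ?g (X i \<omega>)) / n" for \<omega>
      using n by (simp add: A_def sum_component sum_subtractf field_simps)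
    then have "{\<omega> \<in> space M. \<eta> < \<bar>A n \<omega> $ k $ l - J n $ k $ l\<bar>} = {\<omega> \<in> space M. \<eta> * n < \<bar>\<Sum>i=1..n. ?g (X i \<omega>)\<bar>}"
      using n by (simp add: pos_less_divide_eq)
    also have "M.prob \<dots> \<le> n * (LINT x|P. (?g x)\<^sup>2) / (\<eta> * n)\<^sup>2"
      using \<eta> n gi I_entry_integrable[of n k l] P.prob_space
      by (intro chebyshev_iid_sum) (auto simp: J_entry)
    also have "\<dots> = (LINT x|P. (?g x)\<^sup>2) / \<eta>\<^sup>2 * (1 / n)"
      using n by (simp add: power_mult_distrib power2_eq_square)
    also have "\<dots> \<le> C / \<eta>\<^sup>2 * (1 / n)" by (intro mult_right_mono divide_right_mono var) auto
    finally show ?thesis .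
  qed
  have lim: "(\<lambda>n. C / \<eta>\<^sup>2 * (1 / real n)) \<longlonglongrightarrow> 0"
    using tendsto_mult_left[OF lim_const_over_n[of 1], of "C / \<eta>\<^sup>2"] by simp
  show ?thesis
  proof (rule tendsto_sandwich[OF _ _ tendsto_const lim])
    show "\<forall>\<^sub>F n in sequentially. M.prob {\<omega> \<in> space M. \<eta> < \<bar>A n \<omega> $ k $ l - J n $ k $ l\<bar>} \<le> C / \<eta>\<^sup>2 * (1 / real n)"
      using eventually_ge_at_top[of 1] by eventually_elim (rule bd)
    show "\<forall>\<^sub>F n in sequentially. 0 \<le> M.prob {\<omega> \<in> space M. \<eta> < \<bar>A n \<omega> $ k $ l - J n $ k $ l\<bar>}"
      by (intro always_eventually allI measure_nonneg)
  qed
qed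

lemma average_tail:
  fixes h :: "'a \<Rightarrow> real"
  assumes h: "h \<in> borel_measurable \<mu>" "integrable P h" "\<And>x. 0 \<le> h x" and L: "L > 0"
  shows "M.prob {\<omega> \<in> space M. L < (\<Sum>i=1..n. h (X i \<omega>)) / n} \<le> (LINT x|P. h x) / L"
proof (cases "n = 0")
  case True
  then have "{\<omega> \<in> space M. L < (\<Sum>i=1..n. h (X i \<omega>)) / n} = {}" using L by auto
  then have "M.prob {\<omega> \<in> space M. L < (\<Sum>i=1..n. h (X i \<omega>)) / n} = 0" by (simp only: measure_empty)
  then show ?thesis using h L by simp
next
  case False
  have int: "integrable M (\<lambda>\<omega>. h (X i \<omega>))" if "i \<in> {1..n}" for i
    using X_expectation(2)[OF h(1), of i] that h(2) by simp
  have int_avg: "integrable M (\<lambda>\<omega>. (\<Sum>i=1..n. h (X i \<omega>)) / n)"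
    by (intro integrable_divide Bochner_Integration.integrable_sum int)
  then have [measurable]: "(\<lambda>\<omega>. (\<Sum>i=1..n. h (X i \<omega>)) / n) \<in> borel_measurable M" by (rule borel_measurable_integrable)
  have "M.prob {\<omega> \<in> space M. L < (\<Sum>i=1..n. h (X i \<omega>)) / n} \<le> M.prob {\<omega> \<in> space M. L \<le> (\<Sum>i=1..n. h (X i \<omega>)) / n}"
  proof (rule M.finite_measure_mono)
    show "{\<omega> \<in> space M. L \<le> (\<Sum>i=1..n. h (X i \<omega>)) / n} \<in> M.events" by measurable
  qed auto
  also have "\<dots> \<le> M.expectation (\<lambda>\<omega>. (\<Sum>i=1..n. h (X i \<omega>)) / n) / L"
    by (rule integral_Markov_inequality_measure[OF int_avg, of "{}"]) (use h(3) L in \<open>auto intro!: sum_nonneg divide_nonneg_nonneg\<close>)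
  also have "M.expectation (\<lambda>\<omega>. (\<Sum>i=1..n. h (X i \<omega>)) / n) = (\<Sum>i=1..n. M.expectation (\<lambda>\<omega>. h (X i \<omega>))) / n"
    using int by (simp add: Bochner_Integration.integral_sum)
  also have "(\<Sum>i=1..n. M.expectation (\<lambda>\<omega>. h (X i \<omega>))) = (\<Sum>i=1..n. LINT x|P. h x)"
    by (intro sum.cong refl X_expectation(1)[OF h(1)]) simp
  also have "(\<Sum>i=1..n. LINT x|P. h x) / n = (LINT x|P. h x)" using False by simp
  finally show ?thesis .
qed

text \<open>The remainder is quadratic in \<open>T n \<omega> - \<theta>s n\<close>; one factor is kept as a small number, the other
  is scaled by \<open>\<surd>n\<close> into the unknown of the linear equation.\<close>

lemma estimating_equation_remainder:
  assumes n: "n \<ge> 1" and x: "\<And>i. i \<in> {1..n} \<Longrightarrow> X i \<omega> \<in> space \<mu>"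
    and max: "is_MLqE f \<Theta> (q n) n (\<lambda>i. X i \<omega>) (T n \<omega>)" and int: "T n \<omega> \<in> interior \<Theta>"
    and dom: "\<And>i. i \<in> {1..n} \<Longrightarrow> norm (mod_score f (X i \<omega>) (T n \<omega>) (q n) - U n (X i \<omega>) - I n (X i \<omega>) *v (T n \<omega> - \<theta>s n))
        \<le> h (X i \<omega>) * (norm (T n \<omega> - \<theta>s n))\<^sup>2"
  shows "norm (- S n \<omega> - A n \<omega> *v (sqrt n *\<^sub>R (T n \<omega> - \<theta>s n)))
      \<le> ((\<Sum>i=1..n. h (X i \<omega>)) / n * norm (T n \<omega> - \<theta>s n)) * norm (sqrt n *\<^sub>R (T n \<omega> - \<theta>s n))"
proof -
  let ?\<Delta> = "T n \<omega> - \<theta>s n"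
  have zero: "(\<Sum>i=1..n. mod_score f (X i \<omega>) (T n \<omega>) (q n)) = 0"
    by (rule MLqE_estimating_equation[OF x int max])
  have Av: "(\<Sum>i\<in>F. B i) *v v = (\<Sum>i\<in>F. B i *v v)" if "finite F"
    for F :: "nat set" and B :: "nat \<Rightarrow> real^'p^'p" and v
    using that by (induction F rule: finite_induct) (simp_all add: matrix_vector_mult_add_rdistrib)
  have sq: "sqrt n * sqrt n = n" "sqrt n > 0" using n by auto
  have "- S n \<omega> - A n \<omega> *v (sqrt n *\<^sub>R ?\<Delta>)
     = (1 / sqrt n) *\<^sub>R (\<Sum>i=1..n. mod_score f (X i \<omega>) (T n \<omega>) (q n) - U n (X i \<omega>) - I n (X i \<omega>) *v ?\<Delta>)"
  proof -
    have "A n \<omega> *v (sqrt n *\<^sub>R ?\<Delta>) = (1 / n * sqrt n) *\<^sub>R (\<Sum>i=1..n. I n (X i \<omega>) *v ?\<Delta>)"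
      by (simp add: A_def scaleR_matrix_vector_assoc[symmetric] matrix_vector_mult_scaleR Av)
    also have "1 / n * sqrt n = 1 / sqrt n" using sq by (simp add: field_simps)
    finally show ?thesis
      using zero by (simp add: S_def sum_subtractf scaleR_diff_right)
  qed
  also have "norm \<dots> \<le> (1 / sqrt n) * (\<Sum>i=1..n. h (X i \<omega>) * (norm ?\<Delta>)\<^sup>2)"
  proof -
    have "\<bar>1 / sqrt n\<bar> = 1 / sqrt n" by simp
    then show ?thesis
      unfolding norm_scaleR by (simp only:) (intro mult_left_mono sum_norm_le dom; simp)
  qed
  also have "\<dots> = ((\<Sum>i=1..n. h (X i \<omega>)) / n * norm ?\<Delta>) * norm (sqrt n *\<^sub>R ?\<Delta>)"
  proof -
    have "(1 / sqrt n) * (\<Sum>i=1..n. h (X i \<omega>) * (norm ?\<Delta>)\<^sup>2) = (sqrt n / n) * ((\<Sum>i=1..n. h (X i \<omega>)) * (norm ?\<Delta>)\<^sup>2)"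
      using sq by (simp add: sum_distrib_right[symmetric] field_simps)
    then show ?thesis by (simp add: power2_eq_square)
  qed
  finally show ?thesis .
qed

abbreviation V where "V n \<equiv> V_mat P f (\<theta>s n) (q n)"
definition G where "G n = inv_sqrt (V n) ** matrix_inv (J n)"
definition Z where "Z n \<omega> = sqrt n *\<^sub>R (inv_sqrt (V n) *v (T n \<omega> - \<theta>s n))"

lemma matrix_vector_measurable [measurable (raw)]:
  fixes B :: "real^'p^'p"
  assumes "g \<in> borel_measurable N"
  shows "(\<lambda>\<omega>. B *v g \<omega>) \<in> borel_measurable N"
proof -
  have "continuous_on UNIV ((*v) B)" by (intro linear_continuous_on matrix_vector_mul_bounded_linear)
  from borel_measurable_continuous_on[OF this assms] show ?thesis .
qed

lemma Z_measurable [measurable]: "Z n \<in> borel_measurable M"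
proof -
  have [measurable]: "T n \<in> borel_measurable M" by (rule T_meas)
  show ?thesis unfolding Z_def[abs_def] by measurable
qed

definition whitening where
  "whitening j c n \<longleftrightarrow> (\<forall>v. j * norm v \<le> norm (J n *v v)) \<and>
      G n ** J n = inv_sqrt (V n) \<and> (\<forall>u. norm (G n *v u) \<le> 1 / sqrt c * norm u) \<and>
      (\<forall>t. (transpose (G n) *v t) \<bullet> (K n *v (transpose (G n) *v t)) = t \<bullet> t) \<and>
      (\<forall>t. norm (transpose (G n) *v t) \<le> norm t / sqrt c)"

text \<open>\<open>J n\<close> is known to be invertible only for large \<open>n\<close>, hence the filter. The constants are
  uniform in \<open>n\<close>.\<close>

lemma whitening_eventually:
  obtains j c where "j > 0" "c > 0" "\<forall>\<^sub>F n in sequentially. whitening j c n"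
proof -
  obtain j where j: "j > 0" "\<forall>\<^sub>F n in sequentially. \<forall>v. j * norm v \<le> norm (J n *v v)"
    using J_eventually_coercive by blast
  obtain c where c: "c > 0" "\<And>n v. c * (norm v)\<^sup>2 \<le> v \<bullet> (K n *v v)" using K_coercive by blast
  have "\<forall>\<^sub>F n in sequentially. whitening j c n"
    using j(2)
  proof eventually_elim
    case (elim n)
    have "invertible (J n)"
    proof (rule invertible_of_trivial_kernel)
      fix v assume "J n *v v = 0"
      then have "j * norm v \<le> 0" using elim by (metis norm_zero)
      then show "v = 0" using j(1) by (simp add: mult_le_0_iff)
    qed
    note w = sandwich_whitening[OF this J_symmetric K_symmetric c]
    show ?case using elim w unfolding whitening_def G_def V_mat_def by simp
  qed
  then show ?thesis using that j(1) c(1) by blast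
qed

text \<open>Outside four kinds of exceptional events the deterministic bound
  \<open>linearised_equation_error\<close> applies: the estimator is far from \<open>\<theta>0\<close> (consistency), an entry of
  \<open>A n\<close> is far from \<open>J n\<close> (Chebyshev), a component of \<open>S n\<close> is large (second moments), or the
  average of the dominating function is large (Markov). The last two levels are chosen first, to
  make those probabilities small for all \<open>n\<close>, and the closeness required in the first two depends
  on them.\<close>

lemma remainder_negligible:
  assumes e: "e > 0"
  shows "(\<lambda>n. M.prob {\<omega> \<in> space M. norm (Z n \<omega> - (- (G n *v S n \<omega>))) > e}) \<longlonglongrightarrow> 0"
proof (rule LIMSEQ_I)
  fix \<epsilon> :: real assume \<epsilon>: "\<epsilon> > 0"
  let ?p = "real CARD('p)"
  have p: "?p \<ge> 1" by (simp add: Suc_leI)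
  obtain j c where j: "j > 0" and c: "c > 0" and wh: "\<forall>\<^sub>F n in sequentially. whitening j c n"
    by (rule whitening_eventually) (rule that; assumption)
  define g where "g = 1 / sqrt c"
  have g: "g > 0" using c by (simp add: g_def)
  obtain \<rho> h N where \<rho>: "\<rho> > 0" "ball \<theta>0 \<rho> \<subseteq> interior \<Theta>" and h: "integrable P h" "h \<in> borel_measurable \<mu>" "\<And>x. 0 \<le> h x"
    and dom: "AE x in P. taylor_dominated \<rho> N x (h x)"
    by (rule taylor_domination) (rule that; assumption)
  obtain C where C: "\<And>n k L. L > 0 \<Longrightarrow> M.prob {\<omega> \<in> space M. L < \<bar>S n \<omega> $ k\<bar>} \<le> C / L\<^sup>2" "C > 0"
    by (rule S_component_tail) (rule that; assumption)
  \<comment> \<open>truncation levels for the score sum and for the average of the dominating function\<close>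
  define L where "L = sqrt (8 * ?p * C / \<epsilon>)"
  have L: "L > 0" "?p * (C / L\<^sup>2) < \<epsilon> / 4"
    using \<epsilon> C(2) p by (auto simp: L_def field_simps)
  define L' where "L' = 8 * ((LINT x|P. h x) + 1) / \<epsilon>"
  have hpos: "0 \<le> (LINT x|P. h x)" using h(3) by simp
  have L': "L' > 0" "(LINT x|P. h x) / L' < \<epsilon> / 4"
  proof -
    show "L' > 0" unfolding L'_def using \<epsilon> hpos by (intro divide_pos_pos) auto
    have "\<epsilon> / 4 * L' = 2 * ((LINT x|P. h x) + 1)" using \<epsilon> by (simp add: L'_def)
    then show "(LINT x|P. h x) / L' < \<epsilon> / 4"
      using \<open>L' > 0\<close> hpos by (simp add: pos_divide_less_eq)
  qed
  \<comment> \<open>admissible relative error of the linearisation\<close>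
  define \<epsilon>1 where "\<epsilon>1 = min (j / 2) (e * j / (2 * g * (?p * L)))"
  have \<epsilon>1: "\<epsilon>1 > 0" "\<epsilon>1 \<le> j / 2" "(2 * g * \<epsilon>1 / j) * (?p * L) \<le> e"
  proof -
    show "\<epsilon>1 > 0" unfolding \<epsilon>1_def using e j g L(1) p by auto
    show "\<epsilon>1 \<le> j / 2" by (simp add: \<epsilon>1_def)
    have "(2 * g * \<epsilon>1 / j) * (?p * L) \<le> (2 * g * (e * j / (2 * g * (?p * L))) / j) * (?p * L)"
      using j g L(1) p by (intro mult_right_mono divide_right_mono mult_left_mono) (auto simp: \<epsilon>1_def)
    also have "\<dots> = e" using j g L(1) p by (simp add: field_simps)
    finally show "(2 * g * \<epsilon>1 / j) * (?p * L) \<le> e" .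
  qed
  define \<eta> where "\<eta> = \<epsilon>1 / (2 * ?p\<^sup>2)"
  have \<eta>: "\<eta> > 0" "?p\<^sup>2 * \<eta> = \<epsilon>1 / 2" using \<epsilon>1(1) p by (auto simp: \<eta>_def)
  define d where "d = min (\<rho> / 2) (\<epsilon>1 / (4 * L'))"
  have d: "d > 0" "d < \<rho>" "L' * (2 * d) \<le> \<epsilon>1 / 2"
  proof -
    show "d > 0" "d < \<rho>" using \<rho>(1) \<epsilon>1(1) L'(1) by (auto simp: d_def min_def)
    have "L' * (2 * d) \<le> L' * (2 * (\<epsilon>1 / (4 * L')))" using L'(1) by (intro mult_left_mono) (auto simp: d_def)
    also have "\<dots> = \<epsilon>1 / 2" using L'(1) by (simp add: field_simps)
    finally show "L' * (2 * d) \<le> \<epsilon>1 / 2" .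
  qed
  define BT where "BT n = {\<omega> \<in> space M. dist (T n \<omega>) \<theta>0 > d}" for n
  define BS where "BS n k = {\<omega> \<in> space M. L < \<bar>S n \<omega> $ k\<bar>}" for n k
  define BA where "BA n k l = {\<omega> \<in> space M. \<eta> < \<bar>A n \<omega> $ k $ l - J n $ k $ l\<bar>}" for n k l
  define BH where "BH n = {\<omega> \<in> space M. L' < (\<Sum>i=1..n. h (X i \<omega>)) / n}" for n
  have [measurable]: "T n \<in> borel_measurable M" for n by (rule T_meas)
  have comp [measurable]: "(\<lambda>\<omega>. S n \<omega> $ k) \<in> borel_measurable M" for n k
    by measurable
  have Aentry: "(\<lambda>\<omega>. A n \<omega> $ k $ l) \<in> borel_measurable M" for n k l
  proof -
    have "(\<lambda>\<omega>. I n (X i \<omega>) $ k $ l) \<in> borel_measurable M" if "i \<in> {1..n}" for i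
      using measurable_compose[OF X_measurable I_entry_measurable] that by simp
    then have [measurable]: "(\<lambda>\<omega>. \<Sum>i=1..n. I n (X i \<omega>) $ k $ l) \<in> borel_measurable M"
      by (rule borel_measurable_sum)
    have "(\<lambda>\<omega>. (1 / n) * (\<Sum>i=1..n. I n (X i \<omega>) $ k $ l)) \<in> borel_measurable M" by measurable
    then show ?thesis by (simp add: A_def sum_component)
  qed
  have hsum: "(\<lambda>\<omega>. \<Sum>i=1..n. h (X i \<omega>)) \<in> borel_measurable M" for n
    using measurable_compose[OF X_measurable h(2)] by (intro borel_measurable_sum) simp
  note [measurable] = Aentry hsum
  have sets: "BT n \<in> M.events" "BS n k \<in> M.events" "BA n k l \<in> M.events" "BH n \<in> M.events" for n k l
    unfolding BT_def BS_def BA_def BH_def by measurable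
  let ?BAD = "\<lambda>n. BT n \<union> (\<Union>k. BS n k) \<union> (\<Union>k. \<Union>l. BA n k l) \<union> BH n"
  have good: "AE \<omega> in M. (\<forall>n. is_MLqE f \<Theta> (q n) n (\<lambda>i. X i \<omega>) (T n \<omega>)) \<and>
     (\<forall>i\<ge>1. taylor_dominated \<rho> N (X i \<omega>) (h (X i \<omega>)))"
  proof (rule AE_conjI)
    show "AE \<omega> in M. \<forall>n. is_MLqE f \<Theta> (q n) n (\<lambda>i. X i \<omega>) (T n \<omega>)"
      by (simp add: AE_all_countable T_MLqE)
    have "AE \<omega> in M. 1 \<le> i \<longrightarrow> taylor_dominated \<rho> N (X i \<omega>) (h (X i \<omega>))" for i
      using X_AE[OF _ dom, of i] by (cases "1 \<le> i") auto
    then show "AE \<omega> in M. \<forall>i\<ge>1. taylor_dominated \<rho> N (X i \<omega>) (h (X i \<omega>))"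
      unfolding AE_all_countable by blast
  qed
  have "\<forall>\<^sub>F n in sequentially. dist (\<theta>s n) \<theta>0 < d" using tendstoD[OF thetas_lim d(1)] .
  moreover have "\<forall>\<^sub>F n in sequentially. M.prob (BT n) < \<epsilon> / 4"
    using T_consistent d(1) \<epsilon> unfolding conv_in_prob_def BT_def by (intro order_tendstoD(2)[of _ 0]) auto
  moreover have "\<forall>\<^sub>F n in sequentially. (\<Sum>k\<in>UNIV. \<Sum>l\<in>UNIV. M.prob (BA n k l)) < \<epsilon> / 4"
  proof -
    have "(\<lambda>n. \<Sum>k\<in>UNIV. \<Sum>l\<in>UNIV. M.prob (BA n k l)) \<longlonglongrightarrow> (\<Sum>k\<in>(UNIV::'p set). \<Sum>l\<in>(UNIV::'p set). 0)"
      unfolding BA_def by (intro tendsto_sum A_entry_convergence \<eta>)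
    then show ?thesis using \<epsilon> by (intro order_tendstoD(2)[of _ 0]) auto
  qed
  ultimately have "\<forall>\<^sub>F n in sequentially. M.prob {\<omega> \<in> space M. norm (Z n \<omega> - (- (G n *v S n \<omega>))) > e} < \<epsilon>"
    using wh eventually_ge_at_top[of "max 1 N"]
  proof eventually_elim
    case (elim n)
    then have n: "n \<ge> 1" "n \<ge> N" and Jn: "\<And>v. j * norm v \<le> norm (J n *v v)" and GJ: "G n ** J n = inv_sqrt (V n)"
      and Gn: "\<And>u. norm (G n *v u) \<le> g * norm u" by (auto simp: g_def whitening_def)
    have \<theta>n: "\<theta>s n \<in> ball \<theta>0 \<rho>" using elim(1) d(2) by (simp add: dist_commute)
    have incl: "AE \<omega> in M. \<omega> \<in> {\<omega> \<in> space M. norm (Z n \<omega> - (- (G n *v S n \<omega>))) > e} \<longrightarrow> \<omega> \<in> ?BAD n"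
      using good AE_space
    proof eventually_elim
      case (elim \<omega>)
      note \<omega> = elim
      show ?case
      proof (rule impI, rule ccontr)
        assume big: "\<omega> \<in> {\<omega> \<in> space M. norm (Z n \<omega> - (- (G n *v S n \<omega>))) > e}" and nb: "\<omega> \<notin> ?BAD n"
        have Td: "dist (T n \<omega>) \<theta>0 \<le> d" and Sk: "\<And>k. \<bar>S n \<omega> $ k\<bar> \<le> L"
          and Akl: "\<And>k l. \<bar>A n \<omega> $ k $ l - J n $ k $ l\<bar> \<le> \<eta>" and Hn: "(\<Sum>i=1..n. h (X i \<omega>)) / n \<le> L'"
          using nb \<omega>(2) unfolding BT_def BS_def BA_def BH_def by (auto simp: not_less)
        let ?\<Delta> = "T n \<omega> - \<theta>s n" and ?D = "sqrt n *\<^sub>R (T n \<omega> - \<theta>s n)"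
        let ?r = "- S n \<omega> - A n \<omega> *v ?D" and ?H = "(\<Sum>i=1..n. h (X i \<omega>)) / n"
        have Tb: "T n \<omega> \<in> ball \<theta>0 \<rho>" using Td d(2) by (simp add: dist_commute)
        have \<Delta>: "norm ?\<Delta> \<le> 2 * d"
          using dist_triangle2[of "T n \<omega>" "\<theta>s n" \<theta>0] Td \<open>dist (\<theta>s n) \<theta>0 < d\<close> by (simp add: dist_norm)
        have "norm ?r \<le> (?H * norm ?\<Delta>) * norm ?D"
        proof (rule estimating_equation_remainder[OF n(1)])
          show "X i \<omega> \<in> space \<mu>" if "i \<in> {1..n}" for i
            using measurable_space[OF X_measurable \<omega>(2)] that by simp
          show "is_MLqE f \<Theta> (q n) n (\<lambda>i. X i \<omega>) (T n \<omega>)" using \<omega>(1) by blast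
          show "T n \<omega> \<in> interior \<Theta>" using Tb \<rho>(2) by blast
          show "norm (mod_score f (X i \<omega>) (T n \<omega>) (q n) - U n (X i \<omega>) - I n (X i \<omega>) *v ?\<Delta>)
              \<le> h (X i \<omega>) * (norm ?\<Delta>)\<^sup>2" if "i \<in> {1..n}" for i
            using \<omega>(1) that n(2) Tb \<theta>n unfolding taylor_dominated_def by auto
        qed
        also have "\<dots> \<le> (L' * (2 * d)) * norm ?D"
          using Hn \<Delta> L'(1) h(3) by (intro mult_right_mono mult_mono) (auto intro!: sum_nonneg divide_nonneg_nonneg)
        also have "\<dots> \<le> (\<epsilon>1 / 2) * norm ?D" using d(3) by (rule mult_right_mono) simp
        finally have r: "norm ?r \<le> (\<epsilon>1 / 2) * norm ?D" .
        have "norm ((G n ** J n) *v ?D + G n *v S n \<omega>) \<le> (2 * g * \<epsilon>1 / j) * norm (S n \<omega>)"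
          by (rule linearised_equation_error[OF j Jn Gn less_imp_le[OF g] _ Akl r])
             (use \<eta>(2) \<epsilon>1(2) in auto)
        also have "\<dots> \<le> (2 * g * \<epsilon>1 / j) * (?p * L)"
          using norm_le_of_components[OF Sk] g j \<epsilon>1(1) by (intro mult_left_mono) auto
        also have "\<dots> \<le> e" by (rule \<epsilon>1(3))
        finally have "norm (Z n \<omega> - (- (G n *v S n \<omega>))) \<le> e"
          by (simp add: Z_def GJ matrix_vector_mult_scaleR)
        then show False using big by simp
      qed
    qed
    have "M.prob {\<omega> \<in> space M. norm (Z n \<omega> - (- (G n *v S n \<omega>))) > e} \<le> M.prob (?BAD n)"
      using incl sets by (intro M.finite_measure_mono_AE) auto
    also have "\<dots> \<le> M.prob (BT n) + M.prob (\<Union>k. BS n k) + M.prob (\<Union>k. \<Union>l. BA n k l) + M.prob (BH n)"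
      using sets by (intro order_trans[OF measure_Un_le] add_mono order_refl) auto
    also have "M.prob (\<Union>k. BS n k) \<le> (\<Sum>k\<in>UNIV. M.prob (BS n k))"
      using sets by (intro measure_UNION_le) auto
    also have "(\<Sum>k\<in>UNIV. M.prob (BS n k)) \<le> (\<Sum>k\<in>(UNIV::'p set). C / L\<^sup>2)"
      unfolding BS_def by (intro sum_mono C(1) L)
    also have "M.prob (\<Union>k. \<Union>l. BA n k l) \<le> (\<Sum>k\<in>UNIV. \<Sum>l\<in>UNIV. M.prob (BA n k l))"
      using sets by (intro order_trans[OF measure_UNION_le] sum_mono measure_UNION_le) auto
    also have "M.prob (BH n) \<le> (LINT x|P. h x) / L'"
      unfolding BH_def by (rule average_tail[OF h(2,1,3) L'(1)])
    finally have total: "M.prob {\<omega> \<in> space M. norm (Z n \<omega> - (- (G n *v S n \<omega>))) > e}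
      \<le> M.prob (BT n) + (\<Sum>k\<in>(UNIV::'p set). C / L\<^sup>2) + (\<Sum>k\<in>UNIV. \<Sum>l\<in>UNIV. M.prob (BA n k l))
        + (LINT x|P. h x) / L'" by simp
    have "(\<Sum>k\<in>(UNIV::'p set). C / L\<^sup>2) = ?p * (C / L\<^sup>2)" by simp
    then show ?case using total elim(2,3) L(2) L'(2) by linarith
  qed
  then show "\<exists>n0. \<forall>n\<ge>n0. norm (M.prob {\<omega> \<in> space M. norm (Z n \<omega> - (- (G n *v S n \<omega>))) > e} - 0) < \<epsilon>"
    by (simp add: eventually_sequentially)
qed

text \<open>A linear form \<open>t \<bullet> (- G n S n)\<close> is a normalised row sum whose summands have variance
  \<open>t \<bullet> t\<close> exactly, by whitening, and third absolute moments bounded through \<open>\<bar>G\<^sub>n\<^sup>T t\<bar>\<close>.\<close>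

lemma whitened_score_char_limit:
  "(\<lambda>n. LINT \<omega>|M. iexp (t \<bullet> (- (G n *v S n \<omega>)))) \<longlonglongrightarrow> exp (- (norm t)\<^sup>2 / 2)"
proof -
  obtain j c where "j > 0" and c: "c > 0" and wh: "\<forall>\<^sub>F n in sequentially. whitening j c n"
    by (rule whitening_eventually) (rule that; assumption)
  obtain C where C: "\<And>n. integrable P (\<lambda>x. norm (U n x) ^ 3)" "\<And>n. (LINT x|P. norm (U n x) ^ 3) \<le> C"
    by (rule U_third_moment) (rule that; assumption)
  have "0 \<le> (LINT x|P. norm (U 0 x) ^ 3)" by simp
  then have C0: "0 \<le> C" using C(2)[of 0] by linarith
  define a where "a n = - (transpose (G n) *v t)" for n
  define \<xi> where "\<xi> n x = a n \<bullet> U n x" for n x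
  have \<xi>m [measurable]: "\<xi> n \<in> borel_measurable \<mu>" for n unfolding \<xi>_def[abs_def] by measurable
  have eq: "t \<bullet> (- (G n *v S n \<omega>)) = (\<Sum>i=1..n. \<xi> n (X i \<omega>)) / sqrt n" for n \<omega>
  proof -
    have "t \<bullet> (- (G n *v S n \<omega>)) = a n \<bullet> S n \<omega>"
      by (simp only: inner_minus_right inner_minus_left transpose_vector_inner a_def)
    then show ?thesis by (simp add: S_def \<xi>_def inner_sum_right)
  qed
  have "(\<lambda>n. LINT \<omega>|M. iexp ((\<Sum>i=1..n. \<xi> n (X i \<omega>)) / sqrt n)) \<longlonglongrightarrow> exp (- (t \<bullet> t) / 2)"
  proof (rule M.char_triangular_array_limit[where \<nu>="\<lambda>n. distr P borel (\<xi> n)" and C="(norm t / sqrt c) ^ 3 * C"])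
    show "\<forall>\<^sub>F n in sequentially. M.indep_vars (\<lambda>_. borel) (\<lambda>i \<omega>. \<xi> n (X i \<omega>)) {1..n} \<and>
      (\<forall>i\<in>{1..n}. distr M borel (\<lambda>\<omega>. \<xi> n (X i \<omega>)) = distr P borel (\<xi> n)) \<and>
      integrable (distr P borel (\<xi> n)) (\<lambda>x. \<bar>x\<bar> ^ 3) \<and> (LINT x|distr P borel (\<xi> n). x) = 0 \<and>
      (LINT x|distr P borel (\<xi> n). x\<^sup>2) = t \<bullet> t \<and>
      (LINT x|distr P borel (\<xi> n). \<bar>x\<bar> ^ 3) \<le> (norm t / sqrt c) ^ 3 * C"
      using wh
    proof eventually_elim
      case (elim n)
      have an: "norm (a n) \<le> norm t / sqrt c" using elim by (simp add: a_def whitening_def del: transpose_matrix_vector)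
      have "a n \<bullet> (K n *v a n) = (transpose (G n) *v t) \<bullet> (K n *v (transpose (G n) *v t))"
        by (simp add: a_def linear_neg[OF matrix_vector_mul_linear] del: transpose_matrix_vector)
      then have aK: "(LINT x|P. (a n \<bullet> U n x)\<^sup>2) = t \<bullet> t" using elim by (simp add: K_quadratic_form[symmetric] whitening_def)
      have dist: "distr M borel (\<lambda>\<omega>. \<xi> n (X i \<omega>)) = distr P borel (\<xi> n)" if "i \<in> {1..n}" for i
      proof -
        have "distr M borel (\<lambda>\<omega>. \<xi> n (X i \<omega>)) = distr (distr M \<mu> (X i)) borel (\<xi> n)"
          using that by (subst distr_distr[OF \<xi>m X_measurable]) (auto simp: comp_def)
        then show ?thesis using that by (simp add: X_distr)
      qed
      have "(LINT x|P. \<bar>a n \<bullet> U n x\<bar> ^ 3) \<le> (LINT x|P. norm (a n) ^ 3 * norm (U n x) ^ 3)"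
        by (intro integral_mono U_inner_integrable integrable_mult_right C U_inner_cubed_le)
      also have "\<dots> \<le> (norm t / sqrt c) ^ 3 * C"
        using C(2)[of n] an C0 c by (simp add: mult_mono power_mono)
      finally have m3: "(LINT x|P. \<bar>a n \<bullet> U n x\<bar> ^ 3) \<le> (norm t / sqrt c) ^ 3 * C" .
      have \<xi>P: "\<xi> n \<in> borel_measurable P" by simp
      show ?case
      proof (intro conjI ballI indep_transformed[OF \<xi>m] dist)
        show "integrable (distr P borel (\<xi> n)) (\<lambda>x. \<bar>x\<bar> ^ 3)"
          by (subst integrable_distr_eq[OF \<xi>P]) (simp_all add: \<xi>_def U_inner_integrable)
        show "(LINT x|distr P borel (\<xi> n). x) = 0"
          using U_inner_mean[of "a n" n]
          by (subst integral_distr[OF \<xi>P]) (simp_all add: \<xi>_def[abs_def])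
        show "(LINT x|distr P borel (\<xi> n). x\<^sup>2) = t \<bullet> t"
          by (subst integral_distr[OF \<xi>P]) (simp_all add: \<xi>_def aK)
        show "(LINT x|distr P borel (\<xi> n). \<bar>x\<bar> ^ 3) \<le> (norm t / sqrt c) ^ 3 * C"
          by (subst integral_distr[OF \<xi>P]) (simp_all add: \<xi>_def m3)
      qed
    qed
  qed simp
  then show ?thesis unfolding eq by (simp add: power2_norm_eq_inner)
qed

theorem estimator_asymptotically_normal: "weak_conv_vec (\<lambda>n. distr M borel (Z n)) std_normal_vec"
proof (rule levy_continuity_vec)
  show "prob_space (distr M borel (Z n))" for n by (rule M.prob_space_distr) simp
  show "prob_space (std_normal_vec :: (real^'p) measure)" by (rule prob_space_std_normal_vec)
  show "sets (std_normal_vec :: (real^'p) measure) = sets borel" by (simp add: std_normal_vec_def)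
  fix t :: "real^'p"
  have "(\<lambda>n. (LINT \<omega>|M. iexp (t \<bullet> Z n \<omega>)) - (LINT \<omega>|M. iexp (t \<bullet> (- (G n *v S n \<omega>))))) \<longlonglongrightarrow> 0"
    by (rule M.char_diff_tendsto_zero[OF _ _ remainder_negligible]) auto
  from tendsto_add[OF this whitened_score_char_limit[of t]]
  have "(\<lambda>n. LINT \<omega>|M. iexp (t \<bullet> Z n \<omega>)) \<longlonglongrightarrow> exp (- (norm t)\<^sup>2 / 2)" by simp
  then show "(\<lambda>n. LINT y|distr M borel (Z n). iexp (t \<bullet> y)) \<longlonglongrightarrow> (LINT y|std_normal_vec. iexp (t \<bullet> y))"
    unfolding char_std_normal_vec by (simp add: integral_distr)
qed simp

end

section \<open>Asymptotic normality\<close>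

theorem theorem4p3:
  fixes \<mu> :: "'a measure"
    and \<Theta> :: "(real^'p) set"
    and f :: "'a \<Rightarrow> real^'p \<Rightarrow> real"
    and \<theta>0 :: "real^'p"
    and M :: "'w measure"
    and X :: "nat \<Rightarrow> 'w \<Rightarrow> 'a"
    and q :: "nat \<Rightarrow> real"
    and \<theta>s T :: "nat \<Rightarrow> _"
  defines "P \<equiv> law \<mu> f \<theta>0"
  assumes mu: "sigma_finite_measure \<mu>"
    and family: "density_family \<mu> \<Theta> f"
    and theta0: "\<theta>0 \<in> interior \<Theta>"
    and M: "prob_space M"
    and indep: "prob_space.indep_vars M (\<lambda>_. \<mu>) X {1..}"
    and distr: "\<And>i. i \<ge> 1 \<Longrightarrow> distributed M \<mu> (X i) (\<lambda>x. ennreal (f x \<theta>0))"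
    and q_pos: "\<And>n. 0 < q n"
    and q_lim: "q \<longlonglongrightarrow> 1"
    and thetas_mem: "\<And>n. \<theta>s n \<in> interior \<Theta>"
    and thetas_eq: "\<And>n. (LINT x|P. mod_score f x (\<theta>s n) (q n)) = 0"
    and thetas_lim: "\<theta>s \<longlonglongrightarrow> \<theta>0"
    and diff_f: "\<And>x \<theta>. x \<in> space \<mu> \<Longrightarrow> \<theta> \<in> interior \<Theta> \<Longrightarrow> f x differentiable (at \<theta>)"
    and diff_U: "\<And>x \<theta> r. x \<in> space \<mu> \<Longrightarrow> \<theta> \<in> interior \<Theta> \<Longrightarrow> 0 < r \<Longrightarrow>
                   twice_differentiable_at (\<lambda>t. mod_score f x t r) \<theta>"
    and C1: "\<exists>C::real. \<forall>n. (MAX k. \<integral>\<^sup>+x. ennreal (\<bar>mod_score f x (\<theta>s n) (q n) $ k\<bar> ^ 3) \<partial>P) \<le> ennreal C"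
    and C2: "\<exists>c>0. \<forall>n. c \<le> smallest_eigenvalue (K_mat P f (\<theta>s n) (q n))"
    and C3: "\<exists>C::real. \<forall>n k l. (\<integral>\<^sup>+x. ennreal ((mod_info f x (\<theta>s n) (q n) $ k $ l)\<^sup>2) \<partial>P) \<le> ennreal C"
    and C4: "\<exists>A B h. open A \<and> \<theta>0 \<in> A \<and> A \<subseteq> \<Theta> \<and> open B \<and> 1 \<in> B \<and> integrable P h \<and>
               (AE x in P. \<forall>n. q n \<in> B \<longrightarrow> (\<forall>\<theta>\<in>A. \<forall>k l m.
                  \<bar>mod_score_d2 f x \<theta> (q n) k l m\<bar> \<le> (h x :: real)))"
    and T_meas: "\<And>n. T n \<in> borel_measurable M"
    and T_MLqE: "\<And>n. AE \<omega> in M. is_MLqE f \<Theta> (q n) n (\<lambda>i. X i \<omega>) (T n \<omega>)"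
    and T_consistent: "conv_in_prob M T \<theta>0"
  shows "weak_conv_vec
           (\<lambda>n. distr M borel
              (\<lambda>\<omega>. sqrt (real n) *\<^sub>R (inv_sqrt (V_mat P f (\<theta>s n) (q n)) *v (T n \<omega> - \<theta>s n))))
           std_normal_vec"
proof -
  interpret M: prob_space M by (rule M)
  interpret mlqe_sample \<mu> \<Theta> f \<theta>0 q \<theta>s M X T
  proof unfold_locales
    show "density_family \<mu> \<Theta> f" by (rule family)
    show "\<exists>C::real. \<forall>n. (MAX k. \<integral>\<^sup>+x. ennreal (\<bar>mod_score f x (\<theta>s n) (q n) $ k\<bar> ^ 3) \<partial>law \<mu> f \<theta>0) \<le> ennreal C"
      using C1 unfolding P_def .
    show "\<exists>c>0. \<forall>n. c \<le> smallest_eigenvalue (K_mat (law \<mu> f \<theta>0) f (\<theta>s n) (q n))"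
      using C2 unfolding P_def .
    show "\<exists>C::real. \<forall>n k l. (\<integral>\<^sup>+x. ennreal ((mod_info f x (\<theta>s n) (q n) $ k $ l)\<^sup>2) \<partial>law \<mu> f \<theta>0) \<le> ennreal C"
      using C3 unfolding P_def .
    show "\<exists>A B h. open A \<and> \<theta>0 \<in> A \<and> A \<subseteq> \<Theta> \<and> open B \<and> 1 \<in> B \<and> integrable (law \<mu> f \<theta>0) h \<and>
        (AE x in law \<mu> f \<theta>0. \<forall>n. q n \<in> B \<longrightarrow> (\<forall>\<theta>\<in>A. \<forall>k l m.
           \<bar>mod_score_d2 f x \<theta> (q n) k l m\<bar> \<le> (h x :: real)))"
      using C4 unfolding P_def .
    show "(LINT x|law \<mu> f \<theta>0. mod_score f x (\<theta>s n) (q n)) = 0" for n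
      using thetas_eq unfolding P_def .
  qed (fact diff_f diff_U theta0 q_pos q_lim thetas_mem thetas_lim indep distr T_meas T_MLqE T_consistent)+
  show ?thesis
    using estimator_asymptotically_normal unfolding Z_def[abs_def] P_def .
qed

end
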